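(* Let $T\in[0,\infty)$. Let $\Phi$ be a locally bounded edge loading operator such that $\Phi_T$ is sequentially weak-weak continuous with respect to $\|\cdot\|_p$. Let $\mathcal R$ be a routing operator such that $\mathcal R_T$ is regular and has non-empty and convex values (i.e. $\mathcal R_T(f)$ is non-empty and convex for every $f\in\mathcal F_T^{E\times I\times\{+,-\}}$). Then there exists a flow $f\in\mathcal F_T^{E\times I\times\{+,-\}}$ which is coherent until time $T$.
   Context: Fix $p\in(1,\infty)$ and let $q$ satisfy $1/p+1/q=1$. $\lambda$ is Lebesgue measure; (in)equalities between functions of time are meant almost everywhere. $\mathbf 1_J$ is the indicator function of $J\subseteq\mathbb R$; $\mathbf 1_A\in\{0,1\}$ is the truth value of a statement $A$. $\mathcal F\subset L^p_{\mathrm{loc}}(\mathbb R)$ is the set of non-negative locally $p$-integrable functions vanishing on $(-\infty,0)$; $\mathcal S$ is the set of measurable functions $\mathbb R\to[0,1]$. For $T\in[0,\infty]$, $\mathcal F_T,\mathcal S_T$ are the subsets of functions vanishing outside $[0,T)$. Finite products of normed spaces carry the maximum of the component norms. Network: $G=(V,E)$ is a finite directed graph; $\delta^+(v),\delta^-(v)$ are the sets of edges leaving and entering $v$; $e=vw$ means $e$ leads from $v$ to $w$. $I$ is a finite set of commodities; each $i\in I$ has a destination $t_i\in V$ reachable from every node, and network inflow rates $u_{v,i}\in\mathcal F$ ($v\in V$). A flow is a vector $f=(f^+,f^-)\in\mathcal F^{E\times I\times\{+,-\}}$ of edge inflow rates $f^+_{e,i}$ and edge outflow rates $f^-_{e,i}$.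 An edge loading operator is a map $\Phi:\mathcal F^{E\times I}\to\mathcal F^{E\times I}$. It is locally bounded if for every $T\in[0,\infty)$ there is $B'_T\ge 0$ with $\|\mathbf 1_{[0,T]}\Phi(f^+)\|_p\le B'_T$ for all $f^+\in\mathcal F^{E\times I}$. For finite $T$, $\Phi_T:\mathcal F_T^{E\times I}\to\mathcal F_T^{E\times I}$, $f^+\mapsto \mathbf 1_{[0,T]}\Phi(f^+)$. A map is sequentially weak-weak continuous with respect to $\|\cdot\|_p$ if it maps weakly convergent sequences (in $L^p$, with limit in the domain) to sequences converging weakly to the image of the limit. A routing operator is a set-valued map $\mathcal R:\mathcal F^{E\times I\times\{+,-\}}\rightrightarrows\mathcal S^{E\times I}$ such that every $r\in\mathcal R(f)$ satisfies $\sum_{e\in\delta^+(v)}r_{e,i}=\mathbf 1_{v\ne t_i}$ for all $v\in V,i\in I$. For finite $T$, $\mathcal R_T:\mathcal F_T^{E\times I\times\{+,-\}}\rightrightarrows\mathcal S_T^{E\times I}$, $\mathcal R_T(f)=\{\mathbf 1_{[0,T]}r : r\in\mathcal R(f)\}$. $\mathcal R_T$ is regular if the graph of $$\tilde\Gamma:\mathcal F_T^{E\times I\times\{+,-\}}\times\mathcal F_T^{V\times I}\rightrightarrows\mathcal F_T^{E\times I},\quad (f,\tilde g)\mapsto\{g^+\in\mathcal F_T^{E\times I} : \exists r\in\mathcal R_T(f)\ \forall e=vw\in E,\ i\in I:\ g^+_{e,i}=r_{e,i}\tilde g_{v,i}\}$$ is sequentially weakly closed with respect to $\|\cdot\|_p$,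 where the graph of $\Gamma:M\rightrightarrows N$ is $\{(x,y)\in M\times N: y\in\Gamma(x)\}$. A flow $f$ is coherent until $T\in[0,\infty]$ if for almost all $\theta<T$ and all $i\in I$: (a) (consistency with $\Phi$) $f^-_{e,i}(\theta)=\Phi(f^+)_{e,i}(\theta)$ for all $e\in E$; (b) (flow conservation) $\sum_{e\in\delta^+(v)}f^+_{e,i}(\theta)=\mathbf 1_{v\ne t_i}\bigl(u_{v,i}(\theta)+\sum_{e\in\delta^-(v)}f^-_{e,i}(\theta)\bigr)$ for all $v\in V$; and (c) (consistency with $\mathcal R$) there is a single $r\in\mathcal R(f)$ (independent of $\theta,i$) with $f^+_{e,i}(\theta)=r_{e,i}(\theta)\sum_{e'\in\delta^+(v)}f^+_{e',i}(\theta)$ for all $e=vw\in E$. *)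

theory Defs
  imports "HOL-Analysis.Analysis" "Graph_Theory.Digraph"
begin

text \<open>
  Functions of time are represented by functions \<open>real \<Rightarrow> real\<close>, and all (in)equalities between
  them are required almost everywhere. A vector indexed by a finite set \<open>K\<close> is a function
  \<open>'k \<Rightarrow> real \<Rightarrow> real\<close> whose values outside \<open>K\<close> are irrelevant. Thus the elements of the spaces
  of the theory are classes modulo \<open>ae_eq_on K\<close>; operators and set-valued maps are required to be
  compatible with this relation.
\<close>

definition ae_eq_on :: "'k set \<Rightarrow> ('k \<Rightarrow> real \<Rightarrow> real) \<Rightarrow> ('k \<Rightarrow> real \<Rightarrow> real) \<Rightarrow> bool" where
  "ae_eq_on K x y \<longleftrightarrow> (\<forall>k\<in>K. AE \<theta> in lebesgue. x k \<theta> = y k \<theta>)"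

definition vectors :: "'k set \<Rightarrow> (real \<Rightarrow> real) set \<Rightarrow> ('k \<Rightarrow> real \<Rightarrow> real) set" where
  "vectors K X = Pi K (\<lambda>_. X)"

definition truncate :: "real \<Rightarrow> ('k \<Rightarrow> real \<Rightarrow> real) \<Rightarrow> 'k \<Rightarrow> real \<Rightarrow> real" where
  "truncate T x = (\<lambda>k \<theta>. indicator {0..T} \<theta> * x k \<theta>)"

subsection \<open>Lebesgue spaces and weak convergence\<close>

definition Lp :: "real \<Rightarrow> (real \<Rightarrow> real) set" where
  "Lp p = {h \<in> borel_measurable lebesgue. integrable lebesgue (\<lambda>\<theta>. \<bar>h \<theta>\<bar> powr p)}"

definition Lp_norm :: "real \<Rightarrow> (real \<Rightarrow> real) \<Rightarrow> real" where
  "Lp_norm p h = (LINT \<theta>|lebesgue. \<bar>h \<theta>\<bar> powr p) powr (1 / p)"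

text \<open>The maximum norm on \<open>vectors K (Lp p)\<close>; inserting \<open>0\<close> only matters for \<open>K = {}\<close>.\<close>

definition vec_norm :: "real \<Rightarrow> 'k set \<Rightarrow> ('k \<Rightarrow> real \<Rightarrow> real) \<Rightarrow> real" where
  "vec_norm p K x = Max (insert 0 ((\<lambda>k. Lp_norm p (x k)) ` K))"

text \<open>
  Continuous linear functionals on \<open>vectors K (Lp p)\<close>. Boundedness and linearity imply that such a
  functional is invariant under \<open>ae_eq_on K\<close>.
\<close>

definition Lp_dual :: "real \<Rightarrow> 'k set \<Rightarrow> (('k \<Rightarrow> real \<Rightarrow> real) \<Rightarrow> real) set" where
  "Lp_dual p K = {\<phi>.
     (\<forall>x\<in>vectors K (Lp p). \<forall>y\<in>vectors K (Lp p). \<phi> (\<lambda>k \<theta>. x k \<theta> + y k \<theta>) = \<phi> x + \<phi> y) \<and>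
     (\<forall>c. \<forall>x\<in>vectors K (Lp p). \<phi> (\<lambda>k \<theta>. c * x k \<theta>) = c * \<phi> x) \<and>
     (\<exists>C. \<forall>x\<in>vectors K (Lp p). \<bar>\<phi> x\<bar> \<le> C * vec_norm p K x)}"

definition weakly_converges ::
  "real \<Rightarrow> 'k set \<Rightarrow> (nat \<Rightarrow> 'k \<Rightarrow> real \<Rightarrow> real) \<Rightarrow> ('k \<Rightarrow> real \<Rightarrow> real) \<Rightarrow> bool" where
  "weakly_converges p K x y \<longleftrightarrow>
     (\<forall>n. x n \<in> vectors K (Lp p)) \<and> y \<in> vectors K (Lp p) \<and>
     (\<forall>\<phi>\<in>Lp_dual p K. (\<lambda>n. \<phi> (x n)) \<longlonglongrightarrow> \<phi> y)"

definition seq_weakly_closed :: "real \<Rightarrow> 'k set \<Rightarrow> ('k \<Rightarrow> real \<Rightarrow> real) set \<Rightarrow> bool" where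
  "seq_weakly_closed p K A \<longleftrightarrow>
     (\<forall>x y. (\<forall>n. x n \<in> A) \<and> weakly_converges p K x y \<longrightarrow> y \<in> A)"

definition seq_weak_weak_continuous_on ::
  "real \<Rightarrow> 'k set \<Rightarrow> 'l set \<Rightarrow> ('k \<Rightarrow> real \<Rightarrow> real) set \<Rightarrow>
    (('k \<Rightarrow> real \<Rightarrow> real) \<Rightarrow> 'l \<Rightarrow> real \<Rightarrow> real) \<Rightarrow> bool" where
  "seq_weak_weak_continuous_on p K L D \<Psi> \<longleftrightarrow>
     (\<forall>x y. (\<forall>n. x n \<in> D) \<and> y \<in> D \<and> weakly_converges p K x y \<longrightarrow>
        weakly_converges p L (\<lambda>n. \<Psi> (x n)) (\<Psi> y))"

definition convex_vectors :: "('k \<Rightarrow> real \<Rightarrow> real) set \<Rightarrow> bool" where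
  "convex_vectors A \<longleftrightarrow>
     (\<forall>x\<in>A. \<forall>y\<in>A. \<forall>a\<ge>0. \<forall>b\<ge>0. a + b = 1 \<longrightarrow> (\<lambda>k \<theta>. a * x k \<theta> + b * y k \<theta>) \<in> A)"

subsection \<open>The function spaces for flows and routings\<close>

definition rates :: "real \<Rightarrow> (real \<Rightarrow> real) set" where
  "rates p = {h \<in> borel_measurable lebesgue.
     (\<forall>C. compact C \<longrightarrow> set_integrable lebesgue C (\<lambda>\<theta>. \<bar>h \<theta>\<bar> powr p)) \<and>
     (AE \<theta> in lebesgue. 0 \<le> h \<theta>) \<and> (AE \<theta> in lebesgue. \<theta> < 0 \<longrightarrow> h \<theta> = 0)}"

definition shares :: "(real \<Rightarrow> real) set" where
  "shares = {h \<in> borel_measurable lebesgue. AE \<theta> in lebesgue. 0 \<le> h \<theta> \<and> h \<theta> \<le> 1}"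

definition vanishing_outside :: "ereal \<Rightarrow> (real \<Rightarrow> real) set" where
  "vanishing_outside T = {h. AE \<theta> in lebesgue. \<not> (0 \<le> \<theta> \<and> ereal \<theta> < T) \<longrightarrow> h \<theta> = 0}"

definition rates_until :: "real \<Rightarrow> ereal \<Rightarrow> (real \<Rightarrow> real) set" where
  "rates_until p T = rates p \<inter> vanishing_outside T"

definition shares_until :: "ereal \<Rightarrow> (real \<Rightarrow> real) set" where
  "shares_until T = shares \<inter> vanishing_outside T"

subsection \<open>Flows, edge loading and routing\<close>

datatype side = Inflow | Outflow

type_synonym ('e, 'i) flow = "'e \<times> 'i \<times> side \<Rightarrow> real \<Rightarrow> real"

definition flow_index :: "('v, 'e) pre_digraph \<Rightarrow> 'i set \<Rightarrow> ('e \<times> 'i \<times> side) set" where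
  "flow_index G I = arcs G \<times> I \<times> UNIV"

definition edge_inflow :: "('e, 'i) flow \<Rightarrow> 'e \<times> 'i \<Rightarrow> real \<Rightarrow> real" where
  "edge_inflow f = (\<lambda>(e, i). f (e, i, Inflow))"

definition edge_outflow :: "('e, 'i) flow \<Rightarrow> 'e \<times> 'i \<Rightarrow> real \<Rightarrow> real" where
  "edge_outflow f = (\<lambda>(e, i). f (e, i, Outflow))"

type_synonym ('e, 'i) loading = "('e \<times> 'i \<Rightarrow> real \<Rightarrow> real) \<Rightarrow> 'e \<times> 'i \<Rightarrow> real \<Rightarrow> real"

definition edge_loading_operator ::
  "real \<Rightarrow> ('v, 'e) pre_digraph \<Rightarrow> 'i set \<Rightarrow> ('e, 'i) loading \<Rightarrow> bool" where
  "edge_loading_operator p G I \<Phi> \<longleftrightarrow>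
     (\<forall>x\<in>vectors (arcs G \<times> I) (rates p). \<Phi> x \<in> vectors (arcs G \<times> I) (rates p)) \<and>
     (\<forall>x\<in>vectors (arcs G \<times> I) (rates p). \<forall>y\<in>vectors (arcs G \<times> I) (rates p).
        ae_eq_on (arcs G \<times> I) x y \<longrightarrow> ae_eq_on (arcs G \<times> I) (\<Phi> x) (\<Phi> y))"

definition locally_bounded ::
  "real \<Rightarrow> ('v, 'e) pre_digraph \<Rightarrow> 'i set \<Rightarrow> ('e, 'i) loading \<Rightarrow> bool" where
  "locally_bounded p G I \<Phi> \<longleftrightarrow>
     (\<forall>T\<ge>0. \<exists>B\<ge>0. \<forall>x\<in>vectors (arcs G \<times> I) (rates p).
        vec_norm p (arcs G \<times> I) (truncate T (\<Phi> x)) \<le> B)"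

definition loading_until :: "real \<Rightarrow> ('e, 'i) loading \<Rightarrow> ('e, 'i) loading" where
  "loading_until T \<Phi> = (\<lambda>x. truncate T (\<Phi> x))"

type_synonym ('e, 'i) routing = "('e, 'i) flow \<Rightarrow> ('e \<times> 'i \<Rightarrow> real \<Rightarrow> real) set"

text \<open>The last two conjuncts express that \<open>\<R>\<close> maps classes to sets of classes.\<close>

definition routing_operator ::
  "real \<Rightarrow> ('v, 'e) pre_digraph \<Rightarrow> 'i set \<Rightarrow> ('i \<Rightarrow> 'v) \<Rightarrow> ('e, 'i) routing \<Rightarrow> bool" where
  "routing_operator p G I t \<R> \<longleftrightarrow>
     (\<forall>f\<in>vectors (flow_index G I) (rates p). \<forall>r\<in>\<R> f.
        r \<in> vectors (arcs G \<times> I) shares \<and>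
        (\<forall>v\<in>verts G. \<forall>i\<in>I. AE \<theta> in lebesgue.
           (\<Sum>e\<in>out_arcs G v. r (e, i) \<theta>) = of_bool (v \<noteq> t i))) \<and>
     (\<forall>f\<in>vectors (flow_index G I) (rates p). \<forall>f'\<in>vectors (flow_index G I) (rates p).
        ae_eq_on (flow_index G I) f f' \<longrightarrow> \<R> f = \<R> f') \<and>
     (\<forall>f\<in>vectors (flow_index G I) (rates p). \<forall>r\<in>\<R> f.
        \<forall>r'\<in>vectors (arcs G \<times> I) shares. ae_eq_on (arcs G \<times> I) r r' \<longrightarrow> r' \<in> \<R> f)"

definition routing_until ::
  "real \<Rightarrow> ('v, 'e) pre_digraph \<Rightarrow> 'i set \<Rightarrow> ('e, 'i) routing \<Rightarrow> ('e, 'i) routing" where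
  "routing_until T G I \<R> = (\<lambda>f. {s \<in> vectors (arcs G \<times> I) (shares_until T).
     \<exists>r\<in>\<R> f. ae_eq_on (arcs G \<times> I) s (truncate T r)})"

text \<open>The graph of \<open>\<Gamma>\<close>-tilde, with node flows \<open>g\<close> and edge inflows \<open>h\<close>.\<close>

definition routing_graph ::
  "real \<Rightarrow> real \<Rightarrow> ('v, 'e) pre_digraph \<Rightarrow> 'i set \<Rightarrow> ('e, 'i) routing \<Rightarrow>
    ((('e, 'i) flow \<times> ('v \<times> 'i \<Rightarrow> real \<Rightarrow> real)) \<times> ('e \<times> 'i \<Rightarrow> real \<Rightarrow> real)) set" where
  "routing_graph p T G I \<R> = {((f, g), h).
     f \<in> vectors (flow_index G I) (rates_until p T) \<and>
     g \<in> vectors (verts G \<times> I) (rates_until p T) \<and>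
     h \<in> vectors (arcs G \<times> I) (rates_until p T) \<and>
     (\<exists>r\<in>routing_until T G I \<R> f. \<forall>e\<in>arcs G. \<forall>i\<in>I. AE \<theta> in lebesgue.
        h (e, i) \<theta> = r (e, i) \<theta> * g (tail G e, i) \<theta>)}"

text \<open>
  To speak about weak convergence in a product of three spaces of vectors, a triple of vectors is
  identified with a single vector indexed by the disjoint sum of the index sets.
\<close>

definition join :: "(('a \<Rightarrow> 'x) \<times> ('b \<Rightarrow> 'x)) \<times> ('c \<Rightarrow> 'x) \<Rightarrow> ('a + 'b) + 'c \<Rightarrow> 'x" where
  "join = (\<lambda>((f, g), h). case_sum (case_sum f g) h)"

definition regular_routing_until ::
  "real \<Rightarrow> real \<Rightarrow> ('v, 'e) pre_digraph \<Rightarrow> 'i set \<Rightarrow> ('e, 'i) routing \<Rightarrow> bool" where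
  "regular_routing_until p T G I \<R> \<longleftrightarrow>
     seq_weakly_closed p ((flow_index G I <+> verts G \<times> I) <+> arcs G \<times> I)
       (join ` routing_graph p T G I \<R>)"

definition coherent_until ::
  "ereal \<Rightarrow> ('v, 'e) pre_digraph \<Rightarrow> 'i set \<Rightarrow> ('i \<Rightarrow> 'v) \<Rightarrow> ('v \<times> 'i \<Rightarrow> real \<Rightarrow> real) \<Rightarrow>
    ('e, 'i) loading \<Rightarrow> ('e, 'i) routing \<Rightarrow> ('e, 'i) flow \<Rightarrow> bool" where
  "coherent_until T G I t u \<Phi> \<R> f \<longleftrightarrow>
     (\<exists>r\<in>\<R> f. AE \<theta> in lebesgue. ereal \<theta> < T \<longrightarrow> (\<forall>i\<in>I.
        (\<forall>e\<in>arcs G. edge_outflow f (e, i) \<theta> = \<Phi> (edge_inflow f) (e, i) \<theta>) \<and>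
        (\<forall>v\<in>verts G. (\<Sum>e\<in>out_arcs G v. edge_inflow f (e, i) \<theta>) =
           of_bool (v \<noteq> t i) * (u (v, i) \<theta> + (\<Sum>e\<in>in_arcs G v. edge_outflow f (e, i) \<theta>))) \<and>
        (\<forall>e\<in>arcs G. edge_inflow f (e, i) \<theta> =
           r (e, i) \<theta> * (\<Sum>e'\<in>out_arcs G (tail G e). edge_inflow f (e', i) \<theta>))))"

end

theory Submission
  imports Defs "HOL-Probability.Distribution_Functions"
begin

text \<open>
  A coherent flow is a fixed point: edge inflows \<open>x\<close> determine edge outflows through the loading
  operator, these determine the flows arriving at the nodes, and splitting the latter according to
  the routing operator gives a set of possible new edge inflows. Since shares lie between 0 and 1,
  this correspondence maps a ball of non-negative functions in \<open>L\<^sup>p\<close> to itself. The moments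
  \<open>\<integral>\<^sub>0\<^sup>s x\<^sub>k\<close> with rational \<open>s\<close> separate the points of the ball, and weak convergence in it is
  convergence of all moments; so the ball becomes a compact convex subset of the space of real
  sequences, where Kakutani's theorem applies. That theorem is derived from Brouwer's theorem for the
  Hilbert cube, which follows from Kuhn's combinatorial lemma on ever finer and higher-dimensional
  grids. Weak compactness of the ball comes from uniform convexity, without identifying the dual space.
\<close>

section \<open>Fixed points in spaces of sequences\<close>

text \<open>The hypotheses on both operators are sequential and weak. A countable family of moments
  is what makes this enough: the image of the ball is metrisable, so Kakutani's theorem needs a
  closed graph for sequences only. The main obstacle is that weak convergence of the shares and of
  the node flows says nothing about their products. The correspondence is therefore arranged so that
  the product occurs only inside \<open>routing_graph\<close>, with the node inflow as an argument
  of its own, next to the induced flow. The node inflow is computed from the edge outflows and not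
  by summing the edge inflows. It is thus affine in quantities controlled by \<open>\<Phi>\<close>,
  so it inherits weak convergence and a bound that does not depend on \<open>x\<close>; this bound
  fixes the size of the ball. Convexity survives because all elements of one value split the same
  node inflow. Passing to moments also takes the quotient by almost everywhere equality, at the
  price of checking that rerouting respects it.\<close>

lemma tendsto_fun_iff:
  fixes X :: "'b \<Rightarrow> 'a::countable \<Rightarrow> 'c::metric_space"
  shows "(X \<longlongrightarrow> x) F \<longleftrightarrow> (\<forall>i. ((\<lambda>n. X n i) \<longlongrightarrow> x i) F)"
  using limitin_componentwise[of "\<lambda>_. euclidean" UNIV X x F]
  by (simp add: euclidean_product_topology)

text \<open>Tychonoff's theorem. Over a countable index type the product is metrisable, so
  subsequences can be extracted from it.\<close>

lemma compact_box_fun: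
  fixes a b :: "'a::countable \<Rightarrow> real"
  shows "compact (Pi UNIV (\<lambda>i. {a i..b i}))"
proof -
  have "compactin (product_topology (\<lambda>_::'a. euclidean::real topology) UNIV) (PiE UNIV (\<lambda>i. {a i..b i}))"
    by (subst compactin_PiE) auto
  thus ?thesis
    by (simp add: euclidean_product_topology PiE_UNIV_domain)
qed

text \<open>The number \<open>p\<close> is both the resolution of the grid and the number of active
  coordinates; all others are set to 0. This is harmless, because coordinate \<open>i\<close> is
  examined only for \<open>p > i\<close>. The cells shrink in every coordinate, so the points chosen
  in them have one common limit \<open>x\<close>, although they change with \<open>i\<close>; there
  the two opposite inequalities for coordinate \<open>i\<close> become an equality.\<close>

lemma brouwer_Hilbert_cube:
  fixes f :: "(nat \<Rightarrow> real) \<Rightarrow> nat \<Rightarrow> real"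
  assumes cont: "continuous_on (UNIV \<rightarrow> {0..1}) f"
    and maps: "f \<in> (UNIV \<rightarrow> {0..1}) \<rightarrow> (UNIV \<rightarrow> {0..1})"
  shows "\<exists>x\<in>UNIV \<rightarrow> {0..1}. f x = x"
proof -
  define Q :: "(nat \<Rightarrow> real) set" where "Q = UNIV \<rightarrow> {0..1}"
  have Q: "x \<in> Q \<longleftrightarrow> (\<forall>i. 0 \<le> x i \<and> x i \<le> 1)" for x
    by (auto simp: Q_def Pi_iff)
  have fQ: "f x \<in> Q" if "x \<in> Q" for x using maps that by (auto simp: Q_def)
  define emb :: "nat \<Rightarrow> (nat \<Rightarrow> nat) \<Rightarrow> nat \<Rightarrow> real"
    where "emb p x = (\<lambda>i. if i < p then real (x i) / real p else 0)" for p x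
  have embQ: "emb p x \<in> Q" if "\<forall>i<p. x i \<le> p" for p x
    using that by (auto simp: Q emb_def divide_le_eq_1)
  define near :: "nat \<Rightarrow> (nat \<Rightarrow> nat) \<Rightarrow> (nat \<Rightarrow> real) \<Rightarrow> bool"
    where "near p q a \<longleftrightarrow> a \<in> Q \<and> (\<forall>j. \<bar>a j - emb p q j\<bar> \<le> 1 / real p)" for p q a
  have "\<exists>q. (\<forall>i<p. q i < p) \<and>
      (\<forall>i<p. \<exists>a b. near p q a \<and> near p q b \<and> a i \<le> f a i \<and> f b i \<le> b i)"
    if p: "0 < p" for p
  proof -
    \<comment> \<open>Kuhn's lemma demands label 1 on the faces \<open>x i = p\<close>. Forcing it
      is sound: there \<open>emb p x i = 1\<close> bounds all values of \<open>f\<close>, so label 1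
      still means \<open>f (emb p x) i \<le> emb p x i\<close>.\<close>
    define label :: "(nat \<Rightarrow> nat) \<Rightarrow> nat \<Rightarrow> nat"
      where "label x i = (if x i \<noteq> p \<and> emb p x i \<le> f (emb p x) i then 0 else 1)" for x i
    have 1: "\<forall>x. (\<forall>i<p. x i \<le> p) \<longrightarrow> (\<forall>i<p. label x i = 0 \<or> label x i = 1)"
      by (auto simp: label_def)
    have lab: "label x i = 0 \<or> label x i = 1" for x i by (simp add: label_def)
    have 2: "\<forall>x. (\<forall>i<p. x i \<le> p) \<longrightarrow> (\<forall>i<p. x i = 0 \<longrightarrow> label x i = 0)"
    proof (intro allI impI)
      fix x i assume "\<forall>i<p. x i \<le> p" "i < p" "x i = 0"
      moreover from this have "emb p x i = 0" by (simp add: emb_def)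
      ultimately show "label x i = 0"
        using p fQ[OF embQ, of p x] by (auto simp: label_def Q)
    qed
    have 3: "\<forall>x. (\<forall>i<p. x i \<le> p) \<longrightarrow> (\<forall>i<p. x i = p \<longrightarrow> label x i = 1)"
      by (auto simp: label_def)
    obtain q where q: "\<forall>i<p. q i < p"
      and qq: "\<forall>i<p. \<exists>r s. (\<forall>j<p. q j \<le> r j \<and> r j \<le> q j + 1) \<and>
        (\<forall>j<p. q j \<le> s j \<and> s j \<le> q j + 1) \<and> label r i \<noteq> label s i"
      using kuhn_lemma[OF p 1 2 3] by blast
    have nearI: "near p q (emb p r) \<and> (label r i = 0 \<longrightarrow> emb p r i \<le> f (emb p r) i) \<and>
        (label r i \<noteq> 0 \<longrightarrow> f (emb p r) i \<le> emb p r i)"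
      if r: "\<forall>j<p. q j \<le> r j \<and> r j \<le> q j + 1" and i: "i < p" for r i
    proof -
      have rp: "\<forall>j<p. r j \<le> p" using r q by fastforce
      have "emb p r \<in> Q" by (rule embQ[OF rp])
      moreover have "\<bar>emb p r j - emb p q j\<bar> \<le> 1 / real p" for j
      proof (cases "j < p")
        case True
        have "emb p r j - emb p q j = (real (r j) - real (q j)) / real p"
          using True by (simp add: emb_def diff_divide_distrib)
        moreover have "\<bar>real (r j) - real (q j)\<bar> \<le> 1" using r True by force
        ultimately show ?thesis by (simp add: divide_right_mono)
      qed (simp add: emb_def)
      moreover have "f (emb p r) i \<le> emb p r i" if "label r i \<noteq> 0"
      proof (cases "r i = p")
        case True
        then have "emb p r i = 1" using p i by (simp add: emb_def)
        with fQ[OF \<open>emb p r \<in> Q\<close>] show ?thesis by (simp add: Q)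
      qed (use that in \<open>auto simp: label_def split: if_splits\<close>)
      ultimately show ?thesis by (auto simp: near_def label_def split: if_splits)
    qed
    show ?thesis
    proof (intro exI[of _ q] conjI q allI impI)
      fix i assume i: "i < p"
      then obtain r s where rs: "\<forall>j<p. q j \<le> r j \<and> r j \<le> q j + 1"
        "\<forall>j<p. q j \<le> s j \<and> s j \<le> q j + 1" "label r i \<noteq> label s i"
        using qq by blast
      show "\<exists>a b. near p q a \<and> near p q b \<and> a i \<le> f a i \<and> f b i \<le> b i"
        using nearI[OF rs(1) i] nearI[OF rs(2) i] rs(3) lab[of r i] lab[of s i] by fastforce
    qed
  qed
  then obtain q where q: "\<And>p i. 0 < p \<Longrightarrow> i < p \<Longrightarrow> q p i < p"
    and qab: "\<And>p i. 0 < p \<Longrightarrow> i < p \<Longrightarrow> \<exists>a b. near p (q p) a \<and> near p (q p) b \<and> a i \<le> f a i \<and> f b i \<le> b i"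
    by metis
  have "emb (Suc n) (q (Suc n)) \<in> Q" for n
    using q[of "Suc n"] by (intro embQ) (auto simp: less_imp_le)
  moreover have "seq_compact Q"
    using compact_box_fun[of "\<lambda>_::nat. 0" "\<lambda>_. 1"] by (simp add: Q_def compact_eq_seq_compact_metric)
  ultimately obtain x l where x: "x \<in> Q" and l: "strict_mono l"
    and lim: "((\<lambda>n. emb (Suc n) (q (Suc n))) \<circ> l) \<longlonglongrightarrow> x"
    using seq_compactE[of Q "\<lambda>n. emb (Suc n) (q (Suc n))"] by blast
  \<comment> \<open>The grids start at \<open>p = 1\<close>, hence the shift by one.\<close>
  define Z where "Z n = Suc (l n)" for n
  have Z0: "0 < Z n" for n by (simp add: Z_def)
  have Zlim: "(\<lambda>n. 1 / real (Z n)) \<longlonglongrightarrow> 0"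
    using LIMSEQ_subseq_LIMSEQ[OF LIMSEQ_Suc[OF lim_inverse_n'] l]
    by (simp add: comp_def Z_def)
  have near_lim: "a \<longlonglongrightarrow> x" if "\<And>n. near (Z n) (q (Z n)) (a n)" for a
    unfolding tendsto_fun_iff
  proof
    fix j
    have 1: "(\<lambda>n. emb (Z n) (q (Z n)) j) \<longlonglongrightarrow> x j"
      using lim by (simp add: tendsto_fun_iff Z_def comp_def)
    have "(\<lambda>n. a n j - emb (Z n) (q (Z n)) j) \<longlonglongrightarrow> 0"
      by (rule Lim_null_comparison[OF _ Zlim]) (use that in \<open>auto simp: near_def\<close>)
    from tendsto_add[OF this 1] show "(\<lambda>n. a n j) \<longlonglongrightarrow> x j" by simp
  qed
  have f_lim: "(\<lambda>n. f (a n) i) \<longlonglongrightarrow> f x i" if "\<And>n. a n \<in> Q" "a \<longlonglongrightarrow> x" for a i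
  proof -
    have "(\<lambda>n. f (a n)) \<longlonglongrightarrow> f x"
      using cont that x unfolding continuous_on_sequentially Q_def comp_def by blast
    thus ?thesis by (simp add: tendsto_fun_iff)
  qed
  have "f x i = x i" for i
  proof -
    define c where "c n = emb (Z n) (q (Z n))" for n
    have ev: "\<forall>\<^sub>F n in sequentially. i < Z n"
      using filterlim_subseq[OF l] by (auto simp: Z_def filterlim_at_top eventually_mono less_Suc_eq_le)
    have cn: "near (Z n) (q (Z n)) (c n)" for n
      using embQ[of "Z n" "q (Z n)"] q[OF Z0, of _ n] by (auto simp: near_def c_def less_imp_le)
    \<comment> \<open>For the finitely many \<open>n\<close> with \<open>Z n \<le> i\<close> the
      grid point \<open>c n\<close> is a filler, so that closeness holds for every \<open>n\<close>
      and only the inequalities are conditional.\<close>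
    have "\<exists>a b. near (Z n) (q (Z n)) a \<and> near (Z n) (q (Z n)) b \<and>
        (i < Z n \<longrightarrow> a i \<le> f a i \<and> f b i \<le> b i)" for n
      using qab[OF Z0, of i n] cn[of n] by blast
    then obtain a b where a: "\<And>n. near (Z n) (q (Z n)) (a n)" and b: "\<And>n. near (Z n) (q (Z n)) (b n)"
      and ab: "\<And>n. i < Z n \<Longrightarrow> a n i \<le> f (a n) i \<and> f (b n) i \<le> b n i"
      by metis
    have aQ: "a n \<in> Q" "b n \<in> Q" for n using a b by (auto simp: near_def)
    have "x i \<le> f x i"
      by (rule tendsto_le[OF _ f_lim[OF aQ(1) near_lim[OF a]], where g = "\<lambda>n. a n i"])
        (use near_lim[OF a] ab ev in \<open>auto simp: tendsto_fun_iff elim!: eventually_mono\<close>)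
    moreover have "f x i \<le> x i"
      by (rule tendsto_le[OF _ _ f_lim[OF aQ(2) near_lim[OF b]], where f = "\<lambda>n. b n i"])
        (use near_lim[OF b] ab ev in \<open>auto simp: tendsto_fun_iff elim!: eventually_mono\<close>)
    ultimately show ?thesis by simp
  qed
  then show ?thesis using x by (auto simp: Q_def)
qed

section \<open>Kakutani's theorem\<close>

definition convex_functions :: "('j \<Rightarrow> real) set \<Rightarrow> bool" where
  "convex_functions A \<longleftrightarrow>
     (\<forall>x\<in>A. \<forall>y\<in>A. \<forall>a\<ge>0. \<forall>b\<ge>0. a + b = 1 \<longrightarrow> (\<lambda>j. a * x j + b * y j) \<in> A)"

text \<open>Points of weight zero are exempt from membership: in Kakutani's theorem only the values
  at the active nodes of a partition of unity are known to lie in the convex set.\<close>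

lemma convex_functions_sum:
  assumes "convex_functions S" "finite A" "\<And>a. a \<in> A \<Longrightarrow> 0 \<le> w a" "sum w A = 1"
    and "\<And>a. a \<in> A \<Longrightarrow> w a \<noteq> 0 \<Longrightarrow> b a \<in> S"
  shows "(\<lambda>j. \<Sum>a\<in>A. w a * b a j) \<in> S"
  using assms(2-5)
proof (induction A arbitrary: w rule: finite_induct)
  case empty
  then show ?case by simp
next
  case (insert x F)
  define c where "c = sum w F"
  have c0: "0 \<le> c" unfolding c_def by (intro sum_nonneg) (use insert in auto)
  have xc: "w x + c = 1" using insert by (simp add: c_def)
  show ?case
  proof (cases "c = 0")
    case True
    then have "w a = 0" if "a \<in> F" for a
      using that insert by (simp add: c_def sum_nonneg_eq_0_iff)
    moreover from this have "w x = 1" using xc True by simp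
    ultimately show ?thesis using insert by simp
  next
    case False
    have *: "(\<lambda>j. \<Sum>a\<in>F. w a / c * b a j) \<in> S"
      by (rule insert.IH) (use insert c0 False in \<open>auto simp: sum_divide_distrib[symmetric] c_def\<close>)
    have eq: "(\<lambda>j. \<Sum>a\<in>insert x F. w a * b a j) = (\<lambda>j. w x * b x j + c * (\<Sum>a\<in>F. w a / c * b a j))"
      using insert False by (simp add: sum_distrib_left)
    show ?thesis
    proof (cases "w x = 0")
      case True
      with eq * xc show ?thesis by simp
    next
      case False
      then have "b x \<in> S" "0 \<le> w x" using insert by auto
      show ?thesis unfolding eq
        by (rule assms(1)[unfolded convex_functions_def, rule_format]) fact+
    qed
  qed
qed

text \<open>Arbitrary choices \<open>b a \<in> \<Gamma> a\<close> at finitely many nodes are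
  interpolated by a partition of unity subordinate to \<open>e\<close>-balls around the nodes.
  Distances see the first \<open>N\<close> coordinates only, like basic neighbourhoods in the
  product topology. The fixed point is sought among weight vectors, so Brouwer's theorem is applied
  to the full cube and not to \<open>C\<close>.\<close>

lemma Kakutani_approximate:
  fixes C :: "(nat \<Rightarrow> real) set"
  assumes C: "compact C" "C \<noteq> {}" "convex_functions C"
    and \<Gamma>: "\<And>x. x \<in> C \<Longrightarrow> \<Gamma> x \<noteq> {} \<and> \<Gamma> x \<subseteq> C"
    and e: "0 < e"
  obtains A w b where "finite A" "A \<subseteq> C" "\<And>a. a \<in> A \<Longrightarrow> 0 \<le> w a" "sum w A = 1"
    "\<And>a. a \<in> A \<Longrightarrow> b a \<in> \<Gamma> a"
    "\<And>a i. a \<in> A \<Longrightarrow> w a \<noteq> 0 \<Longrightarrow> i < N \<Longrightarrow> \<bar>(\<Sum>a\<in>A. w a * b a i) - a i\<bar> < e"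
proof -
  define d :: "(nat \<Rightarrow> real) \<Rightarrow> (nat \<Rightarrow> real) \<Rightarrow> real" where "d x a = (\<Sum>j<N. \<bar>x j - a j\<bar>)" for x a
  have d_cont: "continuous_on UNIV (\<lambda>x. d x a)" for a
    unfolding d_def by (intro continuous_intros continuous_on_product_coordinates)
  have dself: "d a a = 0" for a by (simp add: d_def)
  have "open {x. d x a < e}" for a
    using open_Collect_less[OF d_cont continuous_on_const] .
  moreover have "C \<subseteq> (\<Union>a\<in>C. {x. d x a < e})" using e dself by auto
  ultimately obtain A where A: "A \<subseteq> C" "finite A" "C \<subseteq> (\<Union>a\<in>A. {x. d x a < e})"
    using compactE_image[OF C(1), of C "\<lambda>a. {x. d x a < e}"] by metis
  define m where "m = card A"
  have m0: "0 < m" using A C(2) by (auto simp: m_def card_gt_0_iff)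
  obtain h where h: "bij_betw h {..<m} A"
    using ex_bij_betw_nat_finite[OF A(2)] by (auto simp: m_def atLeast0LessThan)
  define b where "b a = (SOME g. g \<in> \<Gamma> a)" for a
  have b: "b a \<in> \<Gamma> a" if "a \<in> C" for a
    using \<Gamma>[OF that] by (simp add: b_def some_in_eq)
  have hA: "h i \<in> A" if "i < m" for i using h that by (auto simp: bij_betw_def)
  have bC: "b (h i) \<in> C" if "i < m" for i using hA[OF that] A(1) b \<Gamma> by blast
  define s :: "(nat \<Rightarrow> real) \<Rightarrow> real" where "s l = (\<Sum>i<m. l i)" for l
  \<comment> \<open>A continuous map from the cube onto the probability weights on
    \<open>{..<m}\<close>: an excess is divided away, a missing mass is given to index 0. It fixes
    weights with sum 1, and a fixed point of \<open>F\<close> has sum 1.\<close>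
  define \<rho> :: "(nat \<Rightarrow> real) \<Rightarrow> nat \<Rightarrow> real"
    where "\<rho> l i = (l i + (if i = 0 then max 0 (1 - s l) else 0)) / max 1 (s l)" for l i
  define y where "y l = (\<lambda>j. \<Sum>i<m. \<rho> l i * b (h i) j)" for l
  \<comment> \<open>Tent functions: \<open>v i\<close> is positive exactly where \<open>h i\<close>
    is closer than \<open>e\<close>. Since the nodes form an \<open>e\<close>-net of
    \<open>C\<close>, the sum \<open>V\<close> is positive on \<open>C\<close>.\<close>
  define v where "v i x = max 0 (e - d x (h i))" for i x
  define V where "V x = (\<Sum>i<m. v i x)" for x
  define F where "F l = (\<lambda>i. if i < m then v i (y l) / V (y l) else 0)" for l
  have \<rho>1: "(\<Sum>i<m. \<rho> l i) = 1" for l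
  proof -
    have "(\<Sum>i<m. \<rho> l i) = (s l + (\<Sum>i<m. if i = 0 then max 0 (1 - s l) else 0)) / max 1 (s l)"
      by (simp add: \<rho>_def s_def sum_divide_distrib[symmetric] sum.distrib)
    also have "(\<Sum>i<m. if i = 0 then max 0 (1 - s l) else 0) = max 0 (1 - s l)"
      using m0 by (simp add: sum.delta)
    finally show ?thesis by (auto simp: max_def)
  qed
  have yC: "y l \<in> C" if "l \<in> UNIV \<rightarrow> {0..1}" for l
    unfolding y_def
  proof (rule convex_functions_sum[OF C(3)])
    show "0 \<le> \<rho> l i" for i using that by (auto simp: \<rho>_def Pi_iff)
  qed (use \<rho>1 bC in auto)
  have v0: "0 \<le> v i x" for i x by (simp add: v_def)
  have V0: "0 < V x" if xC: "x \<in> C" for x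
  proof -
    obtain a where "a \<in> A" "d x a < e" using xC A(3) by blast
    then obtain i where i: "i < m" "d x (h i) < e" using h by (auto simp: bij_betw_def)
    show ?thesis unfolding V_def
      by (rule sum_pos2[of _ i]) (use i v0 in \<open>auto simp: v_def\<close>)
  qed
  have FQ: "F \<in> (UNIV \<rightarrow> {0..1}) \<rightarrow> UNIV \<rightarrow> {0..1}"
  proof (intro funcsetI)
    fix l :: "nat \<Rightarrow> real" and i assume l: "l \<in> UNIV \<rightarrow> {0..1}"
    have "v i (y l) \<le> V (y l)" if "i < m"
      unfolding V_def by (rule member_le_sum) (use that v0 in auto)
    then show "F l i \<in> {0..1}" using v0 V0[OF yC[OF l]] by (auto simp: F_def divide_le_eq_1)
  qed
  have y_cont: "continuous_on (UNIV \<rightarrow> {0..1}) (\<lambda>l. y l j)" for j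
  proof -
    have c: "continuous_on (UNIV \<rightarrow> {0..1}) (\<lambda>l::nat \<Rightarrow> real. l i)" for i
      by (rule continuous_on_subset[OF continuous_on_product_coordinates]) simp
    have "continuous_on (UNIV \<rightarrow> {0..1}) (\<lambda>l. \<rho> l i)" for i
      unfolding \<rho>_def s_def by (cases "i = 0") (auto intro!: continuous_intros c)
    then show ?thesis unfolding y_def by (intro continuous_intros)
  qed
  have v_cont: "continuous_on (UNIV \<rightarrow> {0..1}) (\<lambda>l. v i (y l))" for i
    unfolding v_def d_def by (intro continuous_intros y_cont)
  have F_cont: "continuous_on (UNIV \<rightarrow> {0..1}) F"
  proof (rule continuous_on_coordinatewise_then_product)
    fix i
    have "continuous_on (UNIV \<rightarrow> {0..1}) (\<lambda>l. v i (y l) / V (y l))"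
      unfolding V_def
    proof (intro continuous_intros v_cont ballI)
      fix l :: "nat \<Rightarrow> real" assume "l \<in> UNIV \<rightarrow> {0..1}"
      then show "(\<Sum>i<m. v i (y l)) \<noteq> 0" using V0[OF yC] by (simp add: V_def less_imp_neq[symmetric])
    qed
    then show "continuous_on (UNIV \<rightarrow> {0..1}) (\<lambda>l. F l i)"
      by (cases "i < m") (auto simp: F_def)
  qed
  obtain l where l: "l \<in> UNIV \<rightarrow> {0..1}" "F l = l"
    using brouwer_Hilbert_cube[OF F_cont FQ] by blast
  define x where "x = y l"
  have xC: "x \<in> C" using yC[OF l(1)] by (simp add: x_def)
  have li: "l i = v i x / V x" if "i < m" for i
    using fun_cong[OF l(2), of i] that by (simp add: F_def x_def)
  have sl: "s l = 1"
    using V0[OF xC] by (simp add: s_def li sum_divide_distrib[symmetric] V_def)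
  have \<rho>l: "\<rho> l i = l i" for i by (simp add: \<rho>_def sl)
  define w where "w a = l (inv_into {..<m} h a)" for a
  have wh: "w (h i) = l i" if "i < m" for i
    using that h by (simp add: w_def bij_betw_def inv_into_f_f)
  have reidx: "sum g A = (\<Sum>i<m. g (h i))" for g :: "_ \<Rightarrow> real"
    by (rule sum.reindex_bij_betw[OF h, symmetric])
  have xsum: "(\<Sum>a\<in>A. w a * b a j) = x j" for j
    by (simp add: reidx wh x_def y_def \<rho>l)
  show ?thesis
  proof
    show "finite A" "A \<subseteq> C" by fact+
    show "b a \<in> \<Gamma> a" if "a \<in> A" for a using that A b by auto
    show "sum w A = 1" using sl by (simp add: reidx wh s_def)
    fix a assume "a \<in> A"
    then obtain i where i: "i < m" "a = h i" using h by (auto simp: bij_betw_def)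
    show "0 \<le> w a" using i l(1) by (auto simp: wh Pi_iff)
    fix j assume "w a \<noteq> 0" "j < N"
    then have "d x a < e" using i by (auto simp: wh li v_def)
    moreover have "\<bar>x j - a j\<bar> \<le> d x a"
      unfolding d_def by (rule member_le_sum) (use \<open>j < N\<close> in auto)
    ultimately show "\<bar>(\<Sum>a\<in>A. w a * b a j) - a j\<bar> < e" by (simp add: xsum)
  qed
qed

text \<open>The means \<open>z N\<close> and all nodes of non-zero weight approach the same point
  \<open>x\<close>. If \<open>x\<close> were outside \<open>\<Gamma> x\<close>, some convex
  neighbourhood \<open>V\<close> of \<open>\<Gamma> x\<close> would stay away from \<open>x\<close>.
  Compactness and the closed graph force the values at the active nodes into \<open>V\<close>
  eventually, and convexity then forces the means into \<open>V\<close>, which is a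
  contradiction.\<close>

theorem Kakutani_sequences:
  fixes C :: "(nat \<Rightarrow> real) set"
  assumes C: "compact C" "C \<noteq> {}" "convex_functions C"
    and \<Gamma>: "\<And>x. x \<in> C \<Longrightarrow> \<Gamma> x \<noteq> {} \<and> \<Gamma> x \<subseteq> C \<and> convex_functions (\<Gamma> x)"
    and graph: "\<And>X Y x y. (\<And>n. X n \<in> C) \<Longrightarrow> (\<And>n. Y n \<in> \<Gamma> (X n)) \<Longrightarrow> X \<longlonglongrightarrow> x \<Longrightarrow> Y \<longlonglongrightarrow> y \<Longrightarrow> y \<in> \<Gamma> x"
  shows "\<exists>x\<in>C. x \<in> \<Gamma> x"
proof -
  define P where "P N A w b \<longleftrightarrow> finite A \<and> A \<subseteq> C \<and> (\<forall>a\<in>A. 0 \<le> w a) \<and> sum w A = 1 \<and> (\<forall>a\<in>A. b a \<in> \<Gamma> a) \<and>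
      (\<forall>a\<in>A. w a \<noteq> 0 \<longrightarrow> (\<forall>i<N. \<bar>(\<Sum>a\<in>A. w a * b a i) - a i\<bar> < 1 / real (Suc N)))"
    for N :: nat and A w b
  have "\<exists>A w b. P N A w b" for N
  proof -
    obtain A w b where "finite A" "A \<subseteq> C" "\<And>a. a \<in> A \<Longrightarrow> 0 \<le> w a" "sum w A = 1"
      "\<And>a. a \<in> A \<Longrightarrow> b a \<in> \<Gamma> a"
      "\<And>a i. a \<in> A \<Longrightarrow> w a \<noteq> 0 \<Longrightarrow> i < N \<Longrightarrow> \<bar>(\<Sum>a\<in>A. w a * b a i) - a i\<bar> < 1 / real (Suc N)"
      by (rule Kakutani_approximate[OF C, of \<Gamma> "1 / real (Suc N)" N]) (use \<Gamma> in auto)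
    then have "P N A w b" unfolding P_def by simp
    then show ?thesis by blast
  qed
  then obtain A w b where P: "\<And>N. P N (A N) (w N) (b N)" by metis
  have A: "\<And>N. finite (A N)" "\<And>N. A N \<subseteq> C" "\<And>N a. a \<in> A N \<Longrightarrow> 0 \<le> w N a"
    "\<And>N. sum (w N) (A N) = 1" "\<And>N a. a \<in> A N \<Longrightarrow> b N a \<in> \<Gamma> a"
    "\<And>N a i. a \<in> A N \<Longrightarrow> w N a \<noteq> 0 \<Longrightarrow> i < N \<Longrightarrow>
       \<bar>(\<Sum>a\<in>A N. w N a * b N a i) - a i\<bar> < 1 / real (Suc N)"
    using P unfolding P_def by simp_all
  define z where "z N = (\<lambda>i. \<Sum>a\<in>A N. w N a * b N a i)" for N
  have "z N \<in> C" for N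
    unfolding z_def by (rule convex_functions_sum[OF C(3) A(1)]) (use A \<Gamma> in blast)+
  moreover have sC: "seq_compact C" using C(1) by (simp add: compact_eq_seq_compact_metric)
  ultimately obtain x l where x: "x \<in> C" and l: "strict_mono l" and lim: "(z \<circ> l) \<longlonglongrightarrow> x"
    using seq_compactE[of C z] by blast
  have cl: "y \<in> \<Gamma> x" if "\<And>n. Y n \<in> \<Gamma> x" "Y \<longlonglongrightarrow> y" for Y y
    using graph[of "\<lambda>_. x" Y x y] x that by simp
  show ?thesis
  proof (rule bexI[OF _ x], rule ccontr)
    assume nx: "x \<notin> \<Gamma> x"
    \<comment> \<open>Neighbourhoods that control finitely many coordinates. As
      \<open>\<Gamma> x\<close> is closed, a point in all of them lies in \<open>\<Gamma> x\<close>,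
      so some \<open>W K\<close> misses \<open>x\<close>.\<close>
    define W where "W n = {y. \<exists>g\<in>\<Gamma> x. \<forall>j<n. \<bar>y j - g j\<bar> \<le> 1 / real (Suc n)}" for n
    have inv_lim: "(\<lambda>n. 1 / real (Suc n)) \<longlonglongrightarrow> 0"
      using LIMSEQ_Suc[OF lim_inverse_n'] by simp
    have "\<exists>n. x \<notin> W n"
    proof (rule ccontr)
      assume "\<not> ?thesis"
      then have "\<forall>n. \<exists>g\<in>\<Gamma> x. \<forall>j<n. \<bar>x j - g j\<bar> \<le> 1 / real (Suc n)" by (simp add: W_def)
      then obtain g where g: "\<And>n. g n \<in> \<Gamma> x" "\<And>n j. j < n \<Longrightarrow> \<bar>x j - g n j\<bar> \<le> 1 / real (Suc n)"
        by metis
      have "g \<longlonglongrightarrow> x" unfolding tendsto_fun_iff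
      proof
        fix j
        have "(\<lambda>n. g n j - x j) \<longlonglongrightarrow> 0"
          by (rule Lim_null_comparison[OF _ inv_lim], rule eventually_sequentiallyI[of "Suc j"])
            (metis Suc_le_lessD abs_minus_commute g(2) real_norm_def)
        then show "(\<lambda>n. g n j) \<longlonglongrightarrow> x j" by (rule LIM_zero_cancel)
      qed
      with cl g(1) nx show False by blast
    qed
    then obtain K where K: "x \<notin> W K" by blast
    \<comment> \<open>Half the tolerance of \<open>W K\<close>; the other half is spent on the
      distance from \<open>z (l n)\<close> to \<open>x\<close>.\<close>
    define V where "V = {y. \<exists>g\<in>\<Gamma> x. \<forall>j<K. \<bar>y j - g j\<bar> < 1 / real (Suc K) / 2}"
    have convV: "convex_functions V" unfolding convex_functions_def
    proof (intro ballI allI impI)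
      fix y y' and c c' :: real assume "y \<in> V" "y' \<in> V" and c: "0 \<le> c" "0 \<le> c'" "c + c' = 1"
      then obtain g g' where g: "g \<in> \<Gamma> x" "g' \<in> \<Gamma> x"
        "\<And>j. j < K \<Longrightarrow> \<bar>y j - g j\<bar> < 1 / real (Suc K) / 2" "\<And>j. j < K \<Longrightarrow> \<bar>y' j - g' j\<bar> < 1 / real (Suc K) / 2"
        by (auto simp: V_def)
      have "(\<lambda>j. c * g j + c' * g' j) \<in> \<Gamma> x" using \<Gamma>[OF x] g c by (auto simp: convex_functions_def)
      moreover have "\<bar>(c * y j + c' * y' j) - (c * g j + c' * g' j)\<bar> < 1 / real (Suc K) / 2" if "j < K" for j
      proof -
        have "(c * y j + c' * y' j) - (c * g j + c' * g' j) = c * (y j - g j) + c' * (y' j - g' j)"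
          by (simp add: algebra_simps)
        also have "\<bar>\<dots>\<bar> \<le> c * \<bar>y j - g j\<bar> + c' * \<bar>y' j - g' j\<bar>"
          using abs_triangle_ineq[of "c * (y j - g j)" "c' * (y' j - g' j)"] c by (simp add: abs_mult)
        also have "\<dots> < 1 / real (Suc K) / 2"
          by (rule convex_bound_lt[OF g(3,4)[OF that] c])
        finally show ?thesis .
      qed
      ultimately show "(\<lambda>j. c * y j + c' * y' j) \<in> V" unfolding V_def mem_Collect_eq
        by (intro bexI[of _ "\<lambda>j. c * g j + c' * g' j"]) auto
    qed
    have "\<forall>\<^sub>F n in sequentially. z (l n) \<in> V"
    proof (rule ccontr)
      assume "\<not> ?thesis"
      then have "infinite {n. z (l n) \<notin> V}"
        unfolding infinite_nat_iff_unbounded_le eventually_sequentially by auto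
      then obtain k :: "nat \<Rightarrow> nat" where k: "strict_mono k" "\<And>n. z (l (k n)) \<notin> V"
        using infinite_enumerate by blast
      define t where "t n = l (k n)" for n
      have t: "strict_mono t" using l k(1) by (simp add: t_def strict_mono_def)
      \<comment> \<open>A convex set that misses a convex combination misses one of the points of
        non-zero weight.\<close>
      have "\<exists>a\<in>A (t n). w (t n) a \<noteq> 0 \<and> b (t n) a \<notin> V" for n
      proof (rule ccontr)
        assume "\<not> ?thesis"
        then have "z (t n) \<in> V" unfolding z_def
          by (intro convex_functions_sum[OF convV A(1)]) (use A in blast)+
        then show False using k(2) by (simp add: t_def)
      qed
      then obtain a where a: "\<And>n. a n \<in> A (t n)" "\<And>n. w (t n) (a n) \<noteq> 0" "\<And>n. b (t n) (a n) \<notin> V"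
        by metis
      define B where "B n = b (t n) (a n)" for n
      have aC: "a n \<in> C" for n using a A by blast
      have B: "B n \<in> \<Gamma> (a n)" for n using a A by (auto simp: B_def)
      then have "B n \<in> C" for n using \<Gamma>[OF aC] by blast
      then obtain y m where m: "strict_mono m" and y: "(B \<circ> m) \<longlonglongrightarrow> y"
        using sC seq_compactE[of C B] by blast
      have "(a \<circ> m) \<longlonglongrightarrow> x" unfolding tendsto_fun_iff
      proof
        fix j
        have tm: "strict_mono (\<lambda>n. t (m n))" using t m by (simp add: strict_mono_def)
        have "(\<lambda>n. z (l n) j) \<longlonglongrightarrow> x j" using lim by (simp add: tendsto_fun_iff comp_def)
        then have 1: "(\<lambda>n. z (t (m n)) j) \<longlonglongrightarrow> x j"
          using LIMSEQ_subseq_LIMSEQ[of "\<lambda>n. z (l n) j" "x j" "\<lambda>n. k (m n)"] k(1) m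
          by (simp add: comp_def t_def strict_mono_def)
        have 2: "(\<lambda>n. 1 / real (Suc (t (m n)))) \<longlonglongrightarrow> 0"
          using LIMSEQ_subseq_LIMSEQ[OF inv_lim tm] by (simp add: comp_def)
        have ev: "\<forall>\<^sub>F n in sequentially. j < t (m n)"
          using filterlim_subseq[OF tm] unfolding filterlim_at_top by (auto simp: less_eq_Suc_le)
        have "(\<lambda>n. a (m n) j - z (t (m n)) j) \<longlonglongrightarrow> 0"
        proof (rule Lim_null_comparison[OF _ 2], rule eventually_mono[OF ev])
          fix n assume "j < t (m n)"
          from A(6)[OF a(1)[of "m n"] a(2)[of "m n"] this]
          show "norm (a (m n) j - z (t (m n)) j) \<le> 1 / real (Suc (t (m n)))"
            by (simp add: z_def abs_minus_commute del: of_nat_Suc)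
        qed
        from tendsto_add[OF this 1] show "(\<lambda>n. (a \<circ> m) n j) \<longlonglongrightarrow> x j" by simp
      qed
      from graph[OF _ _ this y] aC B have yx: "y \<in> \<Gamma> x" by simp
      have "\<forall>\<^sub>F n in sequentially. \<forall>j\<in>{..<K}. \<bar>(B \<circ> m) n j - y j\<bar> < 1 / real (Suc K) / 2"
      proof (rule eventually_ball_finite)
        show "\<forall>j\<in>{..<K}. \<forall>\<^sub>F n in sequentially. \<bar>(B \<circ> m) n j - y j\<bar> < 1 / real (Suc K) / 2"
        proof
          fix j
          have "(\<lambda>n. (B \<circ> m) n j) \<longlonglongrightarrow> y j" using y by (simp add: tendsto_fun_iff)
          from tendstoD[OF this, of "1 / real (Suc K) / 2"]
          show "\<forall>\<^sub>F n in sequentially. \<bar>(B \<circ> m) n j - y j\<bar> < 1 / real (Suc K) / 2"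
            by (simp add: dist_real_def del: of_nat_Suc)
        qed
      qed simp
      then obtain n where "\<forall>j<K. \<bar>B (m n) j - y j\<bar> < 1 / real (Suc K) / 2"
        by (auto simp: eventually_sequentially)
      then have "B (m n) \<in> V" using yx by (auto simp: V_def)
      then show False using a(3) by (simp add: B_def)
    qed
    moreover have "\<forall>\<^sub>F n in sequentially. \<forall>j\<in>{..<K}. \<bar>z (l n) j - x j\<bar> < 1 / real (Suc K) / 2"
    proof (rule eventually_ball_finite)
      show "\<forall>j\<in>{..<K}. \<forall>\<^sub>F n in sequentially. \<bar>z (l n) j - x j\<bar> < 1 / real (Suc K) / 2"
      proof
        fix j
        have "(\<lambda>n. z (l n) j) \<longlonglongrightarrow> x j" using lim by (simp add: tendsto_fun_iff)
        from tendstoD[OF this, of "1 / real (Suc K) / 2"]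
        show "\<forall>\<^sub>F n in sequentially. \<bar>z (l n) j - x j\<bar> < 1 / real (Suc K) / 2"
          by (simp add: dist_real_def del: of_nat_Suc)
      qed
    qed simp
    ultimately have "\<forall>\<^sub>F n in sequentially. z (l n) \<in> V \<and> (\<forall>j\<in>{..<K}. \<bar>z (l n) j - x j\<bar> < 1 / real (Suc K) / 2)"
      by (rule eventually_conj)
    then obtain n where n: "z (l n) \<in> V" "\<forall>j<K. \<bar>z (l n) j - x j\<bar> < 1 / real (Suc K) / 2"
      by (auto simp: eventually_sequentially)
    then obtain g where g: "g \<in> \<Gamma> x" "\<forall>j<K. \<bar>z (l n) j - g j\<bar> < 1 / real (Suc K) / 2"
      by (auto simp: V_def)
    have "\<bar>x j - g j\<bar> \<le> 1 / real (Suc K)" if "j < K" for j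
    proof -
      have "\<bar>a - c\<bar> \<le> r" if "\<bar>b - a\<bar> < r / 2" "\<bar>b - c\<bar> < r / 2" for a b c r :: real
        using that by linarith
      from this[OF n(2)[rule_format, OF that] g(2)[rule_format, OF that]] show ?thesis .
    qed
    with g(1) K show False by (auto simp: W_def)
  qed
qed

section \<open>Uniform convexity and completeness\<close>

text \<open>The mean value theorem on each half of the interval, with a strictly increasing
  derivative. The end point \<open>a = 0\<close> causes no trouble, as derivatives are taken at
  interior points only.\<close>

lemma powr_midpoint_less:
  fixes a b p :: real
  assumes p: "1 < p" and a: "0 \<le> a" and ab: "a < b"
  shows "((a + b) / 2) powr p < (a powr p + b powr p) / 2"
proof -
  define m where "m = (a + b) / 2"
  have am: "a < m" "m < b" using ab by (auto simp: m_def)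
  have cont: "continuous_on {u..v} (\<lambda>x. x powr p)" if "0 \<le> u" for u v :: real
    using that p by (intro continuous_on_powr' continuous_intros) auto
  have der: "((\<lambda>x. x powr p) has_real_derivative p * x powr (p - 1)) (at x)" if "0 < x" for x
    using that by (auto intro!: derivative_eq_intros)
  have mvt: "\<exists>z. u < z \<and> z < v \<and> v powr p - u powr p = (v - u) * (p * z powr (p - 1))"
    if uv: "0 \<le> u" "u < v" for u v
  proof -
    have "(\<lambda>x. x powr p) differentiable (at x)" if "u < x" "x < v" for x
      using der[of x] that uv real_differentiable_def by auto
    then obtain l z where z: "u < z" "z < v" "((\<lambda>x. x powr p) has_real_derivative l) (at z)"
      "v powr p - u powr p = (v - u) * l"
      using MVT[OF uv(2) cont[OF uv(1)]] by blast
    moreover have "l = p * z powr (p - 1)"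
      using DERIV_unique[OF z(3) der[of z]] z uv by simp
    ultimately show ?thesis by blast
  qed
  obtain z where z: "a < z" "z < m" "m powr p - a powr p = (m - a) * (p * z powr (p - 1))"
    using mvt[OF a am(1)] by blast
  obtain z' where z': "m < z'" "z' < b" "b powr p - m powr p = (b - m) * (p * z' powr (p - 1))"
    using mvt[of m b] a am by force
  have "z powr (p - 1) < z' powr (p - 1)" using z z' a p by (intro powr_less_mono2) auto
  then have "(m - a) * (p * z powr (p - 1)) < (m - a) * (p * z' powr (p - 1))" using p am by simp
  moreover have mid: "b - m = m - a" by (simp add: m_def field_simps)
  ultimately have "m powr p - a powr p < b powr p - m powr p"
    unfolding z(3) z'(3) mid by simp
  then show ?thesis by (simp add: m_def)
qed

text \<open>For positive arguments this is convexity of the power function. A vanishing argument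
  reduces it to \<open>c powr p \<le> c\<close> for \<open>c\<close> between 0 and 1.\<close>

lemma powr_combination_le:
  fixes x y a b p :: real
  assumes p: "1 \<le> p" and xy: "0 \<le> x" "0 \<le> y" and ab: "0 \<le> a" "0 \<le> b" "a + b = 1"
  shows "(a * x + b * y) powr p \<le> a * x powr p + b * y powr p"
proof -
  have scale: "(c * z) powr p \<le> c * z powr p" if "0 \<le> c" "c \<le> 1" "0 \<le> z" for c z :: real
  proof -
    have "c powr p \<le> c powr 1" using p that by (intro powr_mono') auto
    then have "c powr p * z powr p \<le> c * z powr p" using that by (intro mult_right_mono) auto
    then show ?thesis using that by (simp add: powr_mult)
  qed
  consider "x = 0" | "y = 0" | "0 < x" "0 < y" using xy by fastforce
  then show ?thesis
  proof cases
    case 3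
    then show ?thesis using convex_onD[OF powr_convex[OF p], of b x y] ab by (simp add: eq_diff_eq[symmetric])
  qed (use scale[of a x] scale[of b y] xy ab p in auto)
qed

text \<open>By homogeneity it suffices to treat \<open>a = 1\<close>; the deficit of midpoint convexity is bounded
  away from zero on the compact set of those \<open>t \<in> [0, 1]\<close> for which \<open>1 - t\<close> is not small.\<close>

lemma powr_uniformly_convex:
  fixes p e :: real
  assumes p: "1 < p" and e: "0 < e"
  shows "\<exists>C\<ge>0. \<forall>a\<ge>0. \<forall>b\<ge>0. \<bar>a - b\<bar> powr p \<le>
    e * (a powr p + b powr p) + C * ((a powr p + b powr p) / 2 - ((a + b) / 2) powr p)"
proof -
  define g where "g t = (1 + t powr p) / 2 - ((1 + t) / 2) powr p" for t :: real
  define S where "S = {t\<in>{0..1}. e \<le> (1 - t) powr p}"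
  have cS: "continuous_on {0..1} (\<lambda>t::real. (1 - t) powr p)"
    using p by (intro continuous_on_powr' continuous_intros) auto
  have "closed S"
    using continuous_closed_preimage[OF cS, of "{e..}"]
    by (simp add: S_def vimage_def Int_def)
  then have "compact ({0..1} \<inter> S)" by (intro compact_Int_closed) auto
  moreover have "{0..1} \<inter> S = S" by (auto simp: S_def)
  ultimately have S: "compact S" by simp
  have g_cont: "continuous_on S g"
    unfolding g_def using p by (intro continuous_on_powr' continuous_intros) (auto simp: S_def)
  have g_pos: "0 < g t" if "t \<in> S" for t
  proof -
    have "t \<noteq> 1" using that e p by (auto simp: S_def)
    with that powr_midpoint_less[OF p, of t 1] show ?thesis by (auto simp: S_def g_def add.commute)
  qed
  \<comment> \<open>\<open>S\<close> is empty when \<open>e > 1\<close>, and any positive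
    \<open>\<mu>\<close> will then do.\<close>
  have "\<exists>\<mu>>0. \<forall>t\<in>S. \<mu> \<le> g t"
  proof (cases "S = {}")
    case False
    then obtain t where "t \<in> S" "\<forall>s\<in>S. g t \<le> g s" using continuous_attains_inf[OF S _ g_cont] by blast
    with g_pos show ?thesis by blast
  qed (auto intro: exI[of _ 1])
  then obtain \<mu> where \<mu>: "0 < \<mu>" "\<And>t. t \<in> S \<Longrightarrow> \<mu> \<le> g t" by blast
  have g0: "0 \<le> g t" if "t \<in> {0..1}" for t
    using powr_combination_le[of p 1 t "1 / 2" "1 / 2"] p that by (simp add: g_def add_divide_distrib)
  have unit: "(1 - t) powr p \<le> e + g t / \<mu>" if t: "t \<in> {0..1}" for t
  proof (cases "t \<in> S")
    case True
    have "(1 - t) powr p \<le> 1 powr p" using t p by (intro powr_mono2) auto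
    also have "\<dots> \<le> g t / \<mu>" using \<mu>(1) \<mu>(2)[OF True] by simp
    finally show ?thesis using e by simp
  next
    case False
    then have "(1 - t) powr p \<le> e" using t by (simp add: S_def)
    then show ?thesis using g0[OF t] \<mu>(1) by (simp add: add_increasing2)
  qed
  have main: "\<bar>a - b\<bar> powr p \<le> e * (a powr p + b powr p)
      + 1 / \<mu> * ((a powr p + b powr p) / 2 - ((a + b) / 2) powr p)"
    if ab: "0 \<le> b" "b \<le> a" for a b
  proof (cases "a = 0")
    case False
    then have a: "0 < a" using ab by simp
    define t where "t = b / a"
    have t: "t \<in> {0..1}" and b: "b = a * t" using ab a by (auto simp: t_def)
    have "\<bar>a - b\<bar> = a * (1 - t)" using ab by (simp add: b algebra_simps)
    then have "\<bar>a - b\<bar> powr p = a powr p * (1 - t) powr p"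
      using a t by (simp add: powr_mult)
    also have "\<dots> \<le> a powr p * (e + g t / \<mu>)" by (intro mult_left_mono unit t) simp
    also have "\<dots> = e * a powr p + 1 / \<mu> * (a powr p * g t)" by (simp add: algebra_simps)
    also have "a powr p * g t = (a powr p + b powr p) / 2 - ((a + b) / 2) powr p"
    proof -
      have "(a + b) / 2 = a * ((1 + t) / 2)" by (simp add: b algebra_simps)
      then have "((a + b) / 2) powr p = a powr p * ((1 + t) / 2) powr p"
        using a t by (simp only: powr_mult)
      moreover have "b powr p = a powr p * t powr p" using a t by (simp add: b powr_mult)
      ultimately show ?thesis by (simp add: g_def algebra_simps)
    qed
    also have "e * a powr p + x \<le> e * (a powr p + b powr p) + x" for x using e by simp
    finally show ?thesis by simp
  qed (use ab p in auto)
  show ?thesis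
  proof (intro exI[of _ "1 / \<mu>"] conjI allI impI)
    fix a b :: real assume "0 \<le> a" "0 \<le> b"
    then show "\<bar>a - b\<bar> powr p \<le> e * (a powr p + b powr p)
      + 1 / \<mu> * ((a powr p + b powr p) / 2 - ((a + b) / 2) powr p)"
      using main[of a b] main[of b a]
      by (cases "b \<le> a") (simp_all add: abs_minus_commute add.commute)
  qed (use \<mu> in simp)
qed

text \<open>A crude replacement for Minkowski's inequality. It serves membership in
  \<open>Lp\<close> and uniform bounds, where the constant is immaterial.\<close>

lemma powr_add_le:
  fixes a b p :: real
  assumes "0 \<le> p"
  shows "\<bar>a + b\<bar> powr p \<le> 2 powr p * (\<bar>a\<bar> powr p + \<bar>b\<bar> powr p)"
proof -
  have "\<bar>a + b\<bar> powr p \<le> (2 * max \<bar>a\<bar> \<bar>b\<bar>) powr p"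
    using assms by (intro powr_mono2) auto
  also have "\<dots> = 2 powr p * max \<bar>a\<bar> \<bar>b\<bar> powr p" by (simp add: powr_mult)
  also have "\<dots> \<le> 2 powr p * (\<bar>a\<bar> powr p + \<bar>b\<bar> powr p)"
    by (intro mult_left_mono) (auto simp: max_def)
  finally show ?thesis .
qed

section \<open>Estimates for p-th powers of norms, and completeness\<close>

abbreviation Lp_integral :: "real \<Rightarrow> (real \<Rightarrow> real) \<Rightarrow> real" where
  "Lp_integral p h \<equiv> LINT \<theta>|lebesgue. \<bar>h \<theta>\<bar> powr p"

lemma LpD: "h \<in> Lp p \<Longrightarrow> h \<in> borel_measurable lebesgue"
  "h \<in> Lp p \<Longrightarrow> integrable lebesgue (\<lambda>\<theta>. \<bar>h \<theta>\<bar> powr p)"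
  by (auto simp: Lp_def)

lemma Lp_integral_nonneg: "0 \<le> Lp_integral p h"
  by (rule integral_nonneg_AE) simp

lemma Lp_add:
  assumes "0 \<le> p" "x \<in> Lp p" "y \<in> Lp p"
  shows "(\<lambda>\<theta>. x \<theta> + y \<theta>) \<in> Lp p"
    and "Lp_integral p (\<lambda>\<theta>. x \<theta> + y \<theta>) \<le> 2 powr p * (Lp_integral p x + Lp_integral p y)"
proof -
  note [measurable] = LpD(1)[OF assms(2)] LpD(1)[OF assms(3)]
  have int: "integrable lebesgue (\<lambda>\<theta>. 2 powr p * (\<bar>x \<theta>\<bar> powr p + \<bar>y \<theta>\<bar> powr p))"
    by (intro integrable_mult_right Bochner_Integration.integrable_add LpD assms)
  have "integrable lebesgue (\<lambda>\<theta>. \<bar>x \<theta> + y \<theta>\<bar> powr p)"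
    by (rule Bochner_Integration.integrable_bound[OF int])
      (use powr_add_le[OF assms(1)] in auto)
  then show 1: "(\<lambda>\<theta>. x \<theta> + y \<theta>) \<in> Lp p" by (auto simp: Lp_def)
  have "Lp_integral p (\<lambda>\<theta>. x \<theta> + y \<theta>) \<le> (LINT \<theta>|lebesgue. 2 powr p * (\<bar>x \<theta>\<bar> powr p + \<bar>y \<theta>\<bar> powr p))"
    by (intro integral_mono LpD(2)[OF 1] int powr_add_le assms)
  also have "\<dots> = 2 powr p * (Lp_integral p x + Lp_integral p y)"
    using assms LpD(2) by simp
  finally show "Lp_integral p (\<lambda>\<theta>. x \<theta> + y \<theta>) \<le> 2 powr p * (Lp_integral p x + Lp_integral p y)" .
qed

lemma Lp_scale:
  assumes "x \<in> Lp p"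
  shows "(\<lambda>\<theta>. c * x \<theta>) \<in> Lp p" "Lp_integral p (\<lambda>\<theta>. c * x \<theta>) = \<bar>c\<bar> powr p * Lp_integral p x"
  using assms by (auto simp: Lp_def abs_mult powr_mult)

lemma Lp_diff:
  assumes "0 \<le> p" "x \<in> Lp p" "y \<in> Lp p"
  shows "(\<lambda>\<theta>. x \<theta> - y \<theta>) \<in> Lp p"
  using Lp_add(1)[OF assms(1,2) Lp_scale(1)[OF assms(3), of "-1"]] by simp

lemma Lp_dominated:
  assumes "0 \<le> p" "x \<in> borel_measurable lebesgue" "y \<in> Lp p" "AE \<theta> in lebesgue. \<bar>x \<theta>\<bar> \<le> \<bar>y \<theta>\<bar>"
  shows "x \<in> Lp p" "Lp_integral p x \<le> Lp_integral p y"
proof -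
  note [measurable] = assms(2)
  have ae: "AE \<theta> in lebesgue. \<bar>x \<theta>\<bar> powr p \<le> \<bar>y \<theta>\<bar> powr p"
    using assms(4) by eventually_elim (intro powr_mono2 assms(1), auto)
  then have "integrable lebesgue (\<lambda>\<theta>. \<bar>x \<theta>\<bar> powr p)"
    by (intro Bochner_Integration.integrable_bound[OF LpD(2)[OF assms(3)]]) auto
  then show "x \<in> Lp p" using assms(2) by (simp add: Lp_def)
  then show "Lp_integral p x \<le> Lp_integral p y"
    using ae assms(3) by (intro integral_mono_AE LpD)
qed

text \<open>Fatou's lemma for the \<open>p\<close>-th powers. An eventual bound is allowed because
  Cauchy estimates are available for late indices only.\<close>

lemma Lp_Fatou:
  assumes p: "0 < p" and h: "\<And>n. h n \<in> Lp p"
    and M: "\<forall>\<^sub>F n in sequentially. Lp_integral p (h n) \<le> M"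
    and lim: "AE \<theta> in lebesgue. (\<lambda>n. h n \<theta>) \<longlonglongrightarrow> g \<theta>"
    and g[measurable]: "g \<in> borel_measurable lebesgue"
  shows "g \<in> Lp p" "Lp_integral p g \<le> M"
proof -
  note [measurable] = LpD(1)[OF h]
  obtain n where "Lp_integral p (h n) \<le> M" using M by (auto simp: eventually_sequentially)
  with Lp_integral_nonneg[where h = "h n" and p = p] have M0: "0 \<le> M" by linarith
  have "(\<integral>\<^sup>+\<theta>. ennreal (\<bar>g \<theta>\<bar> powr p) \<partial>lebesgue)
      = (\<integral>\<^sup>+\<theta>. liminf (\<lambda>n. ennreal (\<bar>h n \<theta>\<bar> powr p)) \<partial>lebesgue)"
  proof (rule nn_integral_cong_AE, use lim in eventually_elim)
    fix \<theta> assume "(\<lambda>n. h n \<theta>) \<longlonglongrightarrow> g \<theta>"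
    then have "(\<lambda>n. ennreal (\<bar>h n \<theta>\<bar> powr p)) \<longlonglongrightarrow> ennreal (\<bar>g \<theta>\<bar> powr p)"
      using p by (intro tendsto_ennrealI tendsto_powr' tendsto_rabs tendsto_const) auto
    then show "ennreal (\<bar>g \<theta>\<bar> powr p) = liminf (\<lambda>n. ennreal (\<bar>h n \<theta>\<bar> powr p))"
      by (intro lim_imp_Liminf[symmetric]) auto
  qed
  also have "\<dots> \<le> liminf (\<lambda>n. \<integral>\<^sup>+\<theta>. ennreal (\<bar>h n \<theta>\<bar> powr p) \<partial>lebesgue)"
    by (rule nn_integral_liminf) auto
  also have "\<dots> = liminf (\<lambda>n. ennreal (Lp_integral p (h n)))"
    using LpD(2)[OF h] by (subst nn_integral_eq_integral) auto
  also have "\<dots> \<le> ennreal M"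
    by (rule Liminf_le) (use M in \<open>auto intro: ennreal_leI elim!: eventually_mono\<close>)
  finally have *: "(\<integral>\<^sup>+\<theta>. ennreal (\<bar>g \<theta>\<bar> powr p) \<partial>lebesgue) \<le> ennreal M" .
  then have int: "integrable lebesgue (\<lambda>\<theta>. \<bar>g \<theta>\<bar> powr p)"
    by (intro integrableI_bounded) (auto intro: le_less_trans)
  then show "g \<in> Lp p" by (simp add: Lp_def)
  show "Lp_integral p g \<le> M"
    using * M0 by (subst (asm) nn_integral_eq_integral[OF int]) auto
qed

lemma Lp_integral_0_AE:
  assumes "h \<in> Lp p" "Lp_integral p h = 0"
  shows "AE \<theta> in lebesgue. h \<theta> = 0"
  using assms integral_nonneg_eq_0_iff_AE[of lebesgue "\<lambda>\<theta>. \<bar>h \<theta>\<bar> powr p"] by (simp add: Lp_def)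

text \<open>Riesz--Fischer, phrased with \<open>p\<close>-th powers. The almost everywhere
  convergent subsequence is part of the result: through it sign and support pass to the
  limit.\<close>

lemma Lp_Cauchy_limit:
  assumes p: "0 < p" and x: "\<And>n. x n \<in> Lp p"
    and Cau: "\<And>e. 0 < e \<Longrightarrow> \<exists>N. \<forall>m\<ge>N. \<forall>n\<ge>N. Lp_integral p (\<lambda>\<theta>. x m \<theta> - x n \<theta>) \<le> e"
  obtains y r where "strict_mono r" "y \<in> Lp p" "AE \<theta> in lebesgue. (\<lambda>n. x (r n) \<theta>) \<longlonglongrightarrow> y \<theta>"
    "(\<lambda>n. Lp_integral p (\<lambda>\<theta>. x n \<theta> - y \<theta>)) \<longlonglongrightarrow> 0"
proof -
  have p0: "0 \<le> p" using p by simp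
  note [measurable] = LpD(1)[OF x]
  have "\<exists>N. \<forall>k. N k < N (Suc k) \<and>
      (\<forall>m\<ge>N k. \<forall>n\<ge>N k. Lp_integral p (\<lambda>\<theta>. x m \<theta> - x n \<theta>) \<le> (1 / 4) ^ k)"
  proof -
    have "\<exists>N. \<forall>k. (\<forall>m\<ge>N k. \<forall>n\<ge>N k. Lp_integral p (\<lambda>\<theta>. x m \<theta> - x n \<theta>) \<le> (1 / 4) ^ k) \<and> N k < N (Suc k)"
    proof (rule dependent_nat_choice)
      show "\<exists>N. \<forall>m\<ge>N. \<forall>n\<ge>N. Lp_integral p (\<lambda>\<theta>. x m \<theta> - x n \<theta>) \<le> (1 / 4) ^ 0"
        using Cau[of 1] by simp
      fix N k :: nat
      obtain N' where "\<forall>m\<ge>N'. \<forall>n\<ge>N'. Lp_integral p (\<lambda>\<theta>. x m \<theta> - x n \<theta>) \<le> (1 / 4) ^ Suc k"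
        using Cau[of "(1/4) ^ Suc k"] by auto
      then show "\<exists>M. (\<forall>m\<ge>M. \<forall>n\<ge>M. Lp_integral p (\<lambda>\<theta>. x m \<theta> - x n \<theta>) \<le> (1 / 4) ^ Suc k) \<and> N < M"
        by (intro exI[of _ "max N' (Suc N)"]) auto
    qed
    then show ?thesis by blast
  qed
  then obtain r where r: "\<And>k. r k < r (Suc k)"
    "\<And>k m n. r k \<le> m \<Longrightarrow> r k \<le> n \<Longrightarrow> Lp_integral p (\<lambda>\<theta>. x m \<theta> - x n \<theta>) \<le> (1 / 4) ^ k"
    by blast
  have sr: "strict_mono r" using r(1) by (simp add: strict_mono_Suc_iff)
  \<comment> \<open>With the factor \<open>2 ^ k\<close> the integrals drop from
    \<open>(1 / 4) ^ k\<close> to \<open>(1 / 2) ^ k\<close> and remain summable. Where the sum is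
    finite, the increments are eventually at most \<open>((1 / 2) powr (1 / p)) ^ k\<close>, a
    summable geometric sequence. This avoids the triangle inequality for the norm.\<close>
  define \<Delta> where "\<Delta> k \<theta> = 2 ^ k * \<bar>x (r (Suc k)) \<theta> - x (r k) \<theta>\<bar> powr p" for k \<theta>
  have [measurable]: "\<Delta> k \<in> borel_measurable lebesgue" for k unfolding \<Delta>_def by measurable
  have \<Delta>_int: "integrable lebesgue (\<Delta> k)" for k
    unfolding \<Delta>_def using LpD(2)[OF Lp_diff[OF p0 x x]] by simp
  have \<Delta>_bound: "(LINT \<theta>|lebesgue. \<Delta> k \<theta>) \<le> (1 / 2) ^ k" for k
  proof -
    have "(LINT \<theta>|lebesgue. \<Delta> k \<theta>) = 2 ^ k * Lp_integral p (\<lambda>\<theta>. x (r (Suc k)) \<theta> - x (r k) \<theta>)"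
      by (simp add: \<Delta>_def)
    also have "\<dots> \<le> 2 ^ k * (1 / 4) ^ k"
      by (intro mult_left_mono r(2)) (use r(1)[of k] in auto)
    also have "\<dots> = (1 / 2) ^ k" by (simp flip: power_mult_distrib)
    finally show ?thesis .
  qed
  have "(\<integral>\<^sup>+\<theta>. (\<Sum>k. ennreal (\<Delta> k \<theta>)) \<partial>lebesgue) = (\<Sum>k. \<integral>\<^sup>+\<theta>. ennreal (\<Delta> k \<theta>) \<partial>lebesgue)"
    by (rule nn_integral_suminf) simp
  also have "\<dots> = (\<Sum>k. ennreal (LINT \<theta>|lebesgue. \<Delta> k \<theta>))"
    by (intro suminf_cong nn_integral_eq_integral \<Delta>_int) (simp add: \<Delta>_def)
  also have "\<dots> \<le> (\<Sum>k. ennreal ((1 / 2) ^ k))"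
    by (intro suminf_le ennreal_leI \<Delta>_bound) auto
  also have "\<dots> = ennreal (\<Sum>k. (1 / 2) ^ k)"
    by (intro suminf_ennreal2) (auto simp: summable_geometric)
  also have "\<dots> < \<infinity>" by simp
  finally have "AE \<theta> in lebesgue. (\<Sum>k. ennreal (\<Delta> k \<theta>)) \<noteq> \<infinity>"
    by (intro nn_integral_PInf_AE) auto
  then have conv: "AE \<theta> in lebesgue. convergent (\<lambda>k. x (r k) \<theta>)"
  proof eventually_elim
    fix \<theta> assume "(\<Sum>k. ennreal (\<Delta> k \<theta>)) \<noteq> \<infinity>"
    then have "summable (\<lambda>k. \<Delta> k \<theta>)"
      by (intro summable_suminf_not_top) (auto simp: \<Delta>_def)
    then have "(\<lambda>k. \<Delta> k \<theta>) \<longlonglongrightarrow> 0" by (rule summable_LIMSEQ_zero)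
    then have "\<forall>\<^sub>F k in sequentially. \<Delta> k \<theta> < 1" by (rule order_tendstoD) simp
    then have ev: "\<forall>\<^sub>F k in sequentially. norm (x (r (Suc k)) \<theta> - x (r k) \<theta>) \<le> ((1 / 2) powr (1 / p)) ^ k"
    proof eventually_elim
      fix k assume "\<Delta> k \<theta> < 1"
      then have "\<bar>x (r (Suc k)) \<theta> - x (r k) \<theta>\<bar> powr p \<le> (1 / 2) ^ k"
        by (simp add: \<Delta>_def field_simps power_divide)
      then have "(\<bar>x (r (Suc k)) \<theta> - x (r k) \<theta>\<bar> powr p) powr (1 / p) \<le> ((1 / 2) ^ k) powr (1 / p)"
        using p by (intro powr_mono2) auto
      then show "norm (x (r (Suc k)) \<theta> - x (r k) \<theta>) \<le> ((1 / 2) powr (1 / p)) ^ k"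
        using p by (simp add: powr_powr powr_power flip: powr_realpow)
    qed
    have "(1 / 2 :: real) powr (1 / p) < 1"
      using powr_less_mono2[of "1 / p" "1 / 2" 1] p by simp
    then have "summable (\<lambda>k. ((1 / 2 :: real) powr (1 / p)) ^ k)" by (intro summable_geometric) simp
    then have "summable (\<lambda>k. x (r (Suc k)) \<theta> - x (r k) \<theta>)"
      using summable_comparison_test_ev[OF ev] by blast
    then have "convergent (\<lambda>n. \<Sum>k<n. x (r (Suc k)) \<theta> - x (r k) \<theta>)" by (simp add: summable_iff_convergent)
    then have "convergent (\<lambda>n. x (r n) \<theta> - x (r 0) \<theta>)" by (simp add: sum_lessThan_telescope[where f = "\<lambda>k. x (r k) \<theta>"])
    then show "convergent (\<lambda>k. x (r k) \<theta>)" using convergent_diff_const_right_iff by blast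
  qed
  \<comment> \<open>Where the subsequence diverges, \<open>lim\<close> is an unspecified value; this
    happens on a null set only, and \<open>y\<close> is measurable all the same.\<close>
  define y where "y \<theta> = lim (\<lambda>k. x (r k) \<theta>)" for \<theta>
  have [measurable]: "y \<in> borel_measurable lebesgue" unfolding y_def by measurable
  have lim: "AE \<theta> in lebesgue. (\<lambda>k. x (r k) \<theta>) \<longlonglongrightarrow> y \<theta>"
    using conv by eventually_elim (simp add: y_def convergent_LIMSEQ_iff)
  have close: "(\<lambda>\<theta>. x n \<theta> - y \<theta>) \<in> Lp p \<and> Lp_integral p (\<lambda>\<theta>. x n \<theta> - y \<theta>) \<le> (1 / 4) ^ k"
    if n: "r k \<le> n" for k n
  proof -
    have 1: "\<forall>\<^sub>F j in sequentially. Lp_integral p (\<lambda>\<theta>. x n \<theta> - x (r j) \<theta>) \<le> (1 / 4) ^ k"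
      using strict_mono_leD[OF sr, of k] by (intro eventually_sequentiallyI[of k] r(2) n) simp
    have 2: "AE \<theta> in lebesgue. (\<lambda>j. x n \<theta> - x (r j) \<theta>) \<longlonglongrightarrow> x n \<theta> - y \<theta>"
      using lim by eventually_elim (intro tendsto_diff tendsto_const)
    show ?thesis
      using Lp_Fatou[OF p Lp_diff[OF p0 x x] 1 2] by simp
  qed
  have yL: "y \<in> Lp p"
    using Lp_diff[OF p0 x[of "r 0"] conjunct1[OF close[of 0 "r 0"]]] by simp
  have "(\<lambda>n. Lp_integral p (\<lambda>\<theta>. x n \<theta> - y \<theta>)) \<longlonglongrightarrow> 0"
  proof (rule LIMSEQ_I)
    fix e :: real assume "0 < e"
    then obtain k where "(1 / 4 :: real) ^ k < e" using real_arch_pow_inv[of e "1/4"] by auto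
    then show "\<exists>N. \<forall>n\<ge>N. norm (Lp_integral p (\<lambda>\<theta>. x n \<theta> - y \<theta>) - 0) < e"
      using close[of k, THEN conjunct2] Lp_integral_nonneg[where p = p] by (intro exI[of _ "r k"]) (auto intro: le_less_trans)
  qed
  then show ?thesis using that[OF sr yL lim] by simp
qed

section \<open>Rates up to time T and continuous functionals\<close>

lemma AE_lebesgue_neq: "AE \<theta> in lebesgue. \<theta> \<noteq> (c::real)"
  by (rule AE_completion[OF AE_lborel_singleton])

text \<open>On a bounded support, local and global \<open>p\<close>-integrability agree. The closed
  interval \<open>{0..T}\<close>, which \<open>truncate\<close> uses, differs from the half-open one
  by the null set of the point \<open>T\<close>.\<close>

lemma rates_until_iff:
  "h \<in> rates_until p (ereal T) \<longleftrightarrow> h \<in> Lp p \<and> (AE \<theta> in lebesgue. 0 \<le> h \<theta>) \<and>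
     (AE \<theta> in lebesgue. \<theta> \<notin> {0..T} \<longrightarrow> h \<theta> = 0)" (is "?L \<longleftrightarrow> ?R")
proof
  assume L: ?L
  have meas[measurable]: "h \<in> borel_measurable lebesgue" and nonneg: "AE \<theta> in lebesgue. 0 \<le> h \<theta>"
    and int: "set_integrable lebesgue {0..T} (\<lambda>\<theta>. \<bar>h \<theta>\<bar> powr p)"
    and van: "AE \<theta> in lebesgue. \<not> (0 \<le> \<theta> \<and> \<theta> < T) \<longrightarrow> h \<theta> = 0"
    using L by (auto simp: rates_until_def rates_def vanishing_outside_def)
  have van': "AE \<theta> in lebesgue. \<theta> \<notin> {0..T} \<longrightarrow> h \<theta> = 0"
    using van by eventually_elim auto
  have "integrable lebesgue (\<lambda>\<theta>. \<bar>h \<theta>\<bar> powr p) \<longleftrightarrow>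
      integrable lebesgue (\<lambda>\<theta>. indicator {0..T} \<theta> *\<^sub>R \<bar>h \<theta>\<bar> powr p)"
  proof (rule integrable_cong_AE)
    show "(\<lambda>\<theta>. indicator {0..T} \<theta> *\<^sub>R \<bar>h \<theta>\<bar> powr p) \<in> borel_measurable lebesgue"
      by (intro borel_measurable_scaleR borel_measurable_indicator) auto
    show "AE \<theta> in lebesgue. \<bar>h \<theta>\<bar> powr p = indicator {0..T} \<theta> *\<^sub>R \<bar>h \<theta>\<bar> powr p"
      using van' by eventually_elim auto
  qed simp
  with int have "h \<in> Lp p" by (simp add: Lp_def set_integrable_def)
  with nonneg van' show ?R by simp
next
  assume R: ?R
  then have h: "h \<in> Lp p" and [measurable]: "h \<in> borel_measurable lebesgue" by (auto simp: Lp_def)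
  have "set_integrable lebesgue C (\<lambda>\<theta>. \<bar>h \<theta>\<bar> powr p)" if "compact C" for C
    unfolding set_integrable_def
    by (intro integrable_mult_indicator LpD(2)[OF h])
      (use that in \<open>auto simp: compact_imp_closed lmeasurable_compact fmeasurableD\<close>)
  moreover have "AE \<theta> in lebesgue. \<theta> < 0 \<longrightarrow> h \<theta> = 0"
    using conjunct2[OF conjunct2[OF R]] by eventually_elim auto
  moreover have "AE \<theta> in lebesgue. \<not> (0 \<le> \<theta> \<and> \<theta> < T) \<longrightarrow> h \<theta> = 0"
    using conjunct2[OF conjunct2[OF R]] AE_lebesgue_neq[of T] by eventually_elim auto
  ultimately show ?L
    using R by (auto simp: rates_until_def rates_def vanishing_outside_def)
qed

lemma vectorsI: "(\<And>k. k \<in> K \<Longrightarrow> x k \<in> X) \<Longrightarrow> x \<in> vectors K X"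
  and vectorsD: "x \<in> vectors K X \<Longrightarrow> k \<in> K \<Longrightarrow> x k \<in> X"
  by (auto simp: vectors_def Pi_iff)

lemma rates_untilD:
  assumes "h \<in> rates_until p (ereal T)"
  shows "h \<in> Lp p" "AE \<theta> in lebesgue. 0 \<le> h \<theta>" "AE \<theta> in lebesgue. \<theta> \<notin> {0..T} \<longrightarrow> h \<theta> = 0"
  using assms by (auto simp: rates_until_iff)

lemma vectors_rates_until_Lp: "x \<in> vectors K (rates_until p (ereal T)) \<Longrightarrow> x \<in> vectors K (Lp p)"
  by (auto simp: vectors_def dest: rates_untilD(1))

lemma Lp_norm_nonneg: "0 \<le> Lp_norm p h"
  by (simp add: Lp_norm_def)

lemma vec_norm_nonneg: "finite K \<Longrightarrow> 0 \<le> vec_norm p K x"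
  unfolding vec_norm_def by (rule Max_ge) auto

lemma Lp_norm_le_vec_norm: "finite K \<Longrightarrow> k \<in> K \<Longrightarrow> Lp_norm p (x k) \<le> vec_norm p K x"
  unfolding vec_norm_def by (rule Max_ge) auto

lemma vec_norm_le_sum: "finite K \<Longrightarrow> vec_norm p K x \<le> (\<Sum>k\<in>K. Lp_norm p (x k))"
  unfolding vec_norm_def
  by (subst Max_le_iff) (auto intro: sum_nonneg Lp_norm_nonneg member_le_sum)

lemma Lp_dualD:
  assumes "\<phi> \<in> Lp_dual p K"
  shows Lp_dual_add: "x \<in> vectors K (Lp p) \<Longrightarrow> y \<in> vectors K (Lp p) \<Longrightarrow>
      \<phi> (\<lambda>k \<theta>. x k \<theta> + y k \<theta>) = \<phi> x + \<phi> y"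
    and Lp_dual_scale: "x \<in> vectors K (Lp p) \<Longrightarrow> \<phi> (\<lambda>k \<theta>. c * x k \<theta>) = c * \<phi> x"
  using assms by (auto simp: Lp_dual_def)

lemma Lp_dual_tendsto:
  assumes p: "0 < p" and K: "finite K" and \<phi>: "\<phi> \<in> Lp_dual p K"
    and z: "\<And>n. z n \<in> vectors K (Lp p)" and y: "y \<in> vectors K (Lp p)"
    and lim: "\<And>k. k \<in> K \<Longrightarrow> (\<lambda>n. Lp_integral p (\<lambda>\<theta>. z n k \<theta> - y k \<theta>)) \<longlonglongrightarrow> 0"
  shows "(\<lambda>n. \<phi> (z n)) \<longlonglongrightarrow> \<phi> y"
proof -
  obtain C where C: "\<And>x. x \<in> vectors K (Lp p) \<Longrightarrow> \<bar>\<phi> x\<bar> \<le> C * vec_norm p K x"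
    using \<phi> unfolding Lp_dual_def by blast
  define D where "D n = (\<lambda>k \<theta>. z n k \<theta> - y k \<theta>)" for n
  have D: "D n \<in> vectors K (Lp p)" for n
    using z y p by (auto simp: D_def vectors_def Pi_iff intro!: Lp_diff)
  have diff: "\<phi> (z n) - \<phi> y = \<phi> (D n)" for n
    using Lp_dual_add[OF \<phi> D y, of n] by (simp add: D_def)
  have "(\<lambda>n. \<Sum>k\<in>K. Lp_norm p (D n k)) \<longlonglongrightarrow> (\<Sum>k\<in>K. 0)"
  proof (rule tendsto_sum)
    fix k assume "k \<in> K"
    have "(\<lambda>n. Lp_integral p (D n k) powr (1 / p)) \<longlonglongrightarrow> 0 powr (1 / p)"
      using p lim[OF \<open>k \<in> K\<close>] unfolding D_def
      by (intro tendsto_powr' tendsto_const) (auto intro: always_eventually)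
    then show "(\<lambda>n. Lp_norm p (D n k)) \<longlonglongrightarrow> 0" by (simp add: Lp_norm_def)
  qed
  then have lim0: "(\<lambda>n. \<bar>C\<bar> * (\<Sum>k\<in>K. Lp_norm p (D n k))) \<longlonglongrightarrow> 0"
    using tendsto_mult_right_zero by fastforce
  have "(\<lambda>n. \<phi> (z n) - \<phi> y) \<longlonglongrightarrow> 0"
  proof (rule Lim_null_comparison[OF always_eventually lim0], rule allI)
    fix n
    have "\<bar>\<phi> (D n)\<bar> \<le> C * vec_norm p K (D n)" by (rule C[OF D])
    also have "\<dots> \<le> \<bar>C\<bar> * vec_norm p K (D n)"
      by (intro mult_right_mono vec_norm_nonneg K) simp
    also have "\<dots> \<le> \<bar>C\<bar> * (\<Sum>k\<in>K. Lp_norm p (D n k))"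
      by (intro mult_left_mono vec_norm_le_sum K) simp
    finally show "norm (\<phi> (z n) - \<phi> y) \<le> \<bar>C\<bar> * (\<Sum>k\<in>K. Lp_norm p (D n k))" by (simp add: diff)
  qed
  then show ?thesis by (rule LIM_zero_cancel)
qed

lemma Lp_integral_cong_AE:
  assumes "x \<in> borel_measurable lebesgue" "y \<in> borel_measurable lebesgue" "AE \<theta> in lebesgue. x \<theta> = y \<theta>"
  shows "Lp_integral p x = Lp_integral p y"
proof -
  note [measurable] = assms(1,2)
  show ?thesis by (rule integral_cong_AE) (measurable, use assms(3) in eventually_elim, auto)
qed

text \<open>The constant sequence \<open>x\<close> converges to \<open>y\<close> in norm, so a
  bounded functional cannot tell them apart.\<close>

lemma Lp_dual_cong:
  assumes "0 < p" "finite K" "\<phi> \<in> Lp_dual p K" "x \<in> vectors K (Lp p)" "y \<in> vectors K (Lp p)"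
    and "ae_eq_on K x y"
  shows "\<phi> x = \<phi> y"
proof -
  have "Lp_integral p (\<lambda>\<theta>. x k \<theta> - y k \<theta>) = 0" if "k \<in> K" for k
  proof (rule integral_eq_zero_AE)
    have "AE \<theta> in lebesgue. x k \<theta> = y k \<theta>" using that assms by (simp add: ae_eq_on_def)
    then show "AE \<theta> in lebesgue. \<bar>x k \<theta> - y k \<theta>\<bar> powr p = 0" by eventually_elim simp
  qed
  then have "(\<lambda>n::nat. \<phi> x) \<longlonglongrightarrow> \<phi> y"
    using assms by (intro Lp_dual_tendsto[where z = "\<lambda>_. x"]) auto
  then show ?thesis by (simp add: LIMSEQ_const_iff)
qed

lemma rates_until_combination:
  assumes p: "0 \<le> p" and x: "x \<in> rates_until p (ereal T)" and y: "y \<in> rates_until p (ereal T)"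
    and ab: "0 \<le> a" "0 \<le> b"
  shows "(\<lambda>\<theta>. a * x \<theta> + b * y \<theta>) \<in> rates_until p (ereal T)"
proof -
  note x' = rates_untilD[OF x] and y' = rates_untilD[OF y]
  have "(\<lambda>\<theta>. a * x \<theta> + b * y \<theta>) \<in> Lp p" by (intro Lp_add p Lp_scale x' y')
  moreover have "AE \<theta> in lebesgue. 0 \<le> a * x \<theta> + b * y \<theta>"
    using x'(2) y'(2) by eventually_elim (simp add: ab)
  moreover have "AE \<theta> in lebesgue. \<theta> \<notin> {0..T} \<longrightarrow> a * x \<theta> + b * y \<theta> = 0"
    using x'(3) y'(3) by eventually_elim simp
  ultimately show ?thesis by (simp only: rates_until_iff)
qed

lemma convex_Lp_integral:
  assumes p: "1 < p" and x: "x \<in> rates_until p (ereal T)" and y: "y \<in> rates_until p (ereal T)"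
    and ab: "0 \<le> a" "0 \<le> b" "a + b = 1"
  shows "Lp_integral p (\<lambda>\<theta>. a * x \<theta> + b * y \<theta>) \<le> a * Lp_integral p x + b * Lp_integral p y"
proof -
  note x' = rates_untilD[OF x] and y' = rates_untilD[OF y]
  have c: "(\<lambda>\<theta>. a * x \<theta> + b * y \<theta>) \<in> Lp p" using p by (intro Lp_add Lp_scale x' y') auto
  have "Lp_integral p (\<lambda>\<theta>. a * x \<theta> + b * y \<theta>) \<le> (LINT \<theta>|lebesgue. a * \<bar>x \<theta>\<bar> powr p + b * \<bar>y \<theta>\<bar> powr p)"
  proof (rule integral_mono_AE[OF LpD(2)[OF c]])
    show "integrable lebesgue (\<lambda>\<theta>. a * \<bar>x \<theta>\<bar> powr p + b * \<bar>y \<theta>\<bar> powr p)"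
      by (intro integrable_mult_right Bochner_Integration.integrable_add LpD x' y')
    show "AE \<theta> in lebesgue. \<bar>a * x \<theta> + b * y \<theta>\<bar> powr p \<le> a * \<bar>x \<theta>\<bar> powr p + b * \<bar>y \<theta>\<bar> powr p"
      using x'(2) y'(2)
    proof eventually_elim
      case (elim \<theta>)
      then show ?case using powr_combination_le[of p "x \<theta>" "y \<theta>" a b] p ab by simp
    qed
  qed
  also have "\<dots> = a * Lp_integral p x + b * Lp_integral p y" using LpD(2)[OF x'(1)] LpD(2)[OF y'(1)] by simp
  finally show ?thesis .
qed

lemma rates_until_midpoint:
  assumes p: "1 < p" and x: "x \<in> rates_until p (ereal T)" and y: "y \<in> rates_until p (ereal T)"
  shows "(\<lambda>\<theta>. 1 / 2 * (x \<theta> + y \<theta>)) \<in> rates_until p (ereal T)"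
    and "Lp_integral p (\<lambda>\<theta>. 1 / 2 * (x \<theta> + y \<theta>)) \<le> (Lp_integral p x + Lp_integral p y) / 2"
proof -
  have "(\<lambda>\<theta>. 1 / 2 * x \<theta> + 1 / 2 * y \<theta>) \<in> rates_until p (ereal T)"
    by (rule rates_until_combination[OF _ x y]) (use p in auto)
  then show "(\<lambda>\<theta>. 1 / 2 * (x \<theta> + y \<theta>)) \<in> rates_until p (ereal T)"
    by (simp only: distrib_left)
  have "Lp_integral p (\<lambda>\<theta>. 1 / 2 * x \<theta> + 1 / 2 * y \<theta>) \<le> 1 / 2 * Lp_integral p x + 1 / 2 * Lp_integral p y"
    by (rule convex_Lp_integral[OF p x y]) auto
  then show "Lp_integral p (\<lambda>\<theta>. 1 / 2 * (x \<theta> + y \<theta>)) \<le> (Lp_integral p x + Lp_integral p y) / 2"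
    by (simp add: distrib_left add_divide_distrib)
qed

text \<open>The scalar inequality integrated. Non-negativity is what allows a scalar version for
  \<open>a, b \<ge> 0\<close>. On a bounded set \<open>e\<close> makes the first term small, and
  afterwards a small midpoint deficit makes the second one small.\<close>

lemma rates_until_uniformly_convex:
  assumes p: "1 < p" and e: "0 < e"
  obtains C where "0 \<le> C"
    "\<And>x y. x \<in> rates_until p (ereal T) \<Longrightarrow> y \<in> rates_until p (ereal T) \<Longrightarrow>
      Lp_integral p (\<lambda>\<theta>. x \<theta> - y \<theta>) \<le> e * (Lp_integral p x + Lp_integral p y)
       + C * ((Lp_integral p x + Lp_integral p y) / 2 - Lp_integral p (\<lambda>\<theta>. 1 / 2 * (x \<theta> + y \<theta>)))"
proof -
  obtain C where C: "0 \<le> C" "\<And>a b. 0 \<le> a \<Longrightarrow> 0 \<le> b \<Longrightarrow> \<bar>a - b\<bar> powr p \<le>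
    e * (a powr p + b powr p) + C * ((a powr p + b powr p) / 2 - ((a + b) / 2) powr p)"
    using powr_uniformly_convex[OF p e] by blast
  show ?thesis
  proof (rule that[OF C(1)])
    fix x y assume x: "x \<in> rates_until p (ereal T)" and y: "y \<in> rates_until p (ereal T)"
    note x' = rates_untilD[OF x] and y' = rates_untilD[OF y]
      and m = rates_untilD(1)[OF rates_until_midpoint(1)[OF p x y]]
    have int: "integrable lebesgue (\<lambda>\<theta>. e * (\<bar>x \<theta>\<bar> powr p + \<bar>y \<theta>\<bar> powr p))"
      "integrable lebesgue (\<lambda>\<theta>. (\<bar>x \<theta>\<bar> powr p + \<bar>y \<theta>\<bar> powr p) / 2)"
      "integrable lebesgue (\<lambda>\<theta>. C * ((\<bar>x \<theta>\<bar> powr p + \<bar>y \<theta>\<bar> powr p) / 2 - \<bar>1 / 2 * (x \<theta> + y \<theta>)\<bar> powr p))"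
      by (intro integrable_mult_right integrable_divide Bochner_Integration.integrable_add
          Bochner_Integration.integrable_diff LpD x' y' m)+
    have "Lp_integral p (\<lambda>\<theta>. x \<theta> - y \<theta>) \<le> (LINT \<theta>|lebesgue. e * (\<bar>x \<theta>\<bar> powr p + \<bar>y \<theta>\<bar> powr p)
       + C * ((\<bar>x \<theta>\<bar> powr p + \<bar>y \<theta>\<bar> powr p) / 2 - \<bar>1 / 2 * (x \<theta> + y \<theta>)\<bar> powr p))"
    proof (rule integral_mono_AE)
      show "integrable lebesgue (\<lambda>\<theta>. \<bar>x \<theta> - y \<theta>\<bar> powr p)"
        using p x' y' by (intro LpD Lp_diff) auto
      show "AE \<theta> in lebesgue. \<bar>x \<theta> - y \<theta>\<bar> powr p \<le> e * (\<bar>x \<theta>\<bar> powr p + \<bar>y \<theta>\<bar> powr p)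
       + C * ((\<bar>x \<theta>\<bar> powr p + \<bar>y \<theta>\<bar> powr p) / 2 - \<bar>1 / 2 * (x \<theta> + y \<theta>)\<bar> powr p)"
        using x'(2) y'(2)
      proof eventually_elim
        case (elim \<theta>)
        then show ?case using C(2)[OF elim] by simp
      qed
    qed (intro Bochner_Integration.integrable_add int)
    also have "\<dots> = e * (Lp_integral p x + Lp_integral p y)
       + C * ((Lp_integral p x + Lp_integral p y) / 2 - Lp_integral p (\<lambda>\<theta>. 1 / 2 * (x \<theta> + y \<theta>)))"
      using int LpD(2)[OF x'(1)] LpD(2)[OF y'(1)] LpD(2)[OF m]
      by (subst Bochner_Integration.integral_add) (auto simp del: abs_mult)
    finally show "Lp_integral p (\<lambda>\<theta>. x \<theta> - y \<theta>) \<le> e * (Lp_integral p x + Lp_integral p y)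
       + C * ((Lp_integral p x + Lp_integral p y) / 2 - Lp_integral p (\<lambda>\<theta>. 1 / 2 * (x \<theta> + y \<theta>)))" .
  qed
qed

section \<open>Weak convergence\<close>

text \<open>The limit is the common point of the closed convex hulls of all tails: near-minimisers of
  \<open>\<Sum>k\<in>K. Lp_integral p (x k)\<close> over these hulls form a Cauchy sequence by uniform convexity. The hulls
  are described through functionals, as in the Hahn--Banach theorem.\<close>

lemma weak_cluster_point:
  assumes p: "1 < p" and K: "finite K"
    and x: "\<And>n. x n \<in> vectors K (rates_until p (ereal T))"
    and M: "\<And>n k. k \<in> K \<Longrightarrow> Lp_integral p (x n k) \<le> M"
  obtains y where "y \<in> vectors K (rates_until p (ereal T))" "\<And>k. k \<in> K \<Longrightarrow> Lp_integral p (y k) \<le> M"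
    "\<And>\<phi> c. \<phi> \<in> Lp_dual p K \<Longrightarrow> (\<lambda>n. \<phi> (x n)) \<longlonglongrightarrow> c \<Longrightarrow> \<phi> y = c"
proof -
  have p0: "0 < p" "0 \<le> p" using p by auto
  \<comment> \<open>An interval containing the values of a functional on the tail must contain its
    value at \<open>z\<close>. Closure under midpoints is all the convexity that the Cauchy argument
    uses; sign, support and bound are carried along for the limit.\<close>
  define H where "H n = {z \<in> vectors K (rates_until p (ereal T)). (\<forall>k\<in>K. Lp_integral p (z k) \<le> M) \<and>
    (\<forall>\<phi>\<in>Lp_dual p K. \<forall>a b. (\<forall>m\<ge>n. \<phi> (x m) \<in> {a..b}) \<longrightarrow> \<phi> z \<in> {a..b})}" for n
  define J where "J z = (\<Sum>k\<in>K. Lp_integral p (z k))" for z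
  define mid :: "('a \<Rightarrow> real \<Rightarrow> real) \<Rightarrow> ('a \<Rightarrow> real \<Rightarrow> real) \<Rightarrow> 'a \<Rightarrow> real \<Rightarrow> real"
    where "mid z z' = (\<lambda>k \<theta>. 1 / 2 * (z k \<theta> + z' k \<theta>))" for z z'
  have J0: "0 \<le> J z" for z unfolding J_def by (intro sum_nonneg Lp_integral_nonneg)
  have JM: "J z \<le> real (card K) * M" if "z \<in> H n" for z n
    unfolding J_def using that sum_bounded_above[of K "\<lambda>k. Lp_integral p (z k)" M] by (auto simp: H_def)
  have xH: "x m \<in> H n" if "n \<le> m" for m n using that x M by (auto simp: H_def)
  have H_mono: "H m \<subseteq> H n" if "n \<le> m" for m n
    using order.trans[OF that] unfolding H_def by blast
  have mid_H: "mid z z' \<in> H n" if z: "z \<in> H n" and z': "z' \<in> H n" for z z' n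
  proof -
    have W: "z \<in> vectors K (rates_until p (ereal T))" "z' \<in> vectors K (rates_until p (ereal T))"
      using z z' by (auto simp: H_def)
    note L = W[THEN vectors_rates_until_Lp]
    have L2: "(\<lambda>k \<theta>. z k \<theta> + z' k \<theta>) \<in> vectors K (Lp p)"
      by (rule vectorsI) (intro Lp_add p0 L[THEN vectorsD])
    have W_mid: "mid z z' \<in> vectors K (rates_until p (ereal T))"
      unfolding mid_def by (rule vectorsI) (intro rates_until_midpoint p W[THEN vectorsD])
    have avg: "(a + b) / 2 \<le> c" if "a \<le> c" "b \<le> c" for a b c :: real using that by simp
    have "Lp_integral p (mid z z' k) \<le> M" if k: "k \<in> K" for k
    proof -
      have "Lp_integral p (mid z z' k) \<le> (Lp_integral p (z k) + Lp_integral p (z' k)) / 2"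
        unfolding mid_def by (intro rates_until_midpoint(2)[of p _ T] p W[THEN vectorsD] k)
      also have "\<dots> \<le> M"
        by (rule avg) (use z z' k in \<open>auto simp: H_def\<close>)
      finally show ?thesis .
    qed
    moreover have "\<phi> (mid z z') \<in> {a..b}"
      if \<phi>: "\<phi> \<in> Lp_dual p K" and ab: "\<forall>m\<ge>n. \<phi> (x m) \<in> {a..b}" for \<phi> a b
    proof -
      have "\<phi> (mid z z') = 1 / 2 * (\<phi> z + \<phi> z')"
        unfolding mid_def using Lp_dual_scale[OF \<phi> L2, of "1 / 2"] Lp_dual_add[OF \<phi> L] by simp
      moreover have "\<phi> z \<in> {a..b}" "\<phi> z' \<in> {a..b}" using z z' \<phi> ab unfolding H_def by blast+
      ultimately show ?thesis by auto
    qed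
    ultimately show ?thesis using W_mid unfolding H_def by blast
  qed
  define d where "d n = Inf (J ` H n)" for n
  have bdd: "bdd_below (J ` H n)" for n using J0 by (auto intro!: bdd_belowI[of _ 0])
  have dJ: "d n \<le> J z" if "z \<in> H n" for z n unfolding d_def by (rule cInf_lower[OF _ bdd]) (use that in auto)
  have d_mono: "incseq d" unfolding d_def incseq_def
  proof (intro allI impI)
    fix m n :: nat assume "m \<le> n"
    then show "Inf (J ` H m) \<le> Inf (J ` H n)"
      using xH[of n n] by (intro cInf_superset_mono image_mono bdd H_mono) auto
  qed
  have d_bd: "d n \<le> real (card K) * M" for n using dJ[OF xH[of n n]] JM[OF xH[of n n]] by simp
  then obtain L where L: "d \<longlonglongrightarrow> L" "\<And>n. d n \<le> L" using incseq_convergent[OF d_mono] by blast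
  have "\<exists>z\<in>H n. J z < d n + 1 / real (Suc n)" for n
    using cInf_lessD[of "J ` H n" "d n + 1 / real (Suc n)"] xH[of n n]
    by (force simp: d_def simp del: of_nat_Suc)
  then obtain z where z: "\<And>n. z n \<in> H n" "\<And>n. J (z n) < d n + 1 / real (Suc n)" by metis
  have zW: "z n \<in> vectors K (rates_until p (ereal T))" for n using z by (auto simp: H_def)
  have zM: "Lp_integral p (z n k) \<le> M" if "k \<in> K" for n k using z that by (auto simp: H_def)
  \<comment> \<open>For \<open>m, n \<ge> N\<close> both \<open>J (z m)\<close> and
    \<open>J (z n)\<close> are at most \<open>L + 1 / real (Suc N)\<close>, and the midpoint lies in
    \<open>H N\<close>, so its \<open>J\<close> is at least \<open>d N\<close>.\<close>
  define \<gamma> where "\<gamma> N = L + 1 / real (Suc N) - d N" for N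
  have "(\<lambda>N. L + 1 / real (Suc N) - d N) \<longlonglongrightarrow> L + 0 - L"
    using LIMSEQ_Suc[OF lim_inverse_n'] by (intro tendsto_intros L) simp
  moreover have "\<gamma> = (\<lambda>N. L + 1 / real (Suc N) - d N)" by (auto simp: \<gamma>_def)
  ultimately have \<gamma>_lim: "\<gamma> \<longlonglongrightarrow> 0" by simp
  have deficit: "(Lp_integral p (z m k) + Lp_integral p (z n k)) / 2 - Lp_integral p (mid (z m) (z n) k) \<le> \<gamma> N"
    if k: "k \<in> K" and mn: "N \<le> m" "N \<le> n" for k m n N
  proof -
    \<comment> \<open>Near-minimality controls the total deficit over \<open>K\<close>. Every single
      deficit is non-negative by convexity, hence bounded by the total.\<close>
    define E where "E k = (Lp_integral p (z m k) + Lp_integral p (z n k)) / 2 - Lp_integral p (mid (z m) (z n) k)" for k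
    have "0 \<le> E k" if "k \<in> K" for k
      unfolding E_def mid_def using rates_until_midpoint(2)[OF p zW[THEN vectorsD, OF that] zW[THEN vectorsD, OF that]] by simp
    then have "E k \<le> sum E K" by (intro member_le_sum k K) auto
    also have "sum E K = (J (z m) + J (z n)) / 2 - J (mid (z m) (z n))"
      by (simp add: E_def J_def sum_subtractf sum.distrib sum_divide_distrib[symmetric])
    also have "\<dots> \<le> \<gamma> N"
    proof -
      have "mid (z m) (z n) \<in> H N" using mid_H z(1) H_mono[OF mn(1)] H_mono[OF mn(2)] by blast
      then have "d N \<le> J (mid (z m) (z n))" by (rule dJ)
      moreover have "J (z j) \<le> L + 1 / real (Suc N)" if "N \<le> j" for j
      proof -
        have "1 / real (Suc j) \<le> 1 / real (Suc N)" using that by (intro divide_left_mono) auto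
        then show ?thesis using z(2)[of j] L(2)[of j] by linarith
      qed
      from this[OF mn(1)] this[OF mn(2)]
      have "(J (z m) + J (z n)) / 2 \<le> L + 1 / real (Suc N)" by (simp add: field_simps)
      ultimately show ?thesis unfolding \<gamma>_def by linarith
    qed
    finally show ?thesis by (simp add: E_def)
  qed
  define Q where "Q k y r \<longleftrightarrow> strict_mono r \<and> y \<in> Lp p \<and> (AE \<theta> in lebesgue. (\<lambda>n. z (r n) k \<theta>) \<longlonglongrightarrow> y \<theta>) \<and>
      (\<lambda>n. Lp_integral p (\<lambda>\<theta>. z n k \<theta> - y \<theta>)) \<longlonglongrightarrow> 0" for k y and r :: "nat \<Rightarrow> nat"
  have "\<exists>y r. Q k y r" if k: "k \<in> K" for k
  proof -
    have M0: "0 \<le> M" using order.trans[OF Lp_integral_nonneg zM[OF k, of 0]] .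
    have Cau: "\<exists>N. \<forall>m\<ge>N. \<forall>n\<ge>N. Lp_integral p (\<lambda>\<theta>. z m k \<theta> - z n k \<theta>) \<le> e" if e: "0 < e" for e
    proof -
      \<comment> \<open>Chosen to spend half of \<open>e\<close> on the term with
        \<open>2 * M\<close>; the summand 1 covers \<open>M = 0\<close>.\<close>
      define e' where "e' = e / (4 * (M + 1))"
      have e': "0 < e'" "e' * (2 * M) \<le> e / 2"
        using e M0 by (auto simp: e'_def field_simps)
      obtain C where C: "0 \<le> C"
        "\<And>x y. x \<in> rates_until p (ereal T) \<Longrightarrow> y \<in> rates_until p (ereal T) \<Longrightarrow>
        Lp_integral p (\<lambda>\<theta>. x \<theta> - y \<theta>) \<le> e' * (Lp_integral p x + Lp_integral p y)
        + C * ((Lp_integral p x + Lp_integral p y) / 2 - Lp_integral p (\<lambda>\<theta>. 1 / 2 * (x \<theta> + y \<theta>)))"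
        using rates_until_uniformly_convex[OF p e'(1), of T] by blast
      have "(\<lambda>N. C * \<gamma> N) \<longlonglongrightarrow> 0" using \<gamma>_lim by (rule tendsto_mult_right_zero)
      then have "\<forall>\<^sub>F N in sequentially. C * \<gamma> N < e / 2" by (rule order_tendstoD) (use e in simp)
      then obtain N where N: "C * \<gamma> N < e / 2" by (auto simp: eventually_sequentially)
      have "Lp_integral p (\<lambda>\<theta>. z m k \<theta> - z n k \<theta>) \<le> e" if "N \<le> m" "N \<le> n" for m n
      proof -
        have "Lp_integral p (\<lambda>\<theta>. z m k \<theta> - z n k \<theta>) \<le> e' * (Lp_integral p (z m k) + Lp_integral p (z n k))
          + C * ((Lp_integral p (z m k) + Lp_integral p (z n k)) / 2 - Lp_integral p (mid (z m) (z n) k))"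
          unfolding mid_def by (intro C zW[THEN vectorsD] k)
        also have "\<dots> \<le> e' * (2 * M) + C * \<gamma> N"
          using zM[OF k, of m] zM[OF k, of n] e' C(1)
          by (intro add_mono mult_left_mono deficit k that) auto
        finally show ?thesis using e' N by simp
      qed
      then show ?thesis by blast
    qed
    show ?thesis unfolding Q_def
      by (rule Lp_Cauchy_limit[of p "\<lambda>n. z n k"])
        (use p0 Cau zW[THEN vectorsD, OF k] rates_untilD(1) in blast)+
  qed
  then obtain y r where "\<And>k. k \<in> K \<Longrightarrow> Q k (y k) (r k)" by metis
  then have y: "\<And>k. k \<in> K \<Longrightarrow> strict_mono (r k)" "\<And>k. k \<in> K \<Longrightarrow> y k \<in> Lp p"
    "\<And>k. k \<in> K \<Longrightarrow> AE \<theta> in lebesgue. (\<lambda>n. z (r k n) k \<theta>) \<longlonglongrightarrow> y k \<theta>"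
    "\<And>k. k \<in> K \<Longrightarrow> (\<lambda>n. Lp_integral p (\<lambda>\<theta>. z n k \<theta> - y k \<theta>)) \<longlonglongrightarrow> 0"
    unfolding Q_def by auto
  have yk: "y k \<in> rates_until p (ereal T)" "Lp_integral p (y k) \<le> M" if k: "k \<in> K" for k
  proof -
    have zk: "z n k \<in> rates_until p (ereal T)" for n using zW k by (rule vectorsD)
    have "AE \<theta> in lebesgue. \<forall>n. 0 \<le> z (r k n) k \<theta>"
      using rates_untilD(2)[OF zk] by (simp add: AE_all_countable)
    with y(3)[OF k] have "AE \<theta> in lebesgue. 0 \<le> y k \<theta>"
      by eventually_elim (auto intro: LIMSEQ_le_const)
    moreover have "AE \<theta> in lebesgue. \<forall>n. \<theta> \<notin> {0..T} \<longrightarrow> z (r k n) k \<theta> = 0"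
      using rates_untilD(3)[OF zk] by (subst AE_all_countable) blast
    with y(3)[OF k] have "AE \<theta> in lebesgue. \<theta> \<notin> {0..T} \<longrightarrow> y k \<theta> = 0"
    proof eventually_elim
      case (elim \<theta>)
      show ?case
      proof
        assume "\<theta> \<notin> {0..T}"
        with elim(2) have "(\<lambda>n. z (r k n) k \<theta>) = (\<lambda>_. 0)" by auto
        with elim(1) show "y k \<theta> = 0" by (simp add: LIMSEQ_const_iff)
      qed
    qed
    ultimately show "y k \<in> rates_until p (ereal T)" using y(2)[OF k] by (simp add: rates_until_iff)
    show "Lp_integral p (y k) \<le> M"
      by (rule Lp_Fatou(2)[OF p0(1) rates_untilD(1)[OF zk] _ y(3)[OF k] LpD(1)[OF y(2)[OF k]]])
        (use zM k in auto)
  qed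
  then have yW: "y \<in> vectors K (rates_until p (ereal T))" by (intro vectorsI)
  show ?thesis
  proof (rule that[OF yW yk(2)])
    fix \<phi> c assume \<phi>: "\<phi> \<in> Lp_dual p K" and lim: "(\<lambda>n. \<phi> (x n)) \<longlonglongrightarrow> c"
    have zy: "(\<lambda>n. \<phi> (z n)) \<longlonglongrightarrow> \<phi> y"
      by (rule Lp_dual_tendsto[OF p0(1) K \<phi>]) (use zW yW vectors_rates_until_Lp y(4) in blast)+
    moreover have "(\<lambda>n. \<phi> (z n)) \<longlonglongrightarrow> c"
    proof (rule LIMSEQ_I)
      fix e :: real assume "0 < e"
      then obtain N where N: "\<And>n. N \<le> n \<Longrightarrow> \<bar>\<phi> (x n) - c\<bar> < e / 2"
        using LIMSEQ_D[OF lim, of "e / 2"] by auto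
      \<comment> \<open>The interval catches the whole tail of \<open>\<phi> (x m)\<close>, and
        therefore, by the definition of \<open>H\<close>, also \<open>\<phi> (z n)\<close>.\<close>
      have "\<phi> (z n) \<in> {c - e / 2..c + e / 2}" if n: "N \<le> n" for n
      proof -
        have "\<forall>m\<ge>n. \<phi> (x m) \<in> {c - e / 2..c + e / 2}"
        proof (intro allI impI)
          fix m assume "n \<le> m"
          with N[of m] n show "\<phi> (x m) \<in> {c - e / 2..c + e / 2}" by (auto simp: abs_if split: if_splits)
        qed
        then show ?thesis using z(1)[of n] \<phi> unfolding H_def by blast
      qed
      then show "\<exists>N. \<forall>n\<ge>N. norm (\<phi> (z n) - c) < e"
        using \<open>0 < e\<close> by (intro exI[of _ N]) (force simp: abs_if)
    qed
    ultimately show "\<phi> y = c" by (rule LIMSEQ_unique)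
  qed
qed

section \<open>Moments determine weak convergence\<close>

definition test_integral :: "'k \<Rightarrow> real \<Rightarrow> ('k \<Rightarrow> real \<Rightarrow> real) \<Rightarrow> real" where
  "test_integral k a x = (LINT \<theta>|lebesgue. indicator {0..a} \<theta> * x k \<theta>)"

text \<open>Pointwise, \<open>\<bar>x\<bar>\<close> is at most 1 or at most
  \<open>\<bar>x\<bar> powr p\<close>. This replaces Hoelder's inequality and the conjugate exponent
  by a bound that is not homogeneous.\<close>

lemma Lp_indicator_integral:
  assumes p: "1 \<le> p" and x: "x \<in> Lp p"
  shows "integrable lebesgue (\<lambda>\<theta>. indicator {0..a} \<theta> * x \<theta>)"
    and "\<bar>LINT \<theta>|lebesgue. indicator {0..a} \<theta> * x \<theta>\<bar> \<le> \<bar>a\<bar> + Lp_integral p x"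
proof -
  note [measurable] = LpD(1)[OF x]
  have le: "\<bar>indicator {0..a} \<theta> * x \<theta>\<bar> \<le> indicator {0..a} \<theta> + \<bar>x \<theta>\<bar> powr p" for \<theta>
  proof (cases "\<bar>x \<theta>\<bar> \<le> 1")
    case True
    then show ?thesis by (auto simp: indicator_def intro: add_increasing2)
  next
    case False
    then have "\<bar>x \<theta>\<bar> powr 1 \<le> \<bar>x \<theta>\<bar> powr p" using p by (intro powr_mono) auto
    then show ?thesis using False by (auto simp: indicator_def)
  qed
  have ind: "integrable lebesgue (indicator {0..a} :: real \<Rightarrow> real)"
    by (intro integrable_real_indicator) (auto simp: emeasure_lborel_Icc_eq)
  note bd = Bochner_Integration.integrable_add[OF ind LpD(2)[OF x]]
  have [measurable]: "(\<lambda>\<theta>. indicator {0..a} \<theta> * x \<theta>) \<in> borel_measurable lebesgue"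
    by (intro borel_measurable_times borel_measurable_indicator) auto
  show int: "integrable lebesgue (\<lambda>\<theta>. indicator {0..a} \<theta> * x \<theta>)"
    by (rule Bochner_Integration.integrable_bound[OF bd]) (use le in \<open>auto intro!: AE_I2\<close>)
  have "\<bar>LINT \<theta>|lebesgue. indicator {0..a} \<theta> * x \<theta>\<bar> \<le> (LINT \<theta>|lebesgue. \<bar>indicator {0..a} \<theta> * x \<theta>\<bar>)"
    by (rule integral_abs_bound)
  also have "\<dots> \<le> (LINT \<theta>|lebesgue. indicator {0..a} \<theta> + \<bar>x \<theta>\<bar> powr p)"
    by (rule integral_mono[OF integrable_abs[OF int] bd le])
  also have "\<dots> = measure lebesgue {0..a} + Lp_integral p x"
    using Bochner_Integration.integral_add[OF ind LpD(2)[OF x]] by simp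
  also have "measure lebesgue {0..a} \<le> \<bar>a\<bar>" by (cases "0 \<le> a") auto
  finally show "\<bar>LINT \<theta>|lebesgue. indicator {0..a} \<theta> * x \<theta>\<bar> \<le> \<bar>a\<bar> + Lp_integral p x" by simp
qed

lemma test_integral_add:
  assumes "1 \<le> p" "x k \<in> Lp p" "y k \<in> Lp p"
  shows "test_integral k a (\<lambda>k \<theta>. x k \<theta> + y k \<theta>) = test_integral k a x + test_integral k a y"
  using Lp_indicator_integral(1)[OF assms(1,2)] Lp_indicator_integral(1)[OF assms(1,3)]
  by (simp add: test_integral_def distrib_left)

lemma test_integral_scale: "test_integral k a (\<lambda>k \<theta>. c * x k \<theta>) = c * test_integral k a x"
  by (simp add: test_integral_def mult.left_commute)

lemma test_integral_le:
  assumes "1 \<le> p" "x k \<in> Lp p"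
  shows "\<bar>test_integral k a x\<bar> \<le> \<bar>a\<bar> + Lp_integral p (x k)"
  unfolding test_integral_def by (rule Lp_indicator_integral(2)[OF assms])

text \<open>Rescaling \<open>x k\<close> to norm 1 turns the inhomogeneous bound of
  \<open>test_integral_le\<close> into a linear one. A function of norm 0 vanishes almost everywhere
  and is treated apart.\<close>

lemma test_integral_in_Lp_dual:
  assumes p: "1 \<le> p" and K: "finite K" and k: "k \<in> K"
  shows "test_integral k a \<in> Lp_dual p K"
proof -
  have "\<bar>test_integral k a x\<bar> \<le> (\<bar>a\<bar> + 1) * Lp_norm p (x k)" if x: "x k \<in> Lp p" for x
  proof (cases "Lp_integral p (x k) = 0")
    case True
    have "AE \<theta> in lebesgue. indicator {0..a} \<theta> * x k \<theta> = 0"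
      using Lp_integral_0_AE[OF x True] by eventually_elim simp
    then have "test_integral k a x = 0"
      unfolding test_integral_def by (rule integral_eq_zero_AE)
    then show ?thesis by (simp add: Lp_norm_nonneg)
  next
    case False
    define N where "N = Lp_norm p (x k)"
    have I: "0 < Lp_integral p (x k)" 
      using False Lp_integral_nonneg by (metis less_eq_real_def)
    then have N: "0 < N" by (simp add: N_def Lp_norm_def)
    have Np: "N powr p = Lp_integral p (x k)" using p I by (simp add: N_def Lp_norm_def powr_powr)
    have "Lp_integral p (\<lambda>\<theta>. 1 / N * x k \<theta>) = 1"
      using Lp_scale(2)[OF x, of "1 / N"] N I by (simp add: powr_divide Np)
    then have "\<bar>test_integral k a (\<lambda>k \<theta>. 1 / N * x k \<theta>)\<bar> \<le> \<bar>a\<bar> + 1"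
      using test_integral_le[OF p, of "\<lambda>k \<theta>. 1 / N * x k \<theta>" k a] Lp_scale(1)[OF x, of "1 / N"] by simp
    then show ?thesis unfolding test_integral_scale using N by (simp add: abs_mult field_simps N_def)
  qed
  then have "\<bar>test_integral k a x\<bar> \<le> (\<bar>a\<bar> + 1) * vec_norm p K x" if "x \<in> vectors K (Lp p)" for x
    using vectorsD[OF that k] Lp_norm_le_vec_norm[OF K k, of p x]
    by (meson abs_ge_zero add_nonneg_nonneg mult_left_mono order_trans zero_le_one)
  moreover have "test_integral k a (\<lambda>k \<theta>. x k \<theta> + y k \<theta>) = test_integral k a x + test_integral k a y"
    if "x \<in> vectors K (Lp p)" "y \<in> vectors K (Lp p)" for x y
    by (intro test_integral_add[OF p] vectorsD[OF _ k] that)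
  ultimately show ?thesis
    unfolding Lp_dual_def by (auto simp: test_integral_scale)
qed

text \<open>Moments become the distribution function of a finite Borel measure, for which a
  uniqueness theorem holds. Taking the positive part of a Borel version makes the density
  non-negative everywhere.\<close>

lemma rates_until_Borel_density:
  assumes p: "1 \<le> p" and y: "y \<in> rates_until p (ereal T)"
  obtains h :: "real \<Rightarrow> real" where "h \<in> borel_measurable borel" "\<And>\<theta>. 0 \<le> h \<theta>"
    "AE \<theta> in lebesgue. y \<theta> = h \<theta>" "finite_borel_measure (density lborel (\<lambda>\<theta>. ennreal (h \<theta>)))"
    "\<And>s. cdf (density lborel (\<lambda>\<theta>. ennreal (h \<theta>))) s = (LINT \<theta>|lebesgue. indicator {0..s} \<theta> * y \<theta>)"
proof -
  note y' = rates_untilD[OF y] and [measurable] = LpD(1)[OF rates_untilD(1)[OF y]]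
  obtain g where g: "g \<in> borel_measurable lborel" "AE \<theta> in lborel. y \<theta> = g \<theta>"
    using completion_ex_borel_measurable_real[of y lborel] LpD(1)[OF y'(1)] by auto
  define h where "h \<theta> = max 0 (g \<theta>)" for \<theta>
  have [measurable]: "h \<in> borel_measurable borel" using g unfolding h_def by simp
  have h0: "0 \<le> h \<theta>" for \<theta> by (simp add: h_def)
  have "AE \<theta> in lebesgue. y \<theta> = g \<theta>" using g(2) by (rule AE_completion)
  with y'(2) have yh: "AE \<theta> in lebesgue. y \<theta> = h \<theta>" by eventually_elim (simp add: h_def)
  define \<mu> where "\<mu> = density lborel (\<lambda>\<theta>. ennreal (h \<theta>))"
  have sets: "sets \<mu> = sets borel" "space \<mu> = UNIV" by (auto simp: \<mu>_def)
  \<comment> \<open>Only the part of \<open>A\<close> in \<open>{0..T}\<close> carries mass. Stated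
    for general \<open>A\<close>, this covers the whole line with \<open>s = T\<close>, giving
    finiteness, and the half-lines \<open>{..s}\<close>.\<close>
  have eq: "emeasure \<mu> A = ennreal (LINT \<theta>|lebesgue. indicator {0..s} \<theta> * y \<theta>)"
    if A[measurable]: "A \<in> sets borel" and As: "A \<inter> {0..T} = {0..s} \<inter> {0..T}" for A s
  proof -
    have "emeasure \<mu> A = (\<integral>\<^sup>+\<theta>. ennreal (h \<theta>) * indicator A \<theta> \<partial>lborel)"
      unfolding \<mu>_def by (rule emeasure_density) simp_all
    also have "\<dots> = (\<integral>\<^sup>+\<theta>. ennreal (h \<theta>) * indicator A \<theta> \<partial>lebesgue)"
      by (simp add: nn_integral_completion)
    also have "\<dots> = (\<integral>\<^sup>+\<theta>. ennreal (indicator {0..s} \<theta> * y \<theta>) \<partial>lebesgue)"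
    proof (rule nn_integral_cong_AE, use yh y'(3) in eventually_elim)
      case (elim \<theta>)
      show ?case
      proof (cases "\<theta> \<in> {0..T}")
        case True
        then have "\<theta> \<in> A \<longleftrightarrow> \<theta> \<in> {0..s}" using As by blast
        then show ?thesis using elim by (simp add: indicator_def)
      qed (use elim in simp)
    qed
    also have "\<dots> = ennreal (LINT \<theta>|lebesgue. indicator {0..s} \<theta> * y \<theta>)"
      by (rule nn_integral_eq_integral[OF Lp_indicator_integral(1)[OF p y'(1)]])
        (use y'(2) in eventually_elim, simp)
    finally show ?thesis .
  qed
  have "emeasure \<mu> UNIV \<noteq> \<infinity>" by (subst eq[of UNIV T]) auto
  then have fin: "finite_borel_measure \<mu>"
    by (intro finite_borel_measure.intro finite_borel_measure_axioms.intro finite_measureI) (simp_all add: sets)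
  have cdf: "cdf \<mu> s = (LINT \<theta>|lebesgue. indicator {0..s} \<theta> * y \<theta>)" for s
  proof -
    have "emeasure \<mu> {..s} = ennreal (LINT \<theta>|lebesgue. indicator {0..s} \<theta> * y \<theta>)"
      by (rule eq) auto
    moreover have "0 \<le> (LINT \<theta>|lebesgue. indicator {0..s} \<theta> * y \<theta>)"
      by (rule integral_nonneg_AE) (use y'(2) in eventually_elim, simp)
    ultimately show ?thesis by (simp add: cdf_def measure_def)
  qed
  show ?thesis by (rule that[of h]) (use h0 yh fin cdf in \<open>simp_all add: \<mu>_def\<close>)
qed

text \<open>Distribution functions are right-continuous, so rational arguments suffice. They
  determine the measure, and the measure determines its density almost everywhere.\<close>

lemma rates_until_eqI:
  assumes p: "1 \<le> p" and y: "y \<in> rates_until p (ereal T)" and z: "z \<in> rates_until p (ereal T)"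
    and eq: "\<And>s. s \<in> \<rat> \<Longrightarrow> (LINT \<theta>|lebesgue. indicator {0..s} \<theta> * y \<theta>) = (LINT \<theta>|lebesgue. indicator {0..s} \<theta> * z \<theta>)"
  shows "AE \<theta> in lebesgue. y \<theta> = z \<theta>"
proof -
  obtain g :: "real \<Rightarrow> real" where g[measurable]: "g \<in> borel_measurable borel" and g0: "\<And>\<theta>. 0 \<le> g \<theta>"
    and yg: "AE \<theta> in lebesgue. y \<theta> = g \<theta>" and fg: "finite_borel_measure (density lborel (\<lambda>\<theta>. ennreal (g \<theta>)))"
    and cg: "\<And>s. cdf (density lborel (\<lambda>\<theta>. ennreal (g \<theta>))) s = (LINT \<theta>|lebesgue. indicator {0..s} \<theta> * y \<theta>)"
    using rates_until_Borel_density[OF p y] by blast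
  obtain h :: "real \<Rightarrow> real" where h[measurable]: "h \<in> borel_measurable borel" and h0: "\<And>\<theta>. 0 \<le> h \<theta>"
    and zh: "AE \<theta> in lebesgue. z \<theta> = h \<theta>" and fh: "finite_borel_measure (density lborel (\<lambda>\<theta>. ennreal (h \<theta>)))"
    and ch: "\<And>s. cdf (density lborel (\<lambda>\<theta>. ennreal (h \<theta>))) s = (LINT \<theta>|lebesgue. indicator {0..s} \<theta> * z \<theta>)"
    using rates_until_Borel_density[OF p z] by blast
  define F where "F = cdf (density lborel (\<lambda>\<theta>. ennreal (g \<theta>)))"
  define G where "G = cdf (density lborel (\<lambda>\<theta>. ennreal (h \<theta>)))"
  have "F a = G a" for a
  proof (rule ccontr)
    assume ne: "F a \<noteq> G a"
    have "((\<lambda>s. F s - G s) \<longlongrightarrow> F a - G a) (at_right a)"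
      using finite_borel_measure.cdf_is_right_cont[OF fg, of a] finite_borel_measure.cdf_is_right_cont[OF fh, of a]
      unfolding continuous_within F_def G_def by (rule tendsto_diff)
    then have "\<forall>\<^sub>F s in at_right a. F s - G s \<noteq> 0"
      by (rule tendsto_imp_eventually_ne) (use ne in simp)
    then obtain b where b: "a < b" "\<And>s. a < s \<Longrightarrow> s < b \<Longrightarrow> F s - G s \<noteq> 0"
      by (auto simp: eventually_at_right_field)
    obtain s where "s \<in> \<rat>" "a < s" "s < b" using Rats_dense_in_real[OF b(1)] by blast
    with b(2)[of s] eq[of s] show False by (simp add: F_def G_def cg ch)
  qed
  then have "density lborel (\<lambda>\<theta>. ennreal (g \<theta>)) = density lborel (\<lambda>\<theta>. ennreal (h \<theta>))"
    by (intro cdf_unique' fg fh) (auto simp: F_def G_def)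
  then have "AE \<theta> in lborel. ennreal (g \<theta>) = ennreal (h \<theta>)"
    by (intro sigma_finite_measure.density_unique[OF sigma_finite_lborel]) auto
  then have "AE \<theta> in lborel. g \<theta> = h \<theta>"
    by eventually_elim (use g0 h0 in simp)
  then have "AE \<theta> in lebesgue. g \<theta> = h \<theta>" by (rule AE_completion)
  with yg zh show ?thesis by eventually_elim simp
qed

text \<open>Otherwise some \<open>\<phi>\<close> stays away from \<open>\<phi> y\<close> along a
  subsequence, which can be refined so that its values converge to some \<open>c\<close>. The
  cluster point \<open>z\<close> of the refinement has the moments of \<open>y\<close>, so
  \<open>z\<close> equals \<open>y\<close> almost everywhere and
  \<open>c = \<phi> z = \<phi> y\<close>.\<close>

lemma weakly_convergesI_test_integral:
  assumes p: "1 < p" and K: "finite K"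
    and x: "\<And>n. x n \<in> vectors K (rates_until p (ereal T))" and y: "y \<in> vectors K (rates_until p (ereal T))"
    and M: "\<And>n k. k \<in> K \<Longrightarrow> Lp_integral p (x n k) \<le> M"
    and lim: "\<And>k s. k \<in> K \<Longrightarrow> s \<in> \<rat> \<Longrightarrow> (\<lambda>n. test_integral k s (x n)) \<longlonglongrightarrow> test_integral k s y"
  shows "weakly_converges p K x y"
  unfolding weakly_converges_def
proof (intro conjI allI ballI)
  fix \<phi> assume \<phi>: "\<phi> \<in> Lp_dual p K"
  obtain C where C: "\<And>x. x \<in> vectors K (Lp p) \<Longrightarrow> \<bar>\<phi> x\<bar> \<le> C * vec_norm p K x"
    using \<phi> unfolding Lp_dual_def by blast
  define R where "R = \<bar>C\<bar> * (\<Sum>k\<in>K. M powr (1 / p))"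
  have R: "\<bar>\<phi> (x n)\<bar> \<le> R" for n
  proof -
    have "\<bar>\<phi> (x n)\<bar> \<le> C * vec_norm p K (x n)" by (intro C vectors_rates_until_Lp[OF x])
    also have "\<dots> \<le> \<bar>C\<bar> * vec_norm p K (x n)"
      by (intro mult_right_mono vec_norm_nonneg K) simp
    also have "\<dots> \<le> \<bar>C\<bar> * (\<Sum>k\<in>K. Lp_norm p (x n k))"
      by (intro mult_left_mono vec_norm_le_sum K) simp
    also have "\<dots> \<le> R"
      unfolding R_def Lp_norm_def using p M
      by (intro mult_left_mono sum_mono powr_mono2 Lp_integral_nonneg) auto
    finally show ?thesis .
  qed
  show "(\<lambda>n. \<phi> (x n)) \<longlonglongrightarrow> \<phi> y"
  proof (rule ccontr)
    assume "\<not> ?thesis"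
    then obtain e where e: "0 < e" "\<forall>N. \<exists>n\<ge>N. e \<le> \<bar>\<phi> (x n) - \<phi> y\<bar>"
      by (auto simp: LIMSEQ_def dist_real_def not_less)
    then have "infinite {n. e \<le> \<bar>\<phi> (x n) - \<phi> y\<bar>}" by (auto simp: infinite_nat_iff_unbounded_le)
    then obtain r :: "nat \<Rightarrow> nat" where r: "strict_mono r" "\<And>n. e \<le> \<bar>\<phi> (x (r n)) - \<phi> y\<bar>"
      using infinite_enumerate by blast
    have "bounded (range (\<lambda>n. \<phi> (x (r n))))"
      using R by (auto simp: bounded_iff)
    then obtain c l where l: "strict_mono l" "((\<lambda>n. \<phi> (x (r n))) \<circ> l) \<longlonglongrightarrow> c"
      using bounded_imp_convergent_subsequence by blast
    define t where "t n = r (l n)" for n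
    have t: "strict_mono t" using r l by (simp add: t_def strict_mono_def)
    obtain z where z: "z \<in> vectors K (rates_until p (ereal T))"
      "\<And>\<phi> c. \<phi> \<in> Lp_dual p K \<Longrightarrow> (\<lambda>n. \<phi> (x (t n))) \<longlonglongrightarrow> c \<Longrightarrow> \<phi> z = c"
      by (rule weak_cluster_point[of p K "\<lambda>n. x (t n)" T M]) (use p K x M in auto)
    have "ae_eq_on K z y" unfolding ae_eq_on_def
    proof
      fix k assume k: "k \<in> K"
      show "AE \<theta> in lebesgue. z k \<theta> = y k \<theta>"
      proof (rule rates_until_eqI[of p _ T])
        fix s :: real assume "s \<in> \<rat>"
        from LIMSEQ_subseq_LIMSEQ[OF lim[OF k this] t]
        have "(\<lambda>n. test_integral k s (x (t n))) \<longlonglongrightarrow> test_integral k s y" by (simp add: comp_def)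
        from z(2)[OF test_integral_in_Lp_dual this] p K k
        show "(LINT \<theta>|lebesgue. indicator {0..s} \<theta> * z k \<theta>) = (LINT \<theta>|lebesgue. indicator {0..s} \<theta> * y k \<theta>)"
          by (simp add: test_integral_def)
      qed (use p z y k in \<open>auto intro: vectorsD\<close>)
    qed
    then have "\<phi> z = \<phi> y"
      using p by (intro Lp_dual_cong[OF _ K \<phi>] vectors_rates_until_Lp[OF z(1)] vectors_rates_until_Lp[OF y]) auto
    moreover have c: "(\<lambda>n. \<phi> (x (t n))) \<longlonglongrightarrow> c" using l(2) by (simp add: t_def comp_def)
    ultimately have "(\<lambda>n. \<bar>\<phi> (x (t n)) - \<phi> y\<bar>) \<longlonglongrightarrow> \<bar>\<phi> y - \<phi> y\<bar>"
      using z(2)[OF \<phi> c] by (intro tendsto_intros) simp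
    moreover have "e \<le> \<bar>\<phi> (x (t n)) - \<phi> y\<bar>" for n using r(2) by (simp add: t_def)
    ultimately have "e \<le> \<bar>\<phi> y - \<phi> y\<bar>" by (intro LIMSEQ_le_const) auto
    with e show False by simp
  qed
qed (use x y vectors_rates_until_Lp in blast)+

section \<open>The ball as a compact convex set of sequences\<close>

text \<open>The test \<open>k \<in> K\<close> only matters for \<open>K = {}\<close>, where \<open>from_nat_into\<close> returns a junk value.\<close>

definition coords :: "'k set \<Rightarrow> ('k \<Rightarrow> real \<Rightarrow> real) \<Rightarrow> nat \<Rightarrow> real" where
  "coords K x j = (case from_nat_into (K \<times> \<rat>) j of (k, s) \<Rightarrow> if k \<in> K then test_integral k s x else 0)"

definition Lp_ball :: "real \<Rightarrow> real \<Rightarrow> 'k set \<Rightarrow> real \<Rightarrow> ('k \<Rightarrow> real \<Rightarrow> real) set" where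
  "Lp_ball p T K M = {x \<in> vectors K (rates_until p (ereal T)). \<forall>k\<in>K. Lp_integral p (x k) \<le> M}"

lemma coords_cases:
  obtains "\<And>x. coords K x j = 0"
  | k s where "k \<in> K" "\<And>x. coords K x j = test_integral k s x"
proof -
  obtain k s where ks: "from_nat_into (K \<times> (\<rat> :: real set)) j = (k, s)" by fastforce
  show ?thesis
  proof (cases "k \<in> K")
    case True
    then show ?thesis using that(2)[of k s] ks by (simp add: coords_def)
  next
    case False
    then show ?thesis using that(1) ks by (simp add: coords_def)
  qed
qed

lemma test_integral_coords:
  fixes K :: "'k set"
  assumes "finite K" "k \<in> K" "s \<in> \<rat>"
  obtains j where "\<And>x. coords K x j = test_integral k s x"
proof -
  have "countable (K \<times> (\<rat> :: real set))"
    using assms(1) by (intro countable_SIGMA countable_finite countable_rat)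
  then obtain j where "from_nat_into (K \<times> \<rat>) j = (k, s)"
    using from_nat_into_surj[of "K \<times> \<rat>" "(k, s)"] assms by auto
  then show ?thesis using assms by (intro that[of j]) (simp add: coords_def)
qed

lemma coords_affine:
  assumes p: "1 \<le> p" and x: "x \<in> vectors K (Lp p)" and y: "y \<in> vectors K (Lp p)"
  shows "coords K (\<lambda>k \<theta>. a * x k \<theta> + b * y k \<theta>) = (\<lambda>j. a * coords K x j + b * coords K y j)"
proof
  fix j
  show "coords K (\<lambda>k \<theta>. a * x k \<theta> + b * y k \<theta>) j = a * coords K x j + b * coords K y j"
  proof (cases K j rule: coords_cases)
    case (2 k s)
    then show ?thesis
      using test_integral_add[OF p, of "\<lambda>k \<theta>. a * x k \<theta>" k "\<lambda>k \<theta>. b * y k \<theta>" s]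
        Lp_scale(1)[OF vectorsD[OF x]] Lp_scale(1)[OF vectorsD[OF y]]
      by (simp add: test_integral_scale)
  qed simp
qed

text \<open>Thus \<open>coords\<close> represents classes by points, as Kakutani's theorem
  requires.\<close>

lemma coords_eq_iff:
  assumes p: "1 \<le> p" and K: "finite K"
    and x: "x \<in> vectors K (rates_until p (ereal T))" and y: "y \<in> vectors K (rates_until p (ereal T))"
  shows "coords K x = coords K y \<longleftrightarrow> ae_eq_on K x y"
proof
  assume eq: "coords K x = coords K y"
  show "ae_eq_on K x y" unfolding ae_eq_on_def
  proof
    fix k assume k: "k \<in> K"
    show "AE \<theta> in lebesgue. x k \<theta> = y k \<theta>"
    proof (rule rates_until_eqI[OF p vectorsD[OF x k] vectorsD[OF y k]])
      fix s :: real assume "s \<in> \<rat>"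
      then obtain j where "\<And>x. coords K x j = test_integral k s x" using test_integral_coords[OF K k] by blast
      with fun_cong[OF eq, of j]
      show "(LINT \<theta>|lebesgue. indicator {0..s} \<theta> * x k \<theta>) = (LINT \<theta>|lebesgue. indicator {0..s} \<theta> * y k \<theta>)"
        by (simp add: test_integral_def)
    qed
  qed
next
  assume "ae_eq_on K x y"
  then have "test_integral k s x = test_integral k s y" if "k \<in> K" for k s
    using p by (intro Lp_dual_cong[OF _ K test_integral_in_Lp_dual[OF p K that]]
        vectors_rates_until_Lp[OF x] vectors_rates_until_Lp[OF y]) auto
  then show "coords K x = coords K y" by (auto simp: coords_def fun_eq_iff split: prod.splits)
qed

lemma weakly_convergesI_coords:
  assumes "1 < p" "finite K" "\<And>n. x n \<in> Lp_ball p T K M" "y \<in> Lp_ball p T K M"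
    and lim: "(\<lambda>n. coords K (x n)) \<longlonglongrightarrow> coords K y"
  shows "weakly_converges p K x y"
proof (rule weakly_convergesI_test_integral[where T = T and M = M])
  fix k s assume "k \<in> K" "s \<in> (\<rat> :: real set)"
  then obtain j where "\<And>x. coords K x j = test_integral k s x"
    using test_integral_coords[OF assms(2)] by blast
  moreover have "(\<lambda>n. coords K (x n) j) \<longlonglongrightarrow> coords K y j" using lim by (simp add: tendsto_fun_iff)
  ultimately show "(\<lambda>n. test_integral k s (x n)) \<longlonglongrightarrow> test_integral k s y" by simp
qed (use assms in \<open>auto simp: Lp_ball_def\<close>)

text \<open>Each coordinate is bounded on the ball, which gives a coordinatewise convergent
  subsequence. Its limit is attained by the weak cluster point, since every non-zero coordinate is a
  continuous functional.\<close>

lemma compact_coords_Lp_ball: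
  assumes p: "1 < p" and K: "finite K"
  shows "compact (coords K ` Lp_ball p T K M)"
  unfolding compact_eq_seq_compact_metric
proof (rule seq_compactI)
  fix c :: "nat \<Rightarrow> nat \<Rightarrow> real" assume "\<forall>n. c n \<in> coords K ` Lp_ball p T K M"
  then have "\<forall>n. \<exists>x. x \<in> Lp_ball p T K M \<and> c n = coords K x" by blast
  then obtain x where x: "\<And>n. x n \<in> Lp_ball p T K M" "\<And>n. c n = coords K (x n)"
    by metis
  have xW: "x n \<in> vectors K (rates_until p (ereal T))" for n using x by (simp add: Lp_ball_def)
  have xM: "Lp_integral p (x n k) \<le> M" if "k \<in> K" for n k using x that by (simp add: Lp_ball_def)
  have "\<exists>R. \<forall>n. \<bar>coords K (x n) j\<bar> \<le> R" for j
  proof (cases K j rule: coords_cases)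
    case (2 k s)
    have "\<bar>test_integral k s (x n)\<bar> \<le> \<bar>s\<bar> + Lp_integral p (x n k)" for n
      using p vectorsD[OF xW 2(1)] by (intro test_integral_le rates_untilD(1)) auto
    then have "\<bar>test_integral k s (x n)\<bar> \<le> \<bar>s\<bar> + M" for n
      using xM[OF 2(1)] by (meson add_left_mono order_trans)
    with 2(2) show ?thesis by auto
  qed auto
  then obtain R where R: "\<And>n j. \<bar>coords K (x n) j\<bar> \<le> R j" by metis
  have "c n \<in> Pi UNIV (\<lambda>j. {- R j..R j})" for n
    using R[of n] by (auto simp: x(2) abs_le_iff minus_le_iff)
  then obtain l r where r: "strict_mono (r :: nat \<Rightarrow> nat)" "(c \<circ> r) \<longlonglongrightarrow> l"
    using compact_box_fun[of "\<lambda>j. - R j" R] seq_compactE[of "Pi UNIV (\<lambda>j. {- R j..R j})" c]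
    unfolding compact_eq_seq_compact_metric by blast
  obtain y where y: "y \<in> vectors K (rates_until p (ereal T))" "\<And>k. k \<in> K \<Longrightarrow> Lp_integral p (y k) \<le> M"
    "\<And>\<phi> c. \<phi> \<in> Lp_dual p K \<Longrightarrow> (\<lambda>n. \<phi> (x (r n))) \<longlonglongrightarrow> c \<Longrightarrow> \<phi> y = c"
    by (rule weak_cluster_point[of p K "\<lambda>n. x (r n)" T M]) (use p K xW xM in auto)
  have "coords K y j = l j" for j
  proof -
    have lim: "(\<lambda>n. coords K (x (r n)) j) \<longlonglongrightarrow> l j" using r(2) by (simp add: tendsto_fun_iff x(2) comp_def)
    show ?thesis
    proof (cases K j rule: coords_cases)
      case 1
      with lim show ?thesis by (simp add: LIMSEQ_const_iff)
    next
      case (2 k s)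
      with lim y(3)[OF test_integral_in_Lp_dual[OF _ K 2(1)]] p show ?thesis by simp
    qed
  qed
  then have "l = coords K y" by auto
  with y have "l \<in> coords K ` Lp_ball p T K M" by (auto simp: Lp_ball_def)
  with r show "\<exists>l\<in>coords K ` Lp_ball p T K M. \<exists>r. strict_mono r \<and> (c \<circ> r) \<longlonglongrightarrow> l" by blast
qed

lemma convex_coords_Lp_ball:
  assumes p: "1 < p"
  shows "convex_functions (coords K ` Lp_ball p T K M)"
  unfolding convex_functions_def
proof (intro ballI allI impI)
  fix c c' and a b :: real
  assume c: "c \<in> coords K ` Lp_ball p T K M" "c' \<in> coords K ` Lp_ball p T K M"
    and ab: "0 \<le> a" "0 \<le> b" "a + b = 1"
  from c obtain x y where x: "x \<in> Lp_ball p T K M" "c = coords K x" and y: "y \<in> Lp_ball p T K M" "c' = coords K y"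
    by blast
  have W: "x \<in> vectors K (rates_until p (ereal T))" "y \<in> vectors K (rates_until p (ereal T))"
    using x y by (auto simp: Lp_ball_def)
  have "(\<lambda>k \<theta>. a * x k \<theta> + b * y k \<theta>) \<in> vectors K (rates_until p (ereal T))"
    by (rule vectorsI) (use p ab in \<open>auto intro!: rates_until_combination W[THEN vectorsD]\<close>)
  moreover have "Lp_integral p (\<lambda>\<theta>. a * x k \<theta> + b * y k \<theta>) \<le> M" if k: "k \<in> K" for k
  proof -
    have "Lp_integral p (\<lambda>\<theta>. a * x k \<theta> + b * y k \<theta>) \<le> a * Lp_integral p (x k) + b * Lp_integral p (y k)"
      by (rule convex_Lp_integral[OF p W[THEN vectorsD, OF k] ab])
    also have "\<dots> \<le> M"
      by (rule convex_bound_le) (use x(1) y(1) k ab in \<open>auto simp: Lp_ball_def\<close>)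
    finally show ?thesis .
  qed
  ultimately have "(\<lambda>k \<theta>. a * x k \<theta> + b * y k \<theta>) \<in> Lp_ball p T K M" by (simp add: Lp_ball_def)
  moreover have "coords K (\<lambda>k \<theta>. a * x k \<theta> + b * y k \<theta>) = (\<lambda>j. a * c j + b * c' j)"
    using coords_affine[of p x K y a b] p W[THEN vectors_rates_until_Lp] by (simp add: x(2) y(2))
  ultimately show "(\<lambda>j. a * c j + b * c' j) \<in> coords K ` Lp_ball p T K M"
    by (intro image_eqI[where x = "\<lambda>k \<theta>. a * x k \<theta> + b * y k \<theta>"]) simp_all
qed

section \<open>Flows as fixed points\<close>

lemma rates_until_subset_rates: "h \<in> rates_until p T \<Longrightarrow> h \<in> rates p"
  by (simp add: rates_until_def)

lemma truncate_rates:
  assumes h: "h \<in> rates p"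
  shows "(\<lambda>\<theta>. indicator {0..T} \<theta> * h \<theta>) \<in> rates_until p (ereal T)"
proof -
  have [measurable]: "h \<in> borel_measurable lebesgue" and nn: "AE \<theta> in lebesgue. 0 \<le> h \<theta>"
    and int: "integrable lebesgue (\<lambda>\<theta>. indicator {0..T} \<theta> *\<^sub>R \<bar>h \<theta>\<bar> powr p)"
    using h by (auto simp: rates_def set_integrable_def)
  have "(\<lambda>\<theta>. \<bar>indicator {0..T} \<theta> * h \<theta>\<bar> powr p) = (\<lambda>\<theta>. indicator {0..T} \<theta> *\<^sub>R \<bar>h \<theta>\<bar> powr p)"
    by (auto simp: indicator_def)
  moreover have "(\<lambda>\<theta>. indicator {0..T} \<theta> * h \<theta>) \<in> borel_measurable lebesgue"
    by (intro borel_measurable_times borel_measurable_indicator) auto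
  ultimately have "(\<lambda>\<theta>. indicator {0..T} \<theta> * h \<theta>) \<in> Lp p"
    using int by (simp add: Lp_def)
  moreover have "AE \<theta> in lebesgue. 0 \<le> indicator {0..T} \<theta> * h \<theta>"
    using nn by eventually_elim simp
  ultimately show ?thesis by (simp add: rates_until_iff)
qed

lemma Lp_integral_le_vec_norm:
  assumes "0 < p" "finite K" "k \<in> K" "vec_norm p K x \<le> B"
  shows "Lp_integral p (x k) \<le> B powr p"
proof -
  have "Lp_norm p (x k) \<le> B" using Lp_norm_le_vec_norm[OF assms(2,3)] assms(4) by (rule order.trans)
  then have "Lp_norm p (x k) powr p \<le> B powr p"
    using assms(1) by (intro powr_mono2) (auto simp: Lp_norm_nonneg)
  moreover have "Lp_norm p (x k) powr p = Lp_integral p (x k)"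
    using assms(1) Lp_integral_nonneg by (simp add: Lp_norm_def powr_powr)
  ultimately show ?thesis by simp
qed

lemma rates_until_zero: "0 < p \<Longrightarrow> (\<lambda>\<theta>. 0) \<in> rates_until p (ereal T)"
  by (simp add: rates_until_iff Lp_def)

text \<open>The order of quantifiers matters: one \<open>B\<close> serves all families
  \<open>h\<close>.\<close>

lemma rates_until_sum_bounded:
  assumes p: "0 < p" and S: "finite S"
  shows "\<exists>B. \<forall>h. (\<forall>e\<in>S. h e \<in> rates_until p (ereal T) \<and> Lp_integral p (h e) \<le> M) \<longrightarrow>
    (\<lambda>\<theta>. \<Sum>e\<in>S. h e \<theta>) \<in> rates_until p (ereal T) \<and> Lp_integral p (\<lambda>\<theta>. \<Sum>e\<in>S. h e \<theta>) \<le> B"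
  using S
proof induction
  case empty
  then show ?case using p by (intro exI[of _ 0]) (simp add: rates_until_zero)
next
  case (insert e S)
  then obtain B where B: "\<And>h. (\<forall>e\<in>S. h e \<in> rates_until p (ereal T) \<and> Lp_integral p (h e) \<le> M) \<Longrightarrow>
    (\<lambda>\<theta>. \<Sum>e\<in>S. h e \<theta>) \<in> rates_until p (ereal T) \<and> Lp_integral p (\<lambda>\<theta>. \<Sum>e\<in>S. h e \<theta>) \<le> B"
    by blast
  show ?case
  proof (intro exI[of _ "2 powr p * (M + B)"] allI impI)
    fix h assume h: "\<forall>e\<in>insert e S. h e \<in> rates_until p (ereal T) \<and> Lp_integral p (h e) \<le> M"
    then have hS: "(\<lambda>\<theta>. \<Sum>e\<in>S. h e \<theta>) \<in> rates_until p (ereal T)" "Lp_integral p (\<lambda>\<theta>. \<Sum>e\<in>S. h e \<theta>) \<le> B"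
      using B[of h] by auto
    have he: "h e \<in> rates_until p (ereal T)" "Lp_integral p (h e) \<le> M" using h by auto
    have "Lp_integral p (\<lambda>\<theta>. h e \<theta> + (\<Sum>e\<in>S. h e \<theta>)) \<le> 2 powr p * (Lp_integral p (h e) + Lp_integral p (\<lambda>\<theta>. \<Sum>e\<in>S. h e \<theta>))"
      using p by (intro Lp_add rates_untilD(1)[OF he(1)] rates_untilD(1)[OF hS(1)]) simp
    also have "\<dots> \<le> 2 powr p * (M + B)" by (intro mult_left_mono add_mono he hS) simp
    finally show "(\<lambda>\<theta>. \<Sum>e\<in>insert e S. h e \<theta>) \<in> rates_until p (ereal T) \<and>
      Lp_integral p (\<lambda>\<theta>. \<Sum>e\<in>insert e S. h e \<theta>) \<le> 2 powr p * (M + B)"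
      using rates_until_combination[of p "h e" T "\<lambda>\<theta>. \<Sum>e\<in>S. h e \<theta>" 1 1] p he(1) hS(1) insert.hyps
      by simp
  qed
qed

lemma weakly_converges_test_integral:
  assumes "1 \<le> p" "finite K" "weakly_converges p K x y" "k \<in> K"
  shows "(\<lambda>n. test_integral k s (x n)) \<longlonglongrightarrow> test_integral k s y"
  using assms test_integral_in_Lp_dual[OF assms(1,2,4)] by (auto simp: weakly_converges_def)

lemma join_eqD:
  assumes "join ((f, g), h) = join ((f', g'), h')"
  shows "f = f'" "g = g'" "h = h'"
  using fun_cong[OF assms, of "Inl (Inl _)"] fun_cong[OF assms, of "Inl (Inr _)"] fun_cong[OF assms, of "Inr _"]
  by (auto simp: join_def)

section \<open>The rerouting correspondence\<close>

locale dynamic_flow_problem =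
  fixes p T :: real
    and G :: "('v, 'e) pre_digraph"
    and I :: "'i set"
    and t :: "'i \<Rightarrow> 'v"
    and u :: "'v \<times> 'i \<Rightarrow> real \<Rightarrow> real"
    and \<Phi> :: "('e, 'i) loading"
    and \<R> :: "('e, 'i) routing"
  assumes p: "1 < p"
    and G: "fin_digraph G"
    and I: "finite I"
    and u: "u \<in> vectors (verts G \<times> I) (rates p)"
    and T: "0 \<le> T"
    and loading: "edge_loading_operator p G I \<Phi>"
    and bounded: "locally_bounded p G I \<Phi>"
    and loading_cont: "seq_weak_weak_continuous_on p (arcs G \<times> I) (arcs G \<times> I)
           (vectors (arcs G \<times> I) (rates_until p T)) (loading_until T \<Phi>)"
    and routing: "routing_operator p G I t \<R>"
    and regular: "regular_routing_until p T G I \<R>"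
    and routing_values: "\<forall>f\<in>vectors (flow_index G I) (rates_until p T).
           routing_until T G I \<R> f \<noteq> {} \<and> convex_vectors (routing_until T G I \<R> f)"
begin

sublocale fin_digraph G by (rule G)

abbreviation "A \<equiv> arcs G \<times> I"
abbreviation "N \<equiv> verts G \<times> I"
abbreviation "W \<equiv> rates_until p (ereal T)"

lemma fin: "finite A" "finite N" "finite (flow_index G I)"
proof -
  have "UNIV = {Inflow, Outflow}" by (auto intro: side.exhaust)
  then have "finite (UNIV :: side set)" by (metis finite.emptyI finite.insertI)
  then show "finite A" "finite N" "finite (flow_index G I)" using I by (auto simp: flow_index_def)
qed

lemma p_pos: "0 < p" "0 \<le> p" "1 \<le> p" using p by auto

text \<open>Consistency with \<open>\<Phi>\<close> is built in. Truncating the outflows keeps the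
  flow in the space up to time \<open>T\<close> and changes nothing before \<open>T\<close>.\<close>

definition induced_flow :: "('e \<times> 'i \<Rightarrow> real \<Rightarrow> real) \<Rightarrow> ('e, 'i) flow" where
  "induced_flow x = (\<lambda>(e, i, s). case s of Inflow \<Rightarrow> x (e, i) | Outflow \<Rightarrow> loading_until T \<Phi> x (e, i))"

text \<open>The right-hand side of flow conservation, cut off at \<open>T\<close>. The edge inflows
  enter through the loading operator only.\<close>

definition node_inflow :: "('e \<times> 'i \<Rightarrow> real \<Rightarrow> real) \<Rightarrow> 'v \<times> 'i \<Rightarrow> real \<Rightarrow> real" where
  "node_inflow x = (\<lambda>(v, i) \<theta>. of_bool (v \<noteq> t i) *
     (indicator {0..T} \<theta> * u (v, i) \<theta> + (\<Sum>e\<in>in_arcs G v. loading_until T \<Phi> x (e, i) \<theta>)))"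

text \<open>The fibre of \<open>routing_graph\<close> over the pair
  \<open>(induced_flow x, node_inflow x)\<close>.\<close>

definition reroute :: "('e \<times> 'i \<Rightarrow> real \<Rightarrow> real) \<Rightarrow> ('e \<times> 'i \<Rightarrow> real \<Rightarrow> real) set" where
  "reroute x = {h \<in> vectors A W. \<exists>r\<in>routing_until T G I \<R> (induced_flow x).
     \<forall>e\<in>arcs G. \<forall>i\<in>I. AE \<theta> in lebesgue. h (e, i) \<theta> = r (e, i) \<theta> * node_inflow x (tail G e, i) \<theta>}"

lemma vectors_W_rates: "x \<in> vectors K W \<Longrightarrow> x \<in> vectors K (rates p)"
  unfolding vectors_def Pi_iff using rates_until_subset_rates by blast

lemma loading_rates: "x \<in> vectors A W \<Longrightarrow> \<Phi> x \<in> vectors A (rates p)"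
  using loading vectors_W_rates by (auto simp: edge_loading_operator_def)

lemma loading_W:
  assumes "x \<in> vectors A W"
  shows "loading_until T \<Phi> x \<in> vectors A W"
  by (rule vectorsI) (simp add: loading_until_def truncate_def truncate_rates vectorsD[OF loading_rates[OF assms]])

lemma loading_bound: "\<exists>B. \<forall>x\<in>vectors A W. \<forall>k\<in>A. Lp_integral p (loading_until T \<Phi> x k) \<le> B"
proof -
  obtain B where "\<And>x. x \<in> vectors A (rates p) \<Longrightarrow> vec_norm p A (truncate T (\<Phi> x)) \<le> B"
    using bounded T unfolding locally_bounded_def by blast
  then show ?thesis
    using Lp_integral_le_vec_norm[OF p_pos(1) fin(1)] vectors_W_rates unfolding loading_until_def by blast
qed

text \<open>Local boundedness limits the outflows for all \<open>x\<close> at once, so the ball can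
  be chosen afterwards with this very bound.\<close>

lemma node_inflow_bound:
  "\<exists>B. \<forall>x\<in>vectors A W. \<forall>k\<in>N. node_inflow x k \<in> W \<and> Lp_integral p (node_inflow x k) \<le> B"
proof -
  obtain B where B: "\<And>x k. x \<in> vectors A W \<Longrightarrow> k \<in> A \<Longrightarrow> Lp_integral p (loading_until T \<Phi> x k) \<le> B"
    using loading_bound by blast
  have "\<exists>C. \<forall>x\<in>vectors A W. node_inflow x k \<in> W \<and> Lp_integral p (node_inflow x k) \<le> C" if k: "k \<in> N" for k
  proof -
    obtain v i where vi: "k = (v, i)" "v \<in> verts G" "i \<in> I" using k by auto
    obtain D where D: "\<And>h. (\<forall>e\<in>in_arcs G v. h e \<in> W \<and> Lp_integral p (h e) \<le> B) \<Longrightarrow>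
       (\<lambda>\<theta>. \<Sum>e\<in>in_arcs G v. h e \<theta>) \<in> W \<and> Lp_integral p (\<lambda>\<theta>. \<Sum>e\<in>in_arcs G v. h e \<theta>) \<le> D"
      using rates_until_sum_bounded[OF p_pos(1) finite_in_arcs[of v], of T B] by blast
    define U where "U = (\<lambda>\<theta>. indicator {0..T} \<theta> * u (v, i) \<theta>)"
    have U: "U \<in> W" unfolding U_def using vectorsD[OF u k] by (simp add: truncate_rates vi)
    show ?thesis
    proof (intro exI[of _ "2 powr p * (Lp_integral p U + D)"] ballI)
      fix x assume x: "x \<in> vectors A W"
      define V where "V = (\<lambda>\<theta>. \<Sum>e\<in>in_arcs G v. loading_until T \<Phi> x (e, i) \<theta>)"
      have V: "V \<in> W" "Lp_integral p V \<le> D"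
        unfolding V_def using D[of "\<lambda>e. loading_until T \<Phi> x (e, i)"] B[OF x] vectorsD[OF loading_W[OF x]] vi
        by auto
      have sum: "(\<lambda>\<theta>. U \<theta> + V \<theta>) \<in> W"
        using rates_until_combination[OF p_pos(2) U V(1), of 1 1] by simp
      have "Lp_integral p (\<lambda>\<theta>. U \<theta> + V \<theta>) \<le> 2 powr p * (Lp_integral p U + Lp_integral p V)"
        by (intro Lp_add p_pos rates_untilD(1)[OF U] rates_untilD(1)[OF V(1)])
      also have "\<dots> \<le> 2 powr p * (Lp_integral p U + D)" using V by (intro mult_left_mono add_left_mono) auto
      finally have le: "Lp_integral p (\<lambda>\<theta>. U \<theta> + V \<theta>) \<le> 2 powr p * (Lp_integral p U + D)" .
      \<comment> \<open>Needed at a destination, where the node inflow is zero.\<close>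
      have "0 \<le> 2 powr p * (Lp_integral p U + D)" using order.trans[OF Lp_integral_nonneg le] .
      moreover have "node_inflow x k = (if v \<noteq> t i then (\<lambda>\<theta>. U \<theta> + V \<theta>) else (\<lambda>\<theta>. 0))"
        by (auto simp: node_inflow_def vi U_def V_def)
      ultimately show "node_inflow x k \<in> W \<and> Lp_integral p (node_inflow x k) \<le> 2 powr p * (Lp_integral p U + D)"
        using sum le p_pos rates_until_zero by simp
    qed
  qed
  then obtain C where C: "\<And>k x. k \<in> N \<Longrightarrow> x \<in> vectors A W \<Longrightarrow> node_inflow x k \<in> W \<and> Lp_integral p (node_inflow x k) \<le> C k"
    by metis
  show ?thesis
  proof (intro exI[of _ "\<Sum>k\<in>N. \<bar>C k\<bar>"] ballI conjI)
    fix x k assume x: "x \<in> vectors A W" and k: "k \<in> N"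
    show "node_inflow x k \<in> W" using C[OF k x] by simp
    have "Lp_integral p (node_inflow x k) \<le> C k" using C[OF k x] by simp
    also have "\<dots> \<le> \<bar>C k\<bar>" by simp
    also have "\<dots> \<le> (\<Sum>k\<in>N. \<bar>C k\<bar>)" by (rule member_le_sum[OF k]) (use fin in auto)
    finally show "Lp_integral p (node_inflow x k) \<le> (\<Sum>k\<in>N. \<bar>C k\<bar>)" .
  qed
qed

lemma node_inflow_W: "x \<in> vectors A W \<Longrightarrow> node_inflow x \<in> vectors N W"
  using node_inflow_bound by (auto intro: vectorsI)

lemma induced_flow_W: "x \<in> vectors A W \<Longrightarrow> induced_flow x \<in> vectors (flow_index G I) W"
  using vectorsD[of x A W] vectorsD[OF loading_W]
  by (intro vectorsI) (auto simp: flow_index_def induced_flow_def split: side.split)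

lemma routing_until_shares:
  assumes "r \<in> routing_until T G I \<R> f" "k \<in> A"
  shows "r k \<in> borel_measurable lebesgue" "AE \<theta> in lebesgue. 0 \<le> r k \<theta> \<and> r k \<theta> \<le> 1"
  using assms by (auto simp: routing_until_def shares_until_def shares_def dest: vectorsD)

lemma routed_W:
  assumes g: "g \<in> W" and r: "r \<in> routing_until T G I \<R> f" "k \<in> A"
  shows "(\<lambda>\<theta>. r k \<theta> * g \<theta>) \<in> W" "Lp_integral p (\<lambda>\<theta>. r k \<theta> * g \<theta>) \<le> Lp_integral p g"
proof -
  note g' = rates_untilD[OF g] and r' = routing_until_shares[OF r]
  have "AE \<theta> in lebesgue. \<bar>r k \<theta> * g \<theta>\<bar> \<le> \<bar>g \<theta>\<bar>"
    using r'(2) by eventually_elim (auto simp: abs_mult intro: mult_left_le_one_le)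
  moreover have "(\<lambda>\<theta>. r k \<theta> * g \<theta>) \<in> borel_measurable lebesgue"
    using r'(1) LpD(1)[OF g'(1)] by simp
  ultimately have L: "(\<lambda>\<theta>. r k \<theta> * g \<theta>) \<in> Lp p" "Lp_integral p (\<lambda>\<theta>. r k \<theta> * g \<theta>) \<le> Lp_integral p g"
    using Lp_dominated[OF p_pos(2) _ g'(1)] by blast+
  have "AE \<theta> in lebesgue. 0 \<le> r k \<theta> * g \<theta>"
    using r'(2) g'(2) by eventually_elim simp
  moreover have "AE \<theta> in lebesgue. \<theta> \<notin> {0..T} \<longrightarrow> r k \<theta> * g \<theta> = 0"
    using g'(3) by eventually_elim simp
  ultimately show "(\<lambda>\<theta>. r k \<theta> * g \<theta>) \<in> W" using L(1) by (simp only: rates_until_iff)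
  show "Lp_integral p (\<lambda>\<theta>. r k \<theta> * g \<theta>) \<le> Lp_integral p g" by (rule L(2))
qed

lemma reroute_bound:
  assumes x: "x \<in> vectors A W" and h: "h \<in> reroute x"
    and B: "\<And>k. k \<in> N \<Longrightarrow> Lp_integral p (node_inflow x k) \<le> B" and k: "k \<in> A"
  shows "Lp_integral p (h k) \<le> B"
proof -
  obtain e i where ei: "k = (e, i)" "e \<in> arcs G" "i \<in> I" using k by auto
  then have tN: "(tail G e, i) \<in> N" by simp
  obtain r where r: "r \<in> routing_until T G I \<R> (induced_flow x)"
    and hr: "AE \<theta> in lebesgue. h k \<theta> = r k \<theta> * node_inflow x (tail G e, i) \<theta>"
    using h ei unfolding reroute_def by blast
  note n = vectorsD[OF node_inflow_W[OF x] tN]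
  have hk: "h k \<in> W" using h k by (auto simp: reroute_def dest: vectorsD)
  have "Lp_integral p (h k) = Lp_integral p (\<lambda>\<theta>. r k \<theta> * node_inflow x (tail G e, i) \<theta>)"
    by (rule Lp_integral_cong_AE[OF _ _ hr])
      (use hk routed_W(1)[OF n r k] in \<open>auto dest!: rates_untilD(1) LpD(1)\<close>)
  also have "\<dots> \<le> B" using routed_W(2)[OF n r k] B[OF tN] by (rule order.trans)
  finally show ?thesis .
qed

lemma reroute_nonempty:
  assumes x: "x \<in> vectors A W"
  shows "reroute x \<noteq> {}"
proof -
  obtain r where r: "r \<in> routing_until T G I \<R> (induced_flow x)"
    using routing_values induced_flow_W[OF x] by blast
  define h where "h = (\<lambda>(e, i) \<theta>. r (e, i) \<theta> * node_inflow x (tail G e, i) \<theta>)"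
  have "h \<in> vectors A W"
  proof (rule vectorsI)
    fix k assume k: "k \<in> A"
    then obtain e i where ei: "k = (e, i)" "e \<in> arcs G" "i \<in> I" by auto
    then have "(tail G e, i) \<in> N" by simp
    from routed_W(1)[OF vectorsD[OF node_inflow_W[OF x] this] r k] show "h k \<in> W"
      by (simp add: h_def ei)
  qed
  then have "h \<in> reroute x" using r by (auto simp: reroute_def h_def)
  then show ?thesis by blast
qed

text \<open>Both elements multiply the same node inflow, so mixing them amounts to mixing their
  shares.\<close>

lemma reroute_convex:
  assumes x: "x \<in> vectors A W" and h: "h \<in> reroute x" and h': "h' \<in> reroute x"
    and ab: "0 \<le> a" "0 \<le> b" "a + b = 1"
  shows "(\<lambda>k \<theta>. a * h k \<theta> + b * h' k \<theta>) \<in> reroute x"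
proof -
  obtain r where r: "r \<in> routing_until T G I \<R> (induced_flow x)"
    and hr: "\<And>e i. e \<in> arcs G \<Longrightarrow> i \<in> I \<Longrightarrow> AE \<theta> in lebesgue. h (e, i) \<theta> = r (e, i) \<theta> * node_inflow x (tail G e, i) \<theta>"
    using h unfolding reroute_def by blast
  obtain r' where r': "r' \<in> routing_until T G I \<R> (induced_flow x)"
    and hr': "\<And>e i. e \<in> arcs G \<Longrightarrow> i \<in> I \<Longrightarrow> AE \<theta> in lebesgue. h' (e, i) \<theta> = r' (e, i) \<theta> * node_inflow x (tail G e, i) \<theta>"
    using h' unfolding reroute_def by blast
  have "(\<lambda>k \<theta>. a * r k \<theta> + b * r' k \<theta>) \<in> routing_until T G I \<R> (induced_flow x)"
    using routing_values induced_flow_W[OF x] r r' ab unfolding convex_vectors_def by blast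
  moreover have "AE \<theta> in lebesgue. a * h (e, i) \<theta> + b * h' (e, i) \<theta>
      = (a * r (e, i) \<theta> + b * r' (e, i) \<theta>) * node_inflow x (tail G e, i) \<theta>"
    if "e \<in> arcs G" "i \<in> I" for e i
    using hr[OF that] hr'[OF that] by eventually_elim (simp add: algebra_simps)
  moreover have "(\<lambda>k \<theta>. a * h k \<theta> + b * h' k \<theta>) \<in> vectors A W"
    using h h' ab by (intro vectorsI rates_until_combination p_pos) (auto simp: reroute_def dest: vectorsD)
  ultimately show ?thesis
    unfolding reroute_def by (intro CollectI conjI bexI[of _ "\<lambda>k \<theta>. a * r k \<theta> + b * r' k \<theta>"]) auto
qed

text \<open>Makes rerouting a correspondence between classes, as needed for its transfer to
  coordinates.\<close>

lemma reroute_cong: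
  assumes x: "x \<in> vectors A W" and y: "y \<in> vectors A W" and xy: "ae_eq_on A x y" and h: "h \<in> reroute x"
  shows "h \<in> reroute y"
proof -
  have "ae_eq_on A (\<Phi> x) (\<Phi> y)"
    using loading x y xy vectors_W_rates unfolding edge_loading_operator_def by blast
  then have load: "AE \<theta> in lebesgue. loading_until T \<Phi> x k \<theta> = loading_until T \<Phi> y k \<theta>" if "k \<in> A" for k
    using that by (auto simp: ae_eq_on_def loading_until_def truncate_def elim!: eventually_mono)
  have "ae_eq_on (flow_index G I) (induced_flow x) (induced_flow y)"
    using xy load by (auto simp: ae_eq_on_def flow_index_def induced_flow_def split: side.split)
  then have "\<R> (induced_flow x) = \<R> (induced_flow y)"
    using routing vectors_W_rates[OF induced_flow_W[OF x]] vectors_W_rates[OF induced_flow_W[OF y]]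
    unfolding routing_operator_def by blast
  then have R: "routing_until T G I \<R> (induced_flow x) = routing_until T G I \<R> (induced_flow y)"
    by (simp add: routing_until_def)
  have node: "AE \<theta> in lebesgue. node_inflow x (v, i) \<theta> = node_inflow y (v, i) \<theta>" if "i \<in> I" for v i
  proof -
    have "AE \<theta> in lebesgue. \<forall>e\<in>in_arcs G v. loading_until T \<Phi> x (e, i) \<theta> = loading_until T \<Phi> y (e, i) \<theta>"
      using that load by (intro AE_finite_allI) auto
    then show ?thesis by eventually_elim (simp add: node_inflow_def)
  qed
  obtain r where r: "r \<in> routing_until T G I \<R> (induced_flow x)"
    and hr: "\<And>e i. e \<in> arcs G \<Longrightarrow> i \<in> I \<Longrightarrow> AE \<theta> in lebesgue. h (e, i) \<theta> = r (e, i) \<theta> * node_inflow x (tail G e, i) \<theta>"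
    using h unfolding reroute_def by blast
  have "AE \<theta> in lebesgue. h (e, i) \<theta> = r (e, i) \<theta> * node_inflow y (tail G e, i) \<theta>"
    if "e \<in> arcs G" "i \<in> I" for e i
    using hr[OF that] node[OF that(2), of "tail G e"] by eventually_elim simp
  then show ?thesis using h r R by (auto simp: reroute_def)
qed

text \<open>Regularity is applied to the joined triples of induced flow, node inflow and new edge
  inflow. Their weak convergence is read off from moments: those of the outflows converge by
  continuity of the loading operator, and those of the node inflow are affine in them.\<close>

lemma reroute_closed:
  assumes x: "\<And>n. x n \<in> Lp_ball p T A M" "y \<in> Lp_ball p T A M" "(\<lambda>n. coords A (x n)) \<longlonglongrightarrow> coords A y"
    and h: "\<And>n. h n \<in> Lp_ball p T A M" "g \<in> Lp_ball p T A M" "(\<lambda>n. coords A (h n)) \<longlonglongrightarrow> coords A g"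
    and hx: "\<And>n. h n \<in> reroute (x n)"
  shows "g \<in> reroute y"
proof -
  note weak_x = weakly_convergesI_coords[OF p fin(1) x] and weak_h = weakly_convergesI_coords[OF p fin(1) h]
  have xW: "x n \<in> vectors A W" for n using x(1) by (simp add: Lp_ball_def)
  have yW: "y \<in> vectors A W" using x(2) by (simp add: Lp_ball_def)
  have hW: "h n \<in> vectors A W" for n using h(1) by (simp add: Lp_ball_def)
  have gW: "g \<in> vectors A W" using h(2) by (simp add: Lp_ball_def)
  have weak_load: "weakly_converges p A (\<lambda>n. loading_until T \<Phi> (x n)) (loading_until T \<Phi> y)"
    using loading_cont weak_x xW yW unfolding seq_weak_weak_continuous_on_def by blast
  obtain B where B: "\<And>x k. x \<in> vectors A W \<Longrightarrow> k \<in> A \<Longrightarrow> Lp_integral p (loading_until T \<Phi> x k) \<le> B"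
    using loading_bound by blast
  obtain C where C: "\<And>x k. x \<in> vectors A W \<Longrightarrow> k \<in> N \<Longrightarrow> Lp_integral p (node_inflow x k) \<le> C"
    using node_inflow_bound by blast
  \<comment> \<open>One bound for all components of the triple: \<open>M\<close> for edge inflows
    old and new, \<open>B\<close> for outflows, \<open>C\<close> for node inflows.\<close>
  define D where "D = max M (max B C)"
  let ?J = "(flow_index G I <+> N) <+> A"
  define X where "X n = join ((induced_flow (x n), node_inflow (x n)), h n)" for n
  define Y where "Y = join ((induced_flow y, node_inflow y), g)"
  have memb: "join ((induced_flow x, node_inflow x), h) \<in> vectors ?J W"
    if "x \<in> vectors A W" "h \<in> vectors A W" for x h
    using induced_flow_W[OF that(1)] node_inflow_W[OF that(1)] that(2)
    by (auto simp: vectors_def Pi_iff join_def)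
  have bound: "Lp_integral p (X n k) \<le> D" if "k \<in> ?J" for n k
    using that B[OF xW] C[OF xW] x(1)[of n] h(1)[of n]
    by (auto simp: X_def join_def D_def flow_index_def induced_flow_def Lp_ball_def le_max_iff_disj split: side.split)
  have tint: "(\<lambda>n. test_integral (e, i) s (x n)) \<longlonglongrightarrow> test_integral (e, i) s y"
    "(\<lambda>n. test_integral (e, i) s (h n)) \<longlonglongrightarrow> test_integral (e, i) s g"
    "(\<lambda>n. test_integral (e, i) s (loading_until T \<Phi> (x n))) \<longlonglongrightarrow> test_integral (e, i) s (loading_until T \<Phi> y)"
    if "e \<in> arcs G" "i \<in> I" for e i s
    using that weak_x weak_h weak_load
    by (auto intro!: weakly_converges_test_integral[OF p_pos(3) fin(1)])
  have node: "test_integral (v, i) s (node_inflow x) = of_bool (v \<noteq> t i) *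
      ((LINT \<theta>|lebesgue. indicator {0..s} \<theta> * (indicator {0..T} \<theta> * u (v, i) \<theta>))
        + (\<Sum>e\<in>in_arcs G v. test_integral (e, i) s (loading_until T \<Phi> x)))"
    if x: "x \<in> vectors A W" and vi: "v \<in> verts G" "i \<in> I" for x v i s
  proof -
    have 1: "integrable lebesgue (\<lambda>\<theta>. indicator {0..s} \<theta> * (indicator {0..T} \<theta> * u (v, i) \<theta>))"
      using vi by (intro Lp_indicator_integral(1)[OF p_pos(3)] rates_untilD(1)[OF truncate_rates] vectorsD[OF u]) auto
    have 2: "integrable lebesgue (\<lambda>\<theta>. indicator {0..s} \<theta> * loading_until T \<Phi> x (e, i) \<theta>)"
      if "e \<in> in_arcs G v" for e
      using vi that by (intro Lp_indicator_integral(1)[OF p_pos(3)] rates_untilD(1)[of _ p T] vectorsD[OF loading_W[OF x]]) auto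
    have "(LINT \<theta>|lebesgue. indicator {0..s} \<theta> * (indicator {0..T} \<theta> * u (v, i) \<theta>)
          + (\<Sum>e\<in>in_arcs G v. indicator {0..s} \<theta> * loading_until T \<Phi> x (e, i) \<theta>))
        = (LINT \<theta>|lebesgue. indicator {0..s} \<theta> * (indicator {0..T} \<theta> * u (v, i) \<theta>))
          + (\<Sum>e\<in>in_arcs G v. LINT \<theta>|lebesgue. indicator {0..s} \<theta> * loading_until T \<Phi> x (e, i) \<theta>)"
    proof -
      have 3: "integrable lebesgue (\<lambda>\<theta>. \<Sum>e\<in>in_arcs G v. indicator {0..s} \<theta> * loading_until T \<Phi> x (e, i) \<theta>)"
        by (intro Bochner_Integration.integrable_sum 2)
      have "(LINT \<theta>|lebesgue. (\<Sum>e\<in>in_arcs G v. indicator {0..s} \<theta> * loading_until T \<Phi> x (e, i) \<theta>))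
          = (\<Sum>e\<in>in_arcs G v. LINT \<theta>|lebesgue. indicator {0..s} \<theta> * loading_until T \<Phi> x (e, i) \<theta>)"
        by (intro Bochner_Integration.integral_sum 2)
      with Bochner_Integration.integral_add[OF 1 3] show ?thesis by simp
    qed
    then show ?thesis
      by (simp add: test_integral_def node_inflow_def distrib_left sum_distrib_left)
  qed
  have "weakly_converges p ?J X Y"
  proof (rule weakly_convergesI_test_integral[OF p _ _ _ bound])
    show "finite ?J" using fin by simp
    show "X n \<in> vectors ?J W" for n unfolding X_def by (rule memb[OF xW hW])
    show "Y \<in> vectors ?J W" unfolding Y_def by (rule memb[OF yW gW])
    fix k and s :: real assume k: "k \<in> ?J"
    then consider e i where "k = Inl (Inl (e, i, Inflow))" "e \<in> arcs G" "i \<in> I"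
      | e i where "k = Inl (Inl (e, i, Outflow))" "e \<in> arcs G" "i \<in> I"
      | v i where "k = Inl (Inr (v, i))" "v \<in> verts G" "i \<in> I"
      | e i where "k = Inr (e, i)" "e \<in> arcs G" "i \<in> I"
      by (auto simp: flow_index_def) (metis side.exhaust)
    then show "(\<lambda>n. test_integral k s (X n)) \<longlonglongrightarrow> test_integral k s Y"
    proof cases
      case 1
      then show ?thesis using tint(1)[of e i s] by (simp add: X_def Y_def join_def induced_flow_def test_integral_def)
    next
      case 2
      then show ?thesis using tint(3)[of e i s] by (simp add: X_def Y_def join_def induced_flow_def test_integral_def)
    next
      case 3
      have "(\<lambda>n. test_integral (v, i) s (node_inflow (x n))) \<longlonglongrightarrow> test_integral (v, i) s (node_inflow y)"
        unfolding node[OF xW 3(2,3)] node[OF yW 3(2,3)]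
        by (intro tendsto_intros tint) (use 3 in auto)
      with 3 show ?thesis by (simp add: X_def Y_def join_def test_integral_def)
    next
      case 4
      then show ?thesis using tint(2)[of e i s] by (simp add: X_def Y_def join_def test_integral_def)
    qed
  qed
  moreover have "((induced_flow x, node_inflow x), h) \<in> routing_graph p T G I \<R> \<longleftrightarrow> h \<in> reroute x"
    if "x \<in> vectors A W" for x h
    using induced_flow_W[OF that] node_inflow_W[OF that] by (auto simp: routing_graph_def reroute_def)
  note graph = this
  have "X n \<in> join ` routing_graph p T G I \<R>" for n
    unfolding X_def using graph[OF xW] hx by blast
  ultimately have "Y \<in> join ` routing_graph p T G I \<R>"
    using regular unfolding regular_routing_until_def seq_weakly_closed_def by blast
  then have "((induced_flow y, node_inflow y), g) \<in> routing_graph p T G I \<R>"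
    unfolding Y_def by (auto dest: join_eqD)
  then show ?thesis using graph[OF yW] by simp
qed

lemma reroute_fixed_point: "\<exists>x\<in>vectors A W. x \<in> reroute x"
proof -
  obtain M where M: "\<And>x k. x \<in> vectors A W \<Longrightarrow> k \<in> N \<Longrightarrow> Lp_integral p (node_inflow x k) \<le> M"
    using node_inflow_bound by blast
  define S where "S = Lp_ball p T A M"
  have S: "x \<in> vectors A W" if "x \<in> S" for x using that by (simp add: S_def Lp_ball_def)
  have reroute_S: "h \<in> S" if "x \<in> vectors A W" "h \<in> reroute x" for x h
    using reroute_bound[OF that M[OF that(1)]] that by (auto simp: S_def Lp_ball_def reroute_def)
  define \<Gamma> where "\<Gamma> c = {coords A h |x h. x \<in> S \<and> coords A x = c \<and> h \<in> reroute x}" for c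
  have coords_S: "ae_eq_on A x y" if "x \<in> S" "y \<in> S" "coords A x = coords A y" for x y
    using coords_eq_iff[OF p_pos(3) fin(1) S S] that by blast
  have comp: "compact (coords A ` S)" unfolding S_def by (rule compact_coords_Lp_ball[OF p fin(1)])
  have "(\<lambda>k \<theta>. 0) \<in> vectors A W" by (rule vectorsI) (rule rates_until_zero[OF p_pos(1)])
  then have "S \<noteq> {}" using reroute_nonempty reroute_S by blast
  have "\<exists>c\<in>coords A ` S. c \<in> \<Gamma> c"
  proof (rule Kakutani_sequences[OF comp])
    show "coords A ` S \<noteq> {}" using \<open>S \<noteq> {}\<close> by simp
    show "convex_functions (coords A ` S)" unfolding S_def by (rule convex_coords_Lp_ball[OF p])
    fix c assume "c \<in> coords A ` S"
    then obtain x where x: "x \<in> S" "c = coords A x" by blast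
    have "\<Gamma> c \<noteq> {}" using x reroute_nonempty[OF S[OF x(1)]] by (auto simp: \<Gamma>_def)
    moreover have "\<Gamma> c \<subseteq> coords A ` S" using reroute_S S by (auto simp: \<Gamma>_def)
    moreover have "convex_functions (\<Gamma> c)" unfolding convex_functions_def
    proof (intro ballI allI impI)
      fix d d' and a b :: real assume d: "d \<in> \<Gamma> c" "d' \<in> \<Gamma> c" and ab: "0 \<le> a" "0 \<le> b" "a + b = 1"
      \<comment> \<open>By \<open>reroute_cong\<close> one fixed representative \<open>x\<close>
        produces all of \<open>\<Gamma> c\<close>, so that two values can be mixed.\<close>
      have ex: "\<exists>h\<in>reroute x. d = coords A h" if "d \<in> \<Gamma> c" for d
        using that x coords_S S reroute_cong unfolding \<Gamma>_def by blast
      obtain h h' where h: "h \<in> reroute x" "d = coords A h" "h' \<in> reroute x" "d' = coords A h'"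
        using ex[OF d(1)] ex[OF d(2)] by blast
      have L: "h \<in> vectors A (Lp p)" "h' \<in> vectors A (Lp p)"
        using h vectors_rates_until_Lp by (auto simp: reroute_def)
      have "(\<lambda>k \<theta>. a * h k \<theta> + b * h' k \<theta>) \<in> reroute x"
        by (rule reroute_convex[OF S[OF x(1)] h(1,3) ab])
      moreover have "(\<lambda>j. a * d j + b * d' j) = coords A (\<lambda>k \<theta>. a * h k \<theta> + b * h' k \<theta>)"
        unfolding h(2,4) by (rule coords_affine[OF p_pos(3) L, symmetric])
      ultimately show "(\<lambda>j. a * d j + b * d' j) \<in> \<Gamma> c"
        unfolding \<Gamma>_def using x by blast
    qed
    ultimately show "\<Gamma> c \<noteq> {} \<and> \<Gamma> c \<subseteq> coords A ` S \<and> convex_functions (\<Gamma> c)" by blast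
  next
    fix X Y :: "nat \<Rightarrow> nat \<Rightarrow> real" and c d
    assume XY: "\<And>n. X n \<in> coords A ` S" "\<And>n. Y n \<in> \<Gamma> (X n)" and lim: "X \<longlonglongrightarrow> c" "Y \<longlonglongrightarrow> d"
    have "\<forall>n. \<exists>x h. x \<in> S \<and> coords A x = X n \<and> h \<in> reroute x \<and> Y n = coords A h"
      using XY(2) unfolding \<Gamma>_def by blast
    then obtain x h where xh: "\<And>n. x n \<in> S" "\<And>n. coords A (x n) = X n" "\<And>n. h n \<in> reroute (x n)"
      "\<And>n. Y n = coords A (h n)"
      by metis
    have hS: "h n \<in> S" for n using reroute_S S xh by blast
    have closed: "closed (coords A ` S)" using comp by (rule compact_imp_closed)
    have "c \<in> coords A ` S" using closed_sequentially[OF closed _ lim(1)] XY(1) by blast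
    then obtain y where y: "y \<in> S" "c = coords A y" by blast
    have "d \<in> coords A ` S" using closed_sequentially[OF closed _ lim(2)] hS xh(4) by blast
    then obtain g where g: "g \<in> S" "d = coords A g" by blast
    have "X = (\<lambda>n. coords A (x n))" "Y = (\<lambda>n. coords A (h n))" using xh by auto
    then have "g \<in> reroute y"
      using lim xh hS y g unfolding S_def by (intro reroute_closed[of x M y h g]) auto
    then show "d \<in> \<Gamma> c" unfolding \<Gamma>_def using y g by blast
  qed
  then obtain x h where xh: "x \<in> S" "h \<in> reroute x" "coords A h = coords A x" by (auto simp: \<Gamma>_def)
  then have hS: "h \<in> S" using reroute_S S by blast
  \<comment> \<open>Equal coordinates give \<open>x\<close> and \<open>h\<close> equal almost
    everywhere, not literally. Replacing \<open>x\<close> by \<open>h\<close> turns this into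
    genuine membership.\<close>
  have "h \<in> reroute h"
    by (rule reroute_cong[OF S[OF xh(1)] S[OF hS] coords_S[OF xh(1) hS] xh(2)]) (simp add: xh)
  then show ?thesis using S[OF hS] by blast
qed

text \<open>Summing the fixed point equation over the edges leaving a node recovers the node inflow,
  because the shares sum to 1 except at the destination, where the node inflow vanishes anyway. This
  yields flow conservation and consistency with the routing together.\<close>

lemma coherent_induced_flow:
  assumes x: "x \<in> vectors A W" and fixed: "x \<in> reroute x"
  shows "coherent_until T G I t u \<Phi> \<R> (induced_flow x)"
proof -
  obtain s where s: "s \<in> routing_until T G I \<R> (induced_flow x)"
    and xs: "\<And>e i. e \<in> arcs G \<Longrightarrow> i \<in> I \<Longrightarrow> AE \<theta> in lebesgue. x (e, i) \<theta> = s (e, i) \<theta> * node_inflow x (tail G e, i) \<theta>"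
    using fixed unfolding reroute_def by blast
  \<comment> \<open>Coherence asks for an element of \<open>\<R>\<close> itself, whereas
    \<open>s\<close> is only a truncated one.\<close>
  obtain r where r: "r \<in> \<R> (induced_flow x)" and sr: "ae_eq_on A s (truncate T r)"
    using s by (auto simp: routing_until_def)
  have sum_r: "AE \<theta> in lebesgue. (\<Sum>e\<in>out_arcs G v. r (e, i) \<theta>) = of_bool (v \<noteq> t i)"
    if "v \<in> verts G" "i \<in> I" for v i
    using routing r that vectors_W_rates[OF induced_flow_W[OF x]] unfolding routing_operator_def by blast
  have in_eq: "edge_inflow (induced_flow x) = x"
    by (auto simp: edge_inflow_def induced_flow_def)
  have out_eq: "edge_outflow (induced_flow x) = loading_until T \<Phi> x"
    by (auto simp: edge_outflow_def induced_flow_def)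
  have 1: "AE \<theta> in lebesgue. \<forall>i\<in>I. \<forall>e\<in>arcs G.
      x (e, i) \<theta> = indicator {0..T} \<theta> * r (e, i) \<theta> * node_inflow x (tail G e, i) \<theta>"
  proof (intro AE_finite_allI I finite_arcs)
    fix i e assume ie: "i \<in> I" "e \<in> arcs G"
    have "AE \<theta> in lebesgue. s (e, i) \<theta> = indicator {0..T} \<theta> * r (e, i) \<theta>"
      using sr ie by (auto simp: ae_eq_on_def truncate_def)
    with xs[OF ie(2,1)] show "AE \<theta> in lebesgue.
      x (e, i) \<theta> = indicator {0..T} \<theta> * r (e, i) \<theta> * node_inflow x (tail G e, i) \<theta>"
      by eventually_elim simp
  qed
  have 2: "AE \<theta> in lebesgue. \<forall>i\<in>I. \<forall>v\<in>verts G. (\<Sum>e\<in>out_arcs G v. r (e, i) \<theta>) = of_bool (v \<noteq> t i)"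
    by (intro AE_finite_allI I finite_verts sum_r)
  have 3: "AE \<theta> in lebesgue. \<forall>i\<in>I. \<forall>v\<in>verts G. \<theta> < 0 \<longrightarrow> u (v, i) \<theta> = 0"
    using u by (intro AE_finite_allI I finite_verts) (auto simp: vectors_def Pi_iff rates_def)
  have 4: "AE \<theta> in lebesgue. \<forall>i\<in>I. \<forall>e\<in>arcs G. \<theta> < 0 \<longrightarrow> \<Phi> x (e, i) \<theta> = 0"
    using loading_rates[OF x] by (intro AE_finite_allI I finite_arcs) (auto simp: vectors_def Pi_iff rates_def)
  have "AE \<theta> in lebesgue. ereal \<theta> < T \<longrightarrow> (\<forall>i\<in>I.
        (\<forall>e\<in>arcs G. loading_until T \<Phi> x (e, i) \<theta> = \<Phi> x (e, i) \<theta>) \<and>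
        (\<forall>v\<in>verts G. (\<Sum>e\<in>out_arcs G v. x (e, i) \<theta>) =
           of_bool (v \<noteq> t i) * (u (v, i) \<theta> + (\<Sum>e\<in>in_arcs G v. loading_until T \<Phi> x (e, i) \<theta>))) \<and>
        (\<forall>e\<in>arcs G. x (e, i) \<theta> = r (e, i) \<theta> * (\<Sum>e'\<in>out_arcs G (tail G e). x (e', i) \<theta>)))"
    using 1 2 3 4
  proof eventually_elim
    case (elim \<theta>)
    show ?case
    proof (intro impI ballI)
      fix i assume "ereal \<theta> < T" and i: "i \<in> I"
      then have \<theta>: "\<theta> < T" by simp
      let ?n = "\<lambda>v. node_inflow x (v, i) \<theta>"
      have load: "loading_until T \<Phi> x (e, i) \<theta> = \<Phi> x (e, i) \<theta>" if "e \<in> arcs G" for e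
        using elim(4) i that \<theta> by (auto simp: loading_until_def truncate_def indicator_def)
      have node: "?n v = of_bool (v \<noteq> t i) * (u (v, i) \<theta> + (\<Sum>e\<in>in_arcs G v. loading_until T \<Phi> x (e, i) \<theta>))"
        if "v \<in> verts G" for v
        using elim(3) i that \<theta> by (auto simp: node_inflow_def indicator_def)
      \<comment> \<open>Coherence also concerns negative times, where the truncated shares may
        differ from \<open>r\<close>; there both products vanish with the node inflow.\<close>
      have node0: "?n v = 0" if "v \<in> verts G" "\<theta> < 0" for v
        using that by (simp add: node_inflow_def loading_until_def truncate_def)
      have xr: "x (e, i) \<theta> = r (e, i) \<theta> * ?n (tail G e)" if "e \<in> arcs G" for e
        using elim(1) i that \<theta> node0[of "tail G e"] by (cases "0 \<le> \<theta>") auto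
      have out: "(\<Sum>e\<in>out_arcs G v. x (e, i) \<theta>) = ?n v" if v: "v \<in> verts G" for v
      proof -
        have "(\<Sum>e\<in>out_arcs G v. x (e, i) \<theta>) = (\<Sum>e\<in>out_arcs G v. r (e, i) \<theta> * ?n v)"
          by (rule sum.cong) (auto simp: xr)
        also have "\<dots> = of_bool (v \<noteq> t i) * ?n v"
          using elim(2) i v by (simp flip: sum_distrib_right)
        also have "\<dots> = ?n v" by (cases "v = t i") (simp_all add: node_inflow_def)
        finally show ?thesis .
      qed
      show "(\<forall>e\<in>arcs G. loading_until T \<Phi> x (e, i) \<theta> = \<Phi> x (e, i) \<theta>) \<and>
        (\<forall>v\<in>verts G. (\<Sum>e\<in>out_arcs G v. x (e, i) \<theta>) =
           of_bool (v \<noteq> t i) * (u (v, i) \<theta> + (\<Sum>e\<in>in_arcs G v. loading_until T \<Phi> x (e, i) \<theta>))) \<and>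
        (\<forall>e\<in>arcs G. x (e, i) \<theta> = r (e, i) \<theta> * (\<Sum>e'\<in>out_arcs G (tail G e). x (e', i) \<theta>))"
        using load node out xr by simp
    qed
  qed
  then show ?thesis
    unfolding coherent_until_def in_eq out_eq using r by blast
qed

lemma exists_coherent_flow:
  "\<exists>f\<in>vectors (flow_index G I) W. coherent_until T G I t u \<Phi> \<R> f"
  using reroute_fixed_point coherent_induced_flow induced_flow_W by blast

end

theorem theorem3p5:
  fixes p T :: real
    and G :: "('v, 'e) pre_digraph"
    and I :: "'i set"
    and t :: "'i \<Rightarrow> 'v"
    and u :: "'v \<times> 'i \<Rightarrow> real \<Rightarrow> real"
    and \<Phi> :: "('e, 'i) loading"
    and \<R> :: "('e, 'i) routing"
  assumes "1 < p"
    and "fin_digraph G"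
    and "finite I"
    and "\<forall>i\<in>I. t i \<in> verts G \<and> (\<forall>v\<in>verts G. reachable G v (t i))"
    and "u \<in> vectors (verts G \<times> I) (rates p)"
    and "0 \<le> T"
    and "edge_loading_operator p G I \<Phi>"
    and "locally_bounded p G I \<Phi>"
    and "seq_weak_weak_continuous_on p (arcs G \<times> I) (arcs G \<times> I)
           (vectors (arcs G \<times> I) (rates_until p T)) (loading_until T \<Phi>)"
    and "routing_operator p G I t \<R>"
    and "regular_routing_until p T G I \<R>"
    and "\<forall>f\<in>vectors (flow_index G I) (rates_until p T).
           routing_until T G I \<R> f \<noteq> {} \<and> convex_vectors (routing_until T G I \<R> f)"
  shows "\<exists>f\<in>vectors (flow_index G I) (rates_until p T). coherent_until T G I t u \<Phi> \<R> f"
proof -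
  interpret dynamic_flow_problem p T G I t u \<Phi> \<R>
    by (intro dynamic_flow_problem.intro assms)
  show ?thesis by (rule exists_coherent_flow)
qed

end
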